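(* Let $\varphi,\tilde\varphi\in L^2(K)$ be compactly supported refinable functions with $\hat\varphi(0)=\hat{\tilde\varphi}(0)=1$, with refinement masks $m_0,\tilde m_0$, i.e. $\hat\varphi(\xi)=m_0(\mathfrak p\xi)\hat\varphi(\mathfrak p\xi)$ and $\hat{\tilde\varphi}(\xi)=\tilde m_0(\mathfrak p\xi)\hat{\tilde\varphi}(\mathfrak p\xi)$, and let $m_\ell,\tilde m_\ell$, $\ell=1,\dots,L$, be further masks. For each $k\in\{1,\dots,q-1\}$ let $\mathcal M(\xi)$ be the $(L+1)\times2$ matrix whose rows are $\big(m_\ell(\xi),\,m_\ell(\xi+\mathfrak pu(k))\big)$, $\ell=0,1,\dots,L$, and let $\mathcal M_0(\xi)$ be the $L\times2$ matrix consisting of its rows $\ell=1,\dots,L$; define $\tilde{\mathcal M}(\xi)$ and $\tilde{\mathcal M}_0(\xi)$ in the same way from $\tilde m_0,\dots,\tilde m_L$. Suppose that for all $k=1,2,\dots,q-1$ (and a.e. $\xi$) $$\mathcal M(\xi)^*\mathcal M(\xi)=I_2,\qquad\tilde{\mathcal M}(\xi)^*\tilde{\mathcal M}(\xi)=I_2,\qquad\mathcal M_0(\xi)^*\tilde{\mathcal M}_0(\xi)=0.$$ For $1\le\ell\le L$ let $\hat\psi_\ell(\xi)=m_\ell(\mathfrak p\xi)\hat\varphi(\mathfrak p\xi)$ and $\hat\phi_\ell(\xi)=\tilde m_\ell(\mathfrak p\xi)\hat{\tilde\varphi}(\mathfrak p\xi)$. Then $\Psi=\{\psi_1,\dots,\psi_L\}$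 and $\Phi=\{\phi_1,\dots,\phi_L\}$ generate orthogonal Parseval wavelet frames; that is, $\mathcal F(\Psi)$ and $\mathcal F(\Phi)$ are Parseval wavelet frames for $L^2(K)$ and they are orthogonal to each other.
   Context: $K$ is a local field (locally compact, non-discrete, totally disconnected) of positive characteristic $p$, with ring of integers $\mathfrak D=\{|x|\le1\}$, prime ideal $\mathfrak B=\{|x|<1\}$, a fixed prime element $\mathfrak p$ (so $\mathfrak B=\mathfrak p\mathfrak D$), and residue field $\mathfrak D/\mathfrak B\cong GF(q)$, $q=p^c$; $|\mathfrak p|=q^{-1}$, and Haar measure $dx$ on $K^+$ is normalized so that $\mathfrak D$ has measure 1. Fix $1=\zeta_0,\zeta_1,\dots,\zeta_{c-1}\in\mathfrak D\setminus\mathfrak B$ spanning over $GF(p)$ a copy of $GF(q)$ in $K$. Let $\chi$ be the character of $K^+$, trivial on $\mathfrak D$, with $\chi(\zeta_\mu\mathfrak p^{-j})=e^{2\pi i/p}$ if $\mu=0$ and $j=1$, and $=1$ if $\mu\in\{1,\dots,c-1\}$ or $j\ne1$. Put $\chi_y(x)=\chi(yx)$. For $0\le n<q$, $n=a_0+a_1p+\dots+a_{c-1}p^{c-1}$ with $0\le a_k<p$, set $u(n)=(a_0+a_1\zeta_1+\dots+a_{c-1}\zeta_{c-1})\mathfrak p^{-1}$; for $n=b_0+b_1q+\dots+b_sq^s$ with $0\le b_k<q$ set $u(n)=u(b_0)+u(b_1)\mathfrak p^{-1}+\dots+u(b_s)\mathfrak p^{-s}$. Then $\{u(n):n\in\mathbb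 N_0\}$ is a complete set of coset representatives of $\mathfrak D$ in $K^+$. Write $\chi_n=\chi_{u(n)}$. The Fourier transform is $\hat f(\xi)=\int_Kf(x)\overline{\chi_\xi(x)}\,dx$ on $L^1(K)\cap L^2(K)$, extended to a unitary operator on $L^2(K)$. A mask is a function of the form $m(\xi)=\frac1{\sqrt q}\sum_{k\in\mathbb N_0}d_k\overline{\chi_k(\xi)}$ with square-summable complex coefficients $d_k$; it satisfies $m(\xi+u(k))=m(\xi)$ for all $k\in\mathbb N_0$. For $\Psi=\{\psi_1,\dots,\psi_L\}\subset L^2(K)$, the wavelet system is $\mathcal F(\Psi)=\{\psi_{\ell,j,k}(x)=q^{j/2}\psi_\ell(\mathfrak p^{-j}x-u(k)):j\in\mathbb Z,\,k\in\mathbb N_0,\,1\le\ell\le L\}$. It is a Parseval wavelet frame if $\sum_{\ell,j,k}|\langle f,\psi_{\ell,j,k}\rangle|^2=\|f\|_2^2$ for all $f\in L^2(K)$. Two wavelet frames $\mathcal F(\Psi)$ and $\mathcal F(\Phi)$ are orthogonal if $\sum_{\ell=1}^L\sum_{j\in\mathbb Z}\sum_{k\in\mathbb N_0}\langle f,\psi_{\ell,j,k}\rangle\phi_{\ell,j,k}=0$ for all $f\in L^2(K)$. $^*$ denotes conjugate transpose. *)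

theory Defs
  imports
    "HOL-Analysis.Analysis"
    "HOL-Computational_Algebra.Computational_Algebra"
    "Jordan_Normal_Form.Schur_Decomposition"
begin

section \<open>Non-archimedean local fields\<close>

text \<open>
  A local field comes with its absolute value \<open>absv\<close>, which induces the topology; the class
  perfect-space says that the topology is not discrete.  Continuity of the field operations and
  total disconnectedness follow from the axioms; the latter is proved below.
\<close>

class local_field = field + metric_space + perfect_space +
  fixes absv :: "'a \<Rightarrow> real"
  assumes dist_absv: "dist x y = absv (x - y)"
    and absv_mult: "absv (x * y) = absv x * absv y"
    and absv_ultrametric: "absv (x + y) \<le> max (absv x) (absv y)"
    and locally_compact_local_field:
      "\<exists>U C. open U \<and> compact C \<and> x \<in> U \<and> U \<subseteq> C"

lemma local_field_totally_disconnected: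
  "connected_component_set UNIV (x :: 'a :: local_field) = {x}"
proof -
  have ultra: "dist a c \<le> max (dist a b) (dist b c)" for a b c :: 'a
    using absv_ultrametric[of "a - b" "b - c"] by (simp add: dist_absv)
  have clopen: "open (ball x e)" "closed (ball x e)" if "e > 0" for e
  proof -
    have "- ball x e = (\<Union>y\<in>- ball x e. ball y e)"
    proof (intro equalityI subsetI)
      fix z assume "z \<in> (\<Union>y\<in>- ball x e. ball y e)"
      then obtain y where y: "dist x y \<ge> e" "dist y z < e" by (auto simp: not_less)
      show "z \<in> - ball x e"
        using ultra[where a=x and b=z and c=y] y by (auto simp: dist_commute max_def split: if_splits)
    next
      fix z assume "z \<in> - ball x e"
      then show "z \<in> (\<Union>y\<in>- ball x e. ball y e)"
        using that by (intro UN_I[of z]) auto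
    qed
    then have "open (- ball x e)" by (metis open_UN open_ball)
    then show "closed (ball x e)" by (simp add: closed_def)
  qed simp
  have "y = x" if xy: "connected_component UNIV x y" for y
  proof (rule ccontr)
    assume "y \<noteq> x"
    then have pos: "dist x y > 0" by simp
    obtain T where T: "connected T" "x \<in> T" "y \<in> T"
      using xy by (auto simp: connected_component_def)
    have "ball x (dist x y) \<inter> T = {} \<or> - ball x (dist x y) \<inter> T = {}"
      using connectedD[OF T(1), of "ball x (dist x y)" "- ball x (dist x y)"] clopen[OF pos]
      by auto
    moreover have "x \<in> ball x (dist x y) \<inter> T" "y \<in> - ball x (dist x y) \<inter> T"
      using T pos by auto
    ultimately show False by blast
  qed
  then show ?thesis by (auto simp: connected_component_refl)
qed

definition ring_of_integers :: "'a::local_field set" where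
  "ring_of_integers = {x. absv x \<le> 1}"

definition prime_ideal :: "'a::local_field set" where
  "prime_ideal = {x. absv x < 1}"

definition residue_classes :: "'a::local_field set set" where
  "residue_classes =
     ring_of_integers //
       {(x, y). x \<in> ring_of_integers \<and> y \<in> ring_of_integers \<and> x - y \<in> prime_ideal}"

definition haar_measure :: "'a::local_field measure \<Rightarrow> bool" where
  "haar_measure M \<longleftrightarrow>
     sets M = sets borel \<and>
     (\<forall>a. \<forall>A\<in>sets borel. emeasure M ((+) a ` A) = emeasure M A) \<and>
     (\<forall>C. compact C \<longrightarrow> emeasure M C < \<infinity>) \<and>
     (\<forall>U. open U \<longrightarrow> U \<noteq> {} \<longrightarrow> emeasure M U > 0)"

definition additive_character :: "('a::local_field \<Rightarrow> complex) \<Rightarrow> bool" where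
  "additive_character chi \<longleftrightarrow>
     continuous_on UNIV chi \<and> (\<forall>x y. chi (x + y) = chi x * chi y) \<and> (\<forall>x. cmod (chi x) = 1)"

definition prime_field_span :: "nat \<Rightarrow> nat \<Rightarrow> (nat \<Rightarrow> 'a::local_field) \<Rightarrow> 'a set" where
  "prime_field_span p c \<zeta> = {\<Sum>k<c. of_nat (a k) * \<zeta> k | a. \<forall>k<c. a k < p}"

text \<open>
  The standing data: the characteristic \<open>p\<close>, the residue field size \<open>q = p ^ c\<close>, the normalized
  Haar measure \<open>M\<close>, the prime element \<open>\<pp>\<close>, the elements \<open>\<zeta>\<close> (only the indices below \<open>c\<close> matter)
  and the basic character \<open>chi\<close>.  The assumption on \<open>absv\<close> of \<open>\<pp>\<close> normalizes the absolute value.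
\<close>

locale local_field_setup =
  fixes M :: "'a::local_field measure"
    and p c q :: nat
    and \<pp> :: 'a
    and \<zeta> :: "nat \<Rightarrow> 'a"
    and chi :: "'a \<Rightarrow> complex"
  assumes char_p: "CHAR('a) = p" "p > 0"
    and q_eq: "q = p ^ c"
    and card_residue_field: "card (residue_classes :: 'a set set) = q"
    and prime_element: "(prime_ideal :: 'a set) = (*) \<pp> ` ring_of_integers"
    and absv_prime_element: "absv \<pp> = 1 / real q"
    and haar: "haar_measure M" "emeasure M ring_of_integers = 1"
    and zeta_0: "\<zeta> 0 = 1"
    and zeta_unit: "\<And>\<mu>. \<mu> < c \<Longrightarrow> \<zeta> \<mu> \<in> ring_of_integers - prime_ideal"
    and zeta_span_card: "card (prime_field_span p c \<zeta>) = q"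
    and zeta_span_subfield:
      "\<And>x y. x \<in> prime_field_span p c \<zeta> \<Longrightarrow> y \<in> prime_field_span p c \<zeta> \<Longrightarrow>
         x - y \<in> prime_field_span p c \<zeta> \<and> x * y \<in> prime_field_span p c \<zeta> \<and>
         inverse x \<in> prime_field_span p c \<zeta>"
    and chi_character: "additive_character chi"
    and chi_trivial: "\<And>x. x \<in> ring_of_integers \<Longrightarrow> chi x = 1"
    and chi_values:
      "\<And>\<mu> (j :: int). \<mu> < c \<Longrightarrow>
         chi (\<zeta> \<mu> * \<pp> powi (- j)) =
           (if \<mu> = 0 \<and> j = 1 then exp (2 * of_real pi * \<i> / of_nat p) else 1)"

text \<open>
  \<open>coset_rep_digit\<close> is \<open>u\<close> on arguments below \<open>q = p ^ c\<close>; \<open>coset_rep\<close> is \<open>u\<close>.  The base-\<open>q\<close>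
  digit \<open>n div q ^ i mod q\<close> vanishes for \<open>i > n\<close>, so cutting the sum off at \<open>i = n\<close> loses nothing.
\<close>

definition coset_rep_digit :: "nat \<Rightarrow> nat \<Rightarrow> 'a \<Rightarrow> (nat \<Rightarrow> 'a) \<Rightarrow> nat \<Rightarrow> 'a::local_field" where
  "coset_rep_digit p c \<pp> \<zeta> n = (\<Sum>k<c. of_nat (n div p ^ k mod p) * \<zeta> k) * inverse \<pp>"

definition coset_rep :: "nat \<Rightarrow> nat \<Rightarrow> 'a \<Rightarrow> (nat \<Rightarrow> 'a) \<Rightarrow> nat \<Rightarrow> 'a::local_field" where
  "coset_rep p c \<pp> \<zeta> n =
     (\<Sum>i\<le>n. coset_rep_digit p c \<pp> \<zeta> (n div (p ^ c) ^ i mod p ^ c) * inverse \<pp> ^ i)"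


section \<open>Square-integrable functions and the Fourier transform\<close>

definition L2 :: "'a measure \<Rightarrow> ('a \<Rightarrow> complex) set" where
  "L2 M = {f \<in> borel_measurable M. integrable M (\<lambda>x. (cmod (f x))\<^sup>2)}"

text \<open>Only meaningful on \<open>L2 M\<close>: the Bochner integral of a non-integrable function is 0.\<close>

definition L2_norm :: "'a measure \<Rightarrow> ('a \<Rightarrow> complex) \<Rightarrow> real" where
  "L2_norm M f = sqrt (\<integral>x. (cmod (f x))\<^sup>2 \<partial>M)"

definition L2_inner :: "'a measure \<Rightarrow> ('a \<Rightarrow> complex) \<Rightarrow> ('a \<Rightarrow> complex) \<Rightarrow> complex" where
  "L2_inner M f g = (\<integral>x. f x * cnj (g x) \<partial>M)"

definition fourier_integral ::
    "'a::local_field measure \<Rightarrow> ('a \<Rightarrow> complex) \<Rightarrow> ('a \<Rightarrow> complex) \<Rightarrow> 'a \<Rightarrow> complex" where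
  "fourier_integral M chi f \<xi> = (\<integral>x. f x * cnj (chi (\<xi> * x)) \<partial>M)"

text \<open>
  The extension to \<open>L2\<close> by continuity, as a relation: \<open>g\<close> represents the Fourier transform of \<open>f\<close>.
  Both \<open>f\<close> and \<open>g\<close> only matter up to null sets.
\<close>

definition has_fourier_transform ::
    "'a::local_field measure \<Rightarrow> ('a \<Rightarrow> complex) \<Rightarrow> ('a \<Rightarrow> complex) \<Rightarrow> ('a \<Rightarrow> complex) \<Rightarrow> bool" where
  "has_fourier_transform M chi f g \<longleftrightarrow>
     f \<in> L2 M \<and> g \<in> L2 M \<and>
     (\<exists>h :: nat \<Rightarrow> 'a \<Rightarrow> complex.
        (\<forall>n. h n \<in> L2 M \<and> integrable M (h n) \<and> fourier_integral M chi (h n) \<in> L2 M) \<and>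
        (\<lambda>n. L2_norm M (\<lambda>x. h n x - f x)) \<longlonglongrightarrow> 0 \<and>
        (\<lambda>n. L2_norm M (\<lambda>\<xi>. fourier_integral M chi (h n) \<xi> - g \<xi>)) \<longlonglongrightarrow> 0)"

definition compactly_supported :: "'a::local_field measure \<Rightarrow> ('a \<Rightarrow> complex) \<Rightarrow> bool" where
  "compactly_supported M f \<longleftrightarrow> (\<exists>C. compact C \<and> (AE x in M. x \<notin> C \<longrightarrow> f x = 0))"


section \<open>Masks\<close>

text \<open>
  The series defining a mask converges in mean square on every compact set, so a mask is
  determined, and periodic with respect to all \<open>u k\<close>, up to null sets.
\<close>

definition is_mask ::
    "'a::local_field measure \<Rightarrow> nat \<Rightarrow> ('a \<Rightarrow> complex) \<Rightarrow> (nat \<Rightarrow> 'a) \<Rightarrow> ('a \<Rightarrow> complex) \<Rightarrow> bool" where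
  "is_mask M q chi u m \<longleftrightarrow>
     m \<in> borel_measurable M \<and>
     (\<exists>d :: nat \<Rightarrow> complex. summable (\<lambda>k. (cmod (d k))\<^sup>2) \<and>
        (\<forall>C. compact C \<longrightarrow>
           (\<lambda>\<xi>. indicator C \<xi> * m \<xi>) \<in> L2 M \<and>
           (\<lambda>N. L2_norm M (\<lambda>\<xi>. indicator C \<xi> *
              (m \<xi> - (1 / of_real (sqrt (real q))) * (\<Sum>k<N. d k * cnj (chi (u k * \<xi>)))))) \<longlonglongrightarrow> 0))"

text \<open>
  Row \<open>l\<close> of the \<open>(L + 1) \<times> 2\<close> matrix is \<open>(m l \<xi>, m l (\<xi> + s))\<close>; the \<open>L \<times> 2\<close> matrix omits row 0.
\<close>

definition mask_matrix ::
    "(nat \<Rightarrow> 'a::local_field \<Rightarrow> complex) \<Rightarrow> nat \<Rightarrow> 'a \<Rightarrow> 'a \<Rightarrow> complex Matrix.mat" where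
  "mask_matrix m L s \<xi> =
     Matrix.mat (L + 1) 2 (\<lambda>(l, j). if j = 0 then m l \<xi> else m l (\<xi> + s))"

definition mask_matrix0 ::
    "(nat \<Rightarrow> 'a::local_field \<Rightarrow> complex) \<Rightarrow> nat \<Rightarrow> 'a \<Rightarrow> 'a \<Rightarrow> complex Matrix.mat" where
  "mask_matrix0 m L s \<xi> =
     Matrix.mat L 2 (\<lambda>(l, j). mask_matrix m L s \<xi> $$ (l + 1, j))"


section \<open>Wavelet systems\<close>

definition wavelet ::
    "nat \<Rightarrow> 'a \<Rightarrow> (nat \<Rightarrow> 'a) \<Rightarrow> (nat \<Rightarrow> 'a \<Rightarrow> complex) \<Rightarrow> nat \<times> int \<times> nat
       \<Rightarrow> 'a::local_field \<Rightarrow> complex" where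
  "wavelet q \<pp> u \<psi> = (\<lambda>(l, j, k) x.
     of_real (real q powr (real_of_int j / 2)) * \<psi> l (\<pp> powi (- j) * x - u k))"

definition wavelet_index :: "nat \<Rightarrow> (nat \<times> int \<times> nat) set" where
  "wavelet_index L = {1..L} \<times> UNIV \<times> UNIV"

definition parseval_wavelet_frame ::
    "'a::local_field measure \<Rightarrow> nat \<Rightarrow> 'a \<Rightarrow> (nat \<Rightarrow> 'a) \<Rightarrow> nat \<Rightarrow> (nat \<Rightarrow> 'a \<Rightarrow> complex) \<Rightarrow> bool" where
  "parseval_wavelet_frame M q \<pp> u L \<psi> \<longleftrightarrow>
     (\<forall>l\<in>{1..L}. \<psi> l \<in> L2 M) \<and>
     (\<forall>f\<in>L2 M. ((\<lambda>i. (cmod (L2_inner M f (wavelet q \<pp> u \<psi> i)))\<^sup>2)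
        has_sum (L2_norm M f)\<^sup>2) (wavelet_index L))"

text \<open>
  The series in the definition of orthogonality converges unconditionally in \<open>L2\<close>: the finite
  partial sums tend to 0 in norm along the net of finite sets of indices (the notion underlying
  \<open>has_sum\<close>, spelled out because elements of \<open>L2\<close> are functions here, not classes).
\<close>

definition orthogonal_wavelet_systems ::
    "'a::local_field measure \<Rightarrow> nat \<Rightarrow> 'a \<Rightarrow> (nat \<Rightarrow> 'a) \<Rightarrow> nat
       \<Rightarrow> (nat \<Rightarrow> 'a \<Rightarrow> complex) \<Rightarrow> (nat \<Rightarrow> 'a \<Rightarrow> complex) \<Rightarrow> bool" where
  "orthogonal_wavelet_systems M q \<pp> u L \<psi> \<phi> \<longleftrightarrow>
     (\<forall>l\<in>{1..L}. \<psi> l \<in> L2 M \<and> \<phi> l \<in> L2 M) \<and>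
     (\<forall>f\<in>L2 M.
        ((\<lambda>F. L2_norm M (\<lambda>x. \<Sum>i\<in>F. L2_inner M f (wavelet q \<pp> u \<psi> i) * wavelet q \<pp> u \<phi> i x))
           \<longlongrightarrow> 0) (finite_subsets_at_top (wavelet_index L)))"

end

theory Submission
  imports Defs
begin

text \<open>
  The proof is the unitary extension principle, carried out over the local field.

  \<^emph>\<open>Reduction to one scale.\<close> Let \<open>u\<close> be the sequence of coset representatives. By unitary
  dilation, the coefficients of \<open>f\<close> at scale \<open>j\<close> are the inner products of a dilate of \<open>f\<close> with the
  translates \<open>\<psi> l (x - u k)\<close>. On the Fourier side these are Fourier coefficients, with respect to
  the characters \<open>chi (u k * x)\<close>, of the product of \<open>FT f\<close> with the conjugate of the transform of
  \<open>\<psi> l\<close>. The representatives form a discrete group on which the pairing \<open>chi (x * y)\<close> is trivial, and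
  the characters \<open>chi (u k * x)\<close> form an orthonormal basis of the functions on the ring of integers.
  Parseval's identity for periodizations therefore turns \<open>\<Sum>k. coef k G * cnj (coef k H)\<close> into the
  sum of \<open>\<integral>x. G (x + u n) * cnj (H x)\<close> over the representatives \<open>u n\<close>; this is \<open>coef_has_sum\<close>.

  \<^emph>\<open>The masks.\<close> In this sum the masks only enter through products of their values at \<open>\<pp> * x\<close> and
  \<open>\<pp> * x + \<pp> * u n\<close>. Masks are periodic with respect to the representatives, so only the lowest
  base-\<open>q\<close> digit of \<open>n\<close> matters, and the matrix hypotheses evaluate the sum of these products over
  the family: it is 1 or 0 according to whether \<open>q\<close> divides \<open>n\<close> in the case of
  \<open>\<M>\<^sup>* \<M> = I\<close>, and 0 for all \<open>n\<close> in the mixed case. In the latter case the contribution of every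
  single scale to the mixed sum vanishes (\<open>orthogonal_scale\<close>). In the former case one obtains
  \<open>refinement_identity\<close>: with \<open>Q j\<close> the sum of the squared coefficients of \<open>f\<close> with respect to the
  scaling function at scale \<open>j\<close>, the squared wavelet coefficients at scale \<open>j\<close> add up to
  \<open>Q (j + 1) - Q j\<close>.

  \<^emph>\<open>The limits.\<close> The scaling function has compact support, so its transform is locally constant
  and equals 1 near 0. For \<open>f\<close> with compactly supported transform this makes \<open>Q j\<close> equal to the
  squared norm of \<open>f\<close> for all large \<open>j\<close> (\<open>energy_large_scale\<close>). For \<open>j\<close> tending to minus infinity
  and \<open>f\<close> with compact support, \<open>Q j\<close> is bounded by the integral of the squared modulus of the
  scaling function over shrinking neighbourhoods of the group of representatives, so it tends to 0
  (\<open>energy_small_scale\<close>). Telescoping gives Parseval's identity for locally constant functions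
  with compact support.

  \<^emph>\<open>Density.\<close> Locally constant functions with compact support are dense in \<open>L2 M\<close>
  (\<open>step_approx_L2_iff\<close>), and Parseval's identity extends by continuity. The same holds for the
  mixed identity, which then says that the partial sums of the mixed series tend weakly to 0; as they
  form a Cauchy net, they tend to 0 in norm (\<open>synthesis_tendsto_zero\<close>).

  Plancherel's theorem enters for inner products in which one factor is locally constant with
  compact support. The transform of that factor is of the same kind, so it suffices to integrate
  transforms over discs, and these integrals reduce to finite sums over representatives
  (\<open>FT_disc_integral_supported\<close>).
\<close>

section \<open>Absolute values on a local field\<close>

lemma absv_0 [simp]: "absv (0::'a::local_field) = 0"
  using dist_absv[of "0::'a" 0] by simp

lemma absv_nonneg [simp]: "0 \<le> absv (x::'a::local_field)"
  using dist_absv[of x 0] by (metis diff_zero zero_le_dist)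

lemma absv_eq_0_iff [simp]: "absv (x::'a::local_field) = 0 \<longleftrightarrow> x = 0"
  using dist_absv[of x 0] by (metis diff_zero dist_eq_0_iff)

lemma absv_1 [simp]: "absv (1::'a::local_field) = 1"
  using absv_mult[of "1::'a" 1] by simp

lemma absv_minus [simp]: "absv (- x) = absv (x::'a::local_field)"
  using dist_absv[of x 0] dist_absv[of 0 x] by (simp add: dist_commute)

lemma absv_minus_commute: "absv (x - y) = absv (y - (x::'a::local_field))"
  using absv_minus[of "x - y"] by simp

lemma absv_inverse: "absv (inverse x) = inverse (absv (x::'a::local_field))"
proof (cases "x = 0")
  case False
  then have "absv x * absv (inverse x) = 1"
    by (metis absv_1 absv_mult right_inverse)
  then show ?thesis
    by (metis inverse_unique)
qed simp

lemma absv_power: "absv (x ^ n) = absv (x::'a::local_field) ^ n"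
  by (induction n) (auto simp: absv_mult)

lemma absv_power_int: "absv (x powi n) = absv (x::'a::local_field) powi n"
  by (simp add: power_int_def absv_power absv_inverse)

lemma continuous_on_add_const_local_field:
  "continuous_on UNIV (\<lambda>x::'a::local_field. x + a)"
  unfolding continuous_on_iff by (auto simp: dist_absv)

lemma continuous_on_mult_left_local_field:
  "continuous_on UNIV (\<lambda>x::'a::local_field. a * x)"
  unfolding continuous_on_iff
proof safe
  fix x :: 'a and e :: real assume "e > 0"
  show "\<exists>d>0. \<forall>y\<in>UNIV. dist y x < d \<longrightarrow> dist (a * y) (a * x) < e"
  proof (cases "a = 0")
    case False
    then have "absv a > 0" using absv_nonneg[of a] by (metis absv_eq_0_iff less_eq_real_def)
    moreover have "dist (a * y) (a * x) = absv a * dist y x" for y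
      by (metis absv_mult dist_absv right_diff_distrib)
    ultimately show ?thesis using \<open>e > 0\<close>
      by (intro exI[of _ "e / absv a"]) (auto simp: field_simps)
  qed (use \<open>e > 0\<close> in \<open>auto intro: exI[of _ 1]\<close>)
qed

section \<open>Fractional ideals and coset representatives\<close>

context local_field_setup
begin

lemma c_pos: "c > 0" and q_ge_2: "q \<ge> 2"
proof -
  let ?R = "{(x, y). x \<in> ring_of_integers \<and> y \<in> ring_of_integers \<and> x - y \<in> (prime_ideal :: 'a set)}"
  have fin: "finite (residue_classes :: 'a set set)"
    using card_residue_field q_eq char_p by (metis card.infinite not_gr0 power_eq_0_iff)
  \<comment> \<open>The classes of 0 and 1 are different, so the residue field has at least two elements.\<close>
  have "?R `` {0} \<in> residue_classes" "?R `` {1} \<in> residue_classes"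
    unfolding residue_classes_def by (rule quotientI, simp add: ring_of_integers_def)+
  moreover have "1 \<in> ?R `` {1}" "1 \<notin> ?R `` {0}"
    by (auto simp: ring_of_integers_def prime_ideal_def)
  then have "?R `` {0} \<noteq> ?R `` {1}" by blast
  ultimately have "card {?R `` {0}, ?R `` {1}} \<le> q"
    unfolding card_residue_field[symmetric] using fin by (intro card_mono) auto
  with \<open>?R `` {0} \<noteq> ?R `` {1}\<close> show "q \<ge> 2" by simp
  then show "c > 0" using q_eq by (cases c) auto
qed

lemma q_real [simp]: "real q > 0" "real q \<noteq> 0" "real q > 1" "real q \<ge> 1" "q > 0" "Suc 0 < q" "Suc 0 \<le> q" "q \<noteq> 0"
  using q_ge_2 by auto

lemma p_ge_2: "p \<ge> 2"
  using q_ge_2 q_eq char_p by (cases "p = 1") auto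

lemma pp_nonzero [simp]: "\<pp> \<noteq> 0"
proof
  assume "\<pp> = 0"
  with absv_prime_element have "1 / real q = 0" by simp
  then show False by simp
qed

text \<open>The fractional ideal \<open>\<pp> powi (- k) D\<close>, where \<open>D = disc 0\<close> is the ring of integers, indexed so
  that \<open>q powi k\<close> is both its radius and its Haar measure.\<close>

definition disc :: "int \<Rightarrow> 'a set" where
  "disc k = {x. absv x \<le> real q powi k}"

lemma disc_0: "disc 0 = ring_of_integers"
  by (auto simp: disc_def ring_of_integers_def)

lemma zero_in_disc [simp]: "0 \<in> disc k"
  by (simp add: disc_def)

lemma disc_uminus [simp]: "- x \<in> disc k \<longleftrightarrow> x \<in> disc k"
  by (simp add: disc_def)

lemma disc_add: "x \<in> disc k \<Longrightarrow> y \<in> disc k \<Longrightarrow> x + y \<in> disc k"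
  using absv_ultrametric[of x y] by (auto simp: disc_def)

lemma disc_diff: "x \<in> disc k \<Longrightarrow> y \<in> disc k \<Longrightarrow> x - y \<in> disc k"
  using disc_add[of x k "- y"] by simp

lemma disc_add_iff: "y \<in> disc k \<Longrightarrow> x + y \<in> disc k \<longleftrightarrow> x \<in> disc k"
  using disc_add[of x k y] disc_diff[of "x + y" k y] by auto

lemma disc_mult: "x \<in> disc k \<Longrightarrow> y \<in> disc l \<Longrightarrow> x * y \<in> disc (k + l)"
  by (auto simp: disc_def absv_mult power_int_add intro!: mult_mono)

lemma disc_mono: "k \<le> l \<Longrightarrow> disc k \<subseteq> disc l"
  unfolding disc_def using power_int_increasing[of k l "real q"] by (auto intro: order_trans)

lemma disc_sum: "(\<And>i. i \<in> A \<Longrightarrow> f i \<in> disc k) \<Longrightarrow> sum f A \<in> disc k"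
  by (induction A rule: infinite_finite_induct) (auto intro: disc_add)

lemma absv_pp_powi: "absv (\<pp> powi k) = real q powi (- k)"
  by (simp add: absv_power_int absv_prime_element power_int_minus divide_inverse power_int_inverse)

lemma pp_powi_disc_iff: "\<pp> powi k * x \<in> disc l \<longleftrightarrow> x \<in> disc (l + k)"
  by (simp add: disc_def absv_mult absv_pp_powi power_int_add power_int_minus field_simps)

lemma pp_disc_iff: "\<pp> * x \<in> disc l \<longleftrightarrow> x \<in> disc (l + 1)"
  using pp_powi_disc_iff[of 1 x l] by simp

lemma inverse_pp_disc_iff: "inverse \<pp> * x \<in> disc l \<longleftrightarrow> x \<in> disc (l - 1)"
  using pp_powi_disc_iff[of "-1" x l] by (simp add: power_int_minus)

lemma prime_ideal_disc: "prime_ideal = disc (- 1)"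
proof -
  have "x \<in> prime_ideal \<longleftrightarrow> inverse \<pp> * x \<in> ring_of_integers" for x
    unfolding prime_element
    by (auto simp: mult.assoc[symmetric] intro: image_eqI[of _ _ "inverse \<pp> * x"])
  then show ?thesis
    using inverse_pp_disc_iff[of _ 0] by (auto simp: disc_0)
qed

lemma pp_powi_inverse: "\<pp> powi k * \<pp> powi (- k) = 1" "\<pp> powi (- k) * \<pp> powi k = 1"
  by (subst power_int_add[symmetric], simp_all)+

text \<open>Since \<open>\<pp>\<close> generates the prime ideal, the value group is generated by \<open>q\<close>: after scaling by a
  power of \<open>\<pp>\<close>, the inverse of an element outside \<open>disc 0\<close> lies in the prime ideal \<open>disc (- 1)\<close>.\<close>

lemma not_in_disc_absv: "x \<notin> disc k \<Longrightarrow> absv x \<ge> real q powi (k + 1)"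
proof -
  assume "x \<notin> disc k"
  then have *: "x \<noteq> 0" "real q powi k < absv x" by (auto simp: disc_def)
  have "absv (inverse (\<pp> powi k * x)) = real q powi k / absv x"
    by (simp add: absv_mult absv_inverse absv_pp_powi power_int_minus divide_inverse)
  also have "\<dots> < 1"
    using *(2) by (subst pos_divide_less_eq) (auto intro: le_less_trans[rotated])
  finally have "absv (inverse (\<pp> powi k * x)) < 1" .
  then have "inverse (\<pp> powi k * x) \<in> disc (- 1)"
    using prime_ideal_disc by (auto simp: prime_ideal_def)
  then have "real q powi k / absv x \<le> inverse (real q)"
    by (simp add: disc_def absv_mult absv_inverse absv_pp_powi power_int_minus divide_inverse)
  moreover have "absv x > 0" using * by (metis absv_eq_0_iff absv_nonneg less_eq_real_def)
  ultimately show ?thesis by (simp add: power_int_add field_simps)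
qed

lemma disc_exhaust: "\<exists>n::nat. x \<in> disc (int n)"
  using real_arch_pow[of "real q" "absv x"] by (auto simp: disc_def intro: less_imp_le)

lemma disc_Inter: assumes "\<And>n::nat. x \<in> disc (- int n)" shows "x = 0"
proof (rule ccontr)
  assume "x \<noteq> 0"
  then have "absv x > 0" by (metis absv_eq_0_iff absv_nonneg less_eq_real_def)
  then obtain n where "inverse (absv x) < real q ^ n"
    using real_arch_pow[of "real q" "inverse (absv x)"] by auto
  with assms[of n] \<open>absv x > 0\<close> show False
    by (simp add: disc_def power_int_minus field_simps)
qed

lemma disc_cball: "disc k = cball 0 (real q powi k)"
  by (auto simp: disc_def dist_absv)

lemma closed_disc: "closed (disc k)"
  unfolding disc_cball by simp

lemma ball_subset_coset: "ball x (real q powi k) \<subseteq> (+) x ` disc k"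
proof
  fix y assume "y \<in> ball x (real q powi k)"
  then have "y - x \<in> disc k" by (simp add: disc_def dist_absv absv_minus_commute)
  then show "y \<in> (+) x ` disc k" by (intro image_eqI[of _ _ "y - x"]) auto
qed

lemma coset_iff: "y \<in> (+) x ` disc k \<longleftrightarrow> y - x \<in> disc k"
  by (auto intro: image_eqI[of _ _ "y - x"])

lemma open_coset: "open ((+) x ` disc k)"
proof (rule openI)
  fix y assume "y \<in> (+) x ` disc k"
  then have "(+) y ` disc k \<subseteq> (+) x ` disc k"
    using disc_add[of "y - x" k] by (auto simp: coset_iff algebra_simps)
  with ball_subset_coset[of y k] have "ball y (real q powi k) \<subseteq> (+) x ` disc k" by (rule subset_trans)
  then show "\<exists>e>0. ball y e \<subseteq> (+) x ` disc k"
    by (intro exI[of _ "real q powi k"]) auto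
qed

lemma coset_subset_open:
  assumes "open U" "x \<in> U" shows "\<exists>n::nat. (+) x ` disc (- int n) \<subseteq> U"
proof -
  obtain e where e: "e > 0" "ball x e \<subseteq> U" using assms openE by blast
  obtain n where "inverse e < real q ^ n" using real_arch_pow[of "real q" "inverse e"] by auto
  then have "real q powi (- int n) < e" using e by (simp add: power_int_minus field_simps)
  then have "(+) x ` disc (- int n) \<subseteq> ball x e"
    by (auto simp: disc_def dist_absv)
  with e show ?thesis by blast
qed

text \<open>Local compactness makes some small disc compact; all others are images of it under
  multiplication by a power of \<open>\<pp>\<close>.\<close>

lemma compact_disc: "compact (disc k)"
proof -
  obtain U C where UC: "open U" "compact C" "0 \<in> U" "U \<subseteq> (C :: 'a set)"
    using locally_compact_local_field by blast
  obtain n :: nat where "(+) 0 ` disc (- int n) \<subseteq> U" using coset_subset_open[OF UC(1,3)] by blast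
  then have "compact (disc (- int n))"
    using compact_Int_closed[OF UC(2) closed_disc[of "- int n"]] UC(4)
    by (simp add: Int_absorb1)
  then have "compact ((*) (\<pp> powi (- k - int n)) ` disc (- int n))"
    using continuous_on_mult_left_local_field continuous_on_subset
    by (intro compact_continuous_image) blast+
  also have "(*) (\<pp> powi (- k - int n)) ` disc (- int n) = disc k"
  proof (intro equalityI subsetI)
    fix x assume "x \<in> disc k"
    then have "\<pp> powi (k + int n) * x \<in> disc (- int n)" by (simp add: pp_powi_disc_iff)
    moreover have "\<pp> powi (- k - int n) * \<pp> powi (k + int n) = 1"
      by (subst power_int_add[symmetric]) auto
    then have "x = \<pp> powi (- k - int n) * (\<pp> powi (k + int n) * x)"
      by (simp only: mult.assoc[symmetric] mult_1)
    ultimately show "x \<in> (*) (\<pp> powi (- k - int n)) ` disc (- int n)" by blast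
  next
    fix x assume "x \<in> (*) (\<pp> powi (- k - int n)) ` disc (- int n)"
    then obtain y where "y \<in> disc (- int n)" "x = \<pp> powi (- k - int n) * y" by blast
    then show "x \<in> disc k" by (simp only: pp_powi_disc_iff) simp
  qed
  finally show ?thesis .
qed

lemma compact_subset_disc: assumes "compact (C :: 'a set)" shows "\<exists>n::nat. C \<subseteq> disc (int n)"
proof -
  obtain e where e: "C \<subseteq> cball 0 e"
    using bounded_subset_ballD[OF compact_imp_bounded[OF assms], of 0] ball_subset_cball by (meson subset_trans)
  obtain n where "e < real q ^ n" using real_arch_pow[of "real q" e] by auto
  with e show ?thesis by (intro exI[of _ n]) (fastforce simp: disc_cball)
qed

text \<open>The enumeration of the copy of \<open>GF(q)\<close> that is implicit in \<open>coset_rep\<close>: \<open>u b\<close> is \<open>digit b\<close>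
  divided by \<open>\<pp>\<close> for \<open>b < q\<close>.\<close>

definition digit :: "nat \<Rightarrow> 'a" where
  "digit b = (\<Sum>k<c. of_nat (b div p ^ k mod p) * \<zeta> k)"

abbreviation u :: "nat \<Rightarrow> 'a" where "u \<equiv> coset_rep p c \<pp> \<zeta>"

lemma digit_0 [simp]: "digit 0 = 0"
  by (simp add: digit_def)

text \<open>Together with the cardinality of the span this shows that the digits are a bijective
  enumeration of the copy of \<open>GF(q)\<close> by \<open>{..<q}\<close>.\<close>

lemma digits_nat_exist:
  fixes a :: "nat \<Rightarrow> nat"
  assumes "\<forall>k<n. a k < p"
  shows "\<exists>b<p ^ n. \<forall>k<n. b div p ^ k mod p = a k"
  using assms
proof (induction n arbitrary: a)
  case (Suc n)
  obtain b where b: "b < p ^ n" "\<forall>k<n. b div p ^ k mod p = a (Suc k)"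
    using Suc.IH[of "\<lambda>k. a (Suc k)"] Suc.prems by auto
  have a0: "a 0 < p" using Suc.prems by auto
  have "a 0 + p * b < p ^ Suc n"
  proof -
    have "a 0 + p * b < p * Suc b" using a0 by simp
    also have "\<dots> \<le> p * p ^ n" using b by (intro mult_left_mono) auto
    finally show ?thesis by simp
  qed
  moreover have "(a 0 + p * b) div p ^ k mod p = a k" if "k < Suc n" for k
  proof (cases k)
    case (Suc k')
    then have "(a 0 + p * b) div p ^ k = b div p ^ k'" using a0 by (simp add: div_mult2_eq)
    then show ?thesis using b Suc that by auto
  qed (use a0 in auto)
  ultimately show ?case by blast
qed simp

lemma prime_field_span_digit: "prime_field_span p c \<zeta> = digit ` {..<q}"
proof (intro equalityI subsetI)
  fix x assume "x \<in> prime_field_span p c \<zeta>"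
  then obtain a where a: "x = (\<Sum>k<c. of_nat (a k) * \<zeta> k)" "\<forall>k<c. a k < p"
    by (auto simp: prime_field_span_def)
  obtain b where b: "b < p ^ c" "\<forall>k<c. b div p ^ k mod p = a k"
    using digits_nat_exist[OF a(2)] by blast
  have "x = digit b" unfolding a digit_def using b by (intro sum.cong) auto
  with b show "x \<in> digit ` {..<q}" by (auto simp: q_eq)
next
  fix x assume "x \<in> digit ` {..<q}"
  then obtain b where "x = digit b" by blast
  then show "x \<in> prime_field_span p c \<zeta>"
    unfolding prime_field_span_def digit_def using p_ge_2
    by (auto intro!: exI[of _ "\<lambda>k. b div p ^ k mod p"])
qed

lemma inj_on_digit: "inj_on digit {..<q}"
  using zeta_span_card by (intro eq_card_imp_inj_on) (auto simp: prime_field_span_digit)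

lemma digit_closed:
  assumes "b < q" "b' < q"
  shows "\<exists>b''<q. digit b - digit b' = digit b''" "\<exists>b''<q. digit b * digit b' = digit b''"
    "\<exists>b''<q. inverse (digit b) = digit b''"
  using zeta_span_subfield[of "digit b" "digit b'"] assms by (auto simp: prime_field_span_digit)

lemma of_nat_in_disc_0: "(of_nat n :: 'a) \<in> disc 0"
  by (induction n) (auto intro!: disc_add, simp add: disc_def)

lemma digit_in_disc: "digit b \<in> disc 0"
  unfolding digit_def
  using disc_mult[of _ 0 _ 0] of_nat_in_disc_0 zeta_unit by (intro disc_sum) (auto simp: disc_0)

text \<open>The difference of two digits is a digit, and so is its inverse if it is not 0; both are then
  integral, so a nonzero difference is a unit.\<close>

lemma digit_eq_if_congruent:
  assumes "b < q" "b' < q" "digit b - digit b' \<in> disc (- 1)"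
  shows "b = b'"
proof (rule ccontr)
  assume "b \<noteq> b'"
  then have ne: "digit b \<noteq> digit b'" using inj_on_digit assms by (auto dest: inj_onD)
  obtain d where d: "digit b - digit b' = digit d" "d < q" using digit_closed assms by blast
  obtain e where e: "inverse (digit d) = digit e" using digit_closed(3) d by blast
  have "digit d * digit e \<in> disc (- 1 + 0)" using d assms digit_in_disc[of e] by (intro disc_mult) auto
  moreover have "digit d * digit e = 1" using e d ne by (metis eq_iff_diff_eq_0 right_inverse)
  ultimately show False using q_ge_2 by (simp add: disc_def power_int_minus field_simps)
qed

lemma ex_digit_congruent:
  assumes "x \<in> disc 0" shows "\<exists>b<q. x - digit b \<in> disc (- 1)"
proof -
  let ?R = "{(x, y). x \<in> ring_of_integers \<and> y \<in> ring_of_integers \<and> x - y \<in> (prime_ideal :: 'a set)}"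
  have cls: "?R `` {x} \<in> residue_classes" if "x \<in> disc 0" for x
    using that unfolding residue_classes_def disc_0 by (intro quotientI)
  \<comment> \<open>The digits lie in \<open>q\<close> different residue classes, and there are only \<open>q\<close> classes.\<close>
  have inj: "inj_on (\<lambda>b. ?R `` {digit b}) {..<q}"
  proof (rule inj_onI)
    fix b b' assume bb: "b \<in> {..<q}" "b' \<in> {..<q}" "?R `` {digit b} = ?R `` {digit b'}"
    have "digit b' \<in> ?R `` {digit b'}" using digit_in_disc[of b'] by (auto simp: disc_0[symmetric] prime_ideal_disc)
    then have "digit b' \<in> ?R `` {digit b}" using bb by simp
    then have "digit b - digit b' \<in> disc (- 1)" by (auto simp: prime_ideal_disc)
    then show "b = b'" using bb digit_eq_if_congruent by auto
  qed
  have "finite (residue_classes :: 'a set set)"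
    using card_residue_field q_ge_2 by (metis card.infinite not_numeral_le_zero)
  then have "(\<lambda>b. ?R `` {digit b}) ` {..<q} = residue_classes"
    using cls digit_in_disc card_image[OF inj] card_residue_field by (intro card_subset_eq) auto
  then obtain b where b: "b < q" "?R `` {x} = ?R `` {digit b}" using cls[OF assms] by auto
  have "digit b \<in> ?R `` {digit b}" using digit_in_disc[of b] by (auto simp: disc_0[symmetric] prime_ideal_disc)
  then have "digit b \<in> ?R `` {x}" using b by simp
  then show ?thesis using b by (auto simp: prime_ideal_disc)
qed

lemma u_0 [simp]: "u 0 = 0"
  by (simp add: coset_rep_def coset_rep_digit_def)

text \<open>Base-\<open>q\<close> digits of \<open>n\<close> beyond position \<open>n\<close> vanish, so the summation bound can be enlarged.\<close>

lemma u_eq_sum: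
  assumes "n \<le> N" shows "u n = (\<Sum>i\<le>N. digit (n div q ^ i mod q) * inverse \<pp> ^ Suc i)"
proof -
  have "n div q ^ i = 0" if "i > n" for i
  proof -
    have "n < 2 ^ i" using that by (meson less_exp less_trans)
    also have "\<dots> \<le> q ^ i" using q_ge_2 by (simp add: power_mono)
    finally show ?thesis by simp
  qed
  then have "(\<Sum>i\<le>N. digit (n div q ^ i mod q) * inverse \<pp> ^ Suc i)
      = (\<Sum>i\<le>n. digit (n div q ^ i mod q) * inverse \<pp> ^ Suc i)"
    using assms by (intro sum.mono_neutral_right) (auto simp: not_le)
  then show ?thesis
    by (simp add: coset_rep_def coset_rep_digit_def q_eq[symmetric] digit_def[symmetric] mult.assoc)
qed

text \<open>Splitting off the lowest base-\<open>q\<close> digit drives all inductions about \<open>u\<close>; the indices below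
  \<open>q ^ n\<close> are those with at most \<open>n\<close> digits.\<close>

lemma u_rec: assumes "b < q" shows "u (b + q * n) = inverse \<pp> * (digit b + u n)"
proof -
  have "u (b + q * n) = (\<Sum>i\<le>Suc (b + q * n). digit ((b + q * n) div q ^ i mod q) * inverse \<pp> ^ Suc i)"
    by (rule u_eq_sum) simp
  also have "\<dots> = inverse \<pp> * digit b + (\<Sum>i\<le>b + q * n. digit (n div q ^ i mod q) * inverse \<pp> ^ Suc (Suc i))"
    using assms by (subst sum.atMost_Suc_shift) (simp add: div_mult2_eq mult.commute)
  also have "(\<Sum>i\<le>b + q * n. digit (n div q ^ i mod q) * inverse \<pp> ^ Suc (Suc i)) = inverse \<pp> * u n"
    using q_ge_2 by (subst u_eq_sum[of n "b + q * n"]) (auto simp: sum_distrib_left mult_ac intro: trans_le_add2)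
  finally show ?thesis by (simp only: distrib_left[symmetric])
qed

lemma u_digit: "b < q \<Longrightarrow> u b = inverse \<pp> * digit b"
  using u_rec[of b 0] by simp

lemma u_mult_q: "u (q * n) = inverse \<pp> * u n"
  using u_rec[of 0 n] by simp

lemma u_split: "b < q \<Longrightarrow> u (b + q * n) = u b + inverse \<pp> * u n"
  by (simp only: u_rec u_digit distrib_left)

lemma less_power_Suc_cases:
  assumes "i < q ^ Suc n" obtains b i' where "i = b + q * i'" "b < q" "i' < q ^ n"
proof
  show "i = i mod q + q * (i div q)" by simp
  show "i mod q < q" by simp
  show "i div q < q ^ n" using assms by (simp add: less_mult_imp_div_less mult.commute)
qed

lemma digits_less_power: "b < q \<Longrightarrow> i < q ^ n \<Longrightarrow> b + q * i < q ^ Suc n"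
proof -
  assume "b < q" "i < q ^ n"
  then have "b + q * i < q * Suc i" by simp
  also have "\<dots> \<le> q * q ^ n" using \<open>i < q ^ n\<close> by (intro mult_left_mono) auto
  finally show ?thesis by simp
qed

lemma u_in_disc: "i < q ^ n \<Longrightarrow> u i \<in> disc (int n)"
proof (induction n arbitrary: i)
  case (Suc n)
  obtain b i' where i: "i = b + q * i'" "b < q" "i' < q ^ n" using less_power_Suc_cases[OF Suc.prems] .
  have "digit b \<in> disc (int n)" using digit_in_disc disc_mono[of 0 "int n"] by auto
  then show ?case using Suc.IH[OF i(3)] i by (simp add: u_rec inverse_pp_disc_iff disc_add)
qed simp

text \<open>The representatives \<open>u i\<close> with \<open>i < q ^ n\<close> represent \<open>disc n\<close> modulo \<open>disc 0\<close>: one digit is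
  determined at a time, each by its residue class.\<close>

lemma ex_coset_rep: "x \<in> disc (int n) \<Longrightarrow> \<exists>i<q ^ n. x - u i \<in> disc 0"
proof (induction n arbitrary: x)
  case (Suc n)
  then have "\<pp> * x \<in> disc (int n)" by (simp add: pp_disc_iff add.commute)
  then obtain i where i: "i < q ^ n" "\<pp> * x - u i \<in> disc 0" using Suc.IH by blast
  then obtain b where b: "b < q" "\<pp> * x - u i - digit b \<in> disc (- 1)" using ex_digit_congruent by blast
  have "x - u (b + q * i) = inverse \<pp> * (\<pp> * x - u i - digit b)"
    unfolding u_rec[OF b(1)] by (simp add: right_diff_distrib distrib_left mult.assoc[symmetric])
  then have "x - u (b + q * i) \<in> disc 0" using b by (simp add: inverse_pp_disc_iff)
  then show ?case using digits_less_power i b by blast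
qed auto

lemma coset_rep_unique: "i < q ^ n \<Longrightarrow> j < q ^ n \<Longrightarrow> u i - u j \<in> disc 0 \<Longrightarrow> i = j"
proof (induction n arbitrary: i j)
  case (Suc n)
  obtain b i' where i: "i = b + q * i'" "b < q" "i' < q ^ n" using less_power_Suc_cases[OF Suc.prems(1)] .
  obtain d j' where j: "j = d + q * j'" "d < q" "j' < q ^ n" using less_power_Suc_cases[OF Suc.prems(2)] .
  have "u i - u j = inverse \<pp> * ((digit b - digit d) + (u i' - u j'))"
    unfolding i(1) j(1) u_rec[OF i(2)] u_rec[OF j(2)] by (simp add: algebra_simps)
  then have *: "(digit b - digit d) + (u i' - u j') \<in> disc (- 1)"
    using Suc.prems(3) by (simp add: inverse_pp_disc_iff)
  have "((digit b - digit d) + (u i' - u j')) - (digit b - digit d) \<in> disc 0"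
    using * disc_mono[of "-1" 0] digit_in_disc by (intro disc_diff) auto
  then have "u i' - u j' \<in> disc 0" by simp
  then have "i' = j'" using Suc.IH i j by blast
  then have "b = d" using * digit_eq_if_congruent i j by simp
  with \<open>i' = j'\<close> show ?case using i j by simp
qed simp

lemma less_q_power: "i < q ^ i"
  using q_ge_2 by (metis One_nat_def less_exp less_le_trans linorder_not_le nat_le_linear not_less_eq_eq power_mono zero_le numeral_2_eq_2)

lemma u_eq_iff: "u i - u j \<in> disc 0 \<longleftrightarrow> i = j"
proof
  assume "u i - u j \<in> disc 0"
  moreover have "i < q ^ (max i j)" "j < q ^ (max i j)"
    using less_q_power[of "max i j"] by auto
  ultimately show "i = j" using coset_rep_unique by blast
qed simp

lemma inj_u: "inj u"
  by (rule injI) (metis u_eq_iff diff_self zero_in_disc)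

text \<open>In positive characteristic the digits add without carries, so the representatives form a
  group, and those with at most \<open>n\<close> digits form a subgroup.\<close>

lemma u_diff: "i < q ^ n \<Longrightarrow> j < q ^ n \<Longrightarrow> \<exists>k<q ^ n. u i - u j = u k"
proof (induction n arbitrary: i j)
  case (Suc n)
  obtain b i' where i: "i = b + q * i'" "b < q" "i' < q ^ n" using less_power_Suc_cases[OF Suc.prems(1)] .
  obtain d j' where j: "j = d + q * j'" "d < q" "j' < q ^ n" using less_power_Suc_cases[OF Suc.prems(2)] .
  obtain k where k: "k < q ^ n" "u i' - u j' = u k" using Suc.IH i j by blast
  obtain e where e: "e < q" "digit b - digit d = digit e" using digit_closed i j by blast
  have "u i - u j = inverse \<pp> * ((digit b - digit d) + (u i' - u j'))"
    unfolding i(1) j(1) u_rec[OF i(2)] u_rec[OF j(2)] by (simp add: algebra_simps)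
  then have "u i - u j = u (e + q * k)" using k e by (simp add: u_rec)
  then show ?case using digits_less_power k e by blast
qed auto

lemma u_minus: "i < q ^ n \<Longrightarrow> \<exists>k<q ^ n. - u i = u k"
  using u_diff[of 0 n i] by auto

lemma u_add: "i < q ^ n \<Longrightarrow> j < q ^ n \<Longrightarrow> \<exists>k<q ^ n. u i + u j = u k"
  using u_minus[of j n] u_diff[of i n] by (metis diff_minus_eq_add minus_minus)

section \<open>The basic character\<close>

lemma chi_add: "chi (x + y) = chi x * chi y"
  using chi_character by (simp add: additive_character_def)

lemma cmod_chi [simp]: "cmod (chi x) = 1"
  using chi_character by (simp add: additive_character_def)

lemma chi_nonzero [simp]: "chi x \<noteq> 0"
  using cmod_chi[of x] by (metis norm_zero zero_neq_one)

lemma chi_disc: "x \<in> disc 0 \<Longrightarrow> chi x = 1"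
  using chi_trivial by (simp add: disc_0)

lemma chi_0 [simp]: "chi 0 = 1"
  by (simp add: chi_disc)

lemma chi_minus: "chi (- x) = cnj (chi x)"
proof -
  have "chi x * chi (- x) = 1" by (simp add: chi_add[symmetric])
  moreover have "chi x * cnj (chi x) = 1" by (simp add: complex_norm_square[symmetric])
  ultimately show ?thesis by (metis chi_nonzero mult_left_cancel)
qed

lemma chi_diff: "chi (x - y) = chi x * cnj (chi y)"
  using chi_add[of x "- y"] by (simp add: chi_minus)

lemma chi_cnj_mult [simp]: "chi x * cnj (chi x) = 1" "cnj (chi x) * chi x = 1"
  by (simp_all add: complex_norm_square[symmetric] mult.commute[of "cnj _"])

lemma chi_sum: "chi (sum f A) = (\<Prod>x\<in>A. chi (f x))"
  by (induction A rule: infinite_finite_induct) (auto simp: chi_add)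

lemma chi_of_nat_mult: "chi (of_nat n * x) = chi x ^ n"
  by (induction n) (auto simp: chi_add algebra_simps)

lemma continuous_on_chi: "continuous_on UNIV chi"
  using chi_character by (simp add: additive_character_def)

lemma chi_digit: assumes "j \<ge> 2" shows "chi (digit b * \<pp> powi (- j)) = 1"
proof -
  have "digit b * \<pp> powi (- j) = (\<Sum>k<c. of_nat (b div p ^ k mod p) * (\<zeta> k * \<pp> powi (- j)))"
    by (simp add: digit_def sum_distrib_right mult.assoc)
  then show ?thesis using assms by (simp add: chi_sum chi_of_nat_mult chi_values)
qed

lemma chi_inverse_pp: "chi (inverse \<pp>) \<noteq> 1"
proof
  assume "chi (inverse \<pp>) = 1"
  moreover have "chi (inverse \<pp>) = exp (2 * of_real pi * \<i> / of_nat p)"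
    using chi_values[of 0 1] c_pos zeta_0 by (simp add: power_int_minus)
  ultimately have "exp (2 * of_real pi * \<i> / of_nat p) = 1" by simp
  then obtain k :: int where "2 * pi / real p = of_int (2 * k) * pi" by (auto simp: exp_eq_1)
  then have "1 = of_int k * real p" using p_ge_2 by (simp add: field_simps)
  then have "1 = k * int p" by (metis of_int_eq_1_iff of_int_mult of_int_of_nat_eq)
  then show False using p_ge_2 by (auto simp: zmult_eq_1_iff)
qed

text \<open>A product of two representatives only involves powers \<open>\<pp> powi (- j)\<close> with \<open>j \<ge> 2\<close>, on whose
  digit multiples \<open>chi\<close> is trivial. Hence the pairing \<open>(x, y) \<mapsto> chi (x * y)\<close> is trivial on the
  group of representatives.\<close>

lemma chi_digit_u: "b < q \<Longrightarrow> j \<ge> 1 \<Longrightarrow> i < q ^ n \<Longrightarrow> chi (digit b * \<pp> powi (- j) * u i) = 1"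
proof (induction n arbitrary: i j)
  case (Suc n)
  obtain d i' where i: "i = d + q * i'" "d < q" "i' < q ^ n" using less_power_Suc_cases[OF Suc.prems(3)] .
  obtain e where e: "e < q" "digit b * digit d = digit e" using digit_closed Suc.prems i by blast
  have "\<pp> powi (- j) * inverse \<pp> = \<pp> powi (- (j + 1))"
    by (simp add: power_int_add power_int_minus power_int_diff field_simps)
  then have "digit b * \<pp> powi (- j) * u i = digit b * \<pp> powi (- (j + 1)) * (digit d + u i')"
    unfolding i(1) u_rec[OF i(2)] by (simp only: mult.assoc[symmetric]) (simp only: mult.assoc)
  then have "digit b * \<pp> powi (- j) * u i = digit e * \<pp> powi (- (j + 1)) + digit b * \<pp> powi (- (j + 1)) * u i'"
    unfolding e(2)[symmetric] by (simp add: algebra_simps)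
  then show ?case using Suc.IH[of "j + 1" i'] Suc.prems i chi_digit[of "j + 1" e] by (simp add: chi_add)
qed auto

lemma chi_pp_u_u: "j \<ge> 0 \<Longrightarrow> k < q ^ n \<Longrightarrow> chi (\<pp> powi (- j) * u k * u i) = 1"
proof (induction n arbitrary: k j)
  case (Suc n)
  obtain d k' where k: "k = d + q * k'" "d < q" "k' < q ^ n" using less_power_Suc_cases[OF Suc.prems(2)] .
  have "\<pp> powi (- j) * inverse \<pp> = \<pp> powi (- (j + 1))"
    by (simp add: power_int_add power_int_minus power_int_diff field_simps)
  then have "\<pp> powi (- j) * u k * u i = digit d * \<pp> powi (- (j + 1)) * u i + \<pp> powi (- (j + 1)) * u k' * u i"
    unfolding k(1) u_rec[OF k(2)] by (simp only: mult.assoc[symmetric]) (simp add: algebra_simps)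
  moreover have "chi (digit d * \<pp> powi (- (j + 1)) * u i) = 1"
    using chi_digit_u[of d "j + 1" i i] less_q_power[of i] k Suc.prems by auto
  ultimately show ?case using Suc.IH[of "j + 1" k'] Suc.prems k by (simp add: chi_add)
qed auto

lemma chi_u_u [simp]: "chi (u k * u i) = 1"
  using chi_pp_u_u[of 0 k k i] less_q_power[of k] by simp

text \<open>\<open>disc k\<close> and \<open>disc (- k)\<close> are dual to each other under the pairing.\<close>

lemma chi_nontrivial_disc:
  assumes "y \<notin> disc (- k)" shows "\<exists>x\<in>disc k. chi (y * x) \<noteq> 1"
proof
  have "y \<noteq> 0" using assms by auto
  \<comment> \<open>The witness is chosen so that its product with \<open>y\<close> is \<open>inverse \<pp>\<close>.\<close>
  have "y * (inverse \<pp> * inverse y) = inverse \<pp>" using \<open>y \<noteq> 0\<close> by simp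
  then show "chi (y * (inverse \<pp> * inverse y)) \<noteq> 1" using chi_inverse_pp by metis
  have "real q powi (- k + 1) \<le> absv y" using not_in_disc_absv[OF assms] by simp
  then have "inverse (absv y) \<le> inverse (real q powi (- k + 1))" by (intro le_imp_inverse_le) auto
  also have "\<dots> = real q powi (k - 1)" by (simp add: power_int_diff power_int_minus power_int_add field_simps)
  finally show "inverse \<pp> * inverse y \<in> disc k"
    by (simp add: inverse_pp_disc_iff) (simp add: disc_def absv_inverse)
qed

text \<open>Orthogonality of characters on the finite group of the \<open>u i\<close> with \<open>i < q ^ n\<close>: the sum of a
  nontrivial character over a group vanishes.\<close>

lemma dirichlet_kernel:
  assumes "y \<in> disc 0"
  shows "(\<Sum>i<q ^ n. chi (u i * y)) = (if y \<in> disc (- int n) then of_nat (q ^ n) else 0)"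
proof (cases "y \<in> disc (- int n)")
  case True
  then have "chi (u i * y) = 1" if "i < q ^ n" for i
    using disc_mult[OF u_in_disc[OF that] True] by (simp add: chi_disc)
  then show ?thesis using True by simp
next
  case False
  obtain x where x: "x \<in> disc (int n)" "chi (y * x) \<noteq> 1" using chi_nontrivial_disc False by blast
  obtain j where j: "j < q ^ n" "x - u j \<in> disc 0" using ex_coset_rep x by blast
  have "chi (y * x) = chi (u j * y) * chi (y * (x - u j))"
    by (simp add: chi_add[symmetric] algebra_simps)
  then have nt: "chi (u j * y) \<noteq> 1" using x disc_mult[OF assms j(2)] by (simp add: chi_disc)
  let ?S = "\<Sum>x\<in>u ` {..<q ^ n}. chi (x * y)"
  \<comment> \<open>Translation by \<open>u j\<close> permutes the group and multiplies the sum by \<open>chi (u j * y) \<noteq> 1\<close>.\<close>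
  have add: "x + u j \<in> u ` {..<q ^ n}" and diff: "x - u j \<in> u ` {..<q ^ n}"
    if "x \<in> u ` {..<q ^ n}" for x
    using u_add[OF _ j(1)] u_diff[OF _ j(1)] that by (auto simp: image_iff)
  have "?S = (\<Sum>x\<in>u ` {..<q ^ n}. chi ((x + u j) * y))"
    by (rule sum.reindex_bij_witness[of _ "\<lambda>x. x + u j" "\<lambda>x. x - u j"]) (simp_all add: add diff)
  also have "\<dots> = (\<Sum>x\<in>u ` {..<q ^ n}. chi (u j * y) * chi (x * y))"
    by (simp add: distrib_right chi_add mult.commute[of "chi (u j * y)"])
  also have "\<dots> = chi (u j * y) * ?S" by (simp add: sum_distrib_left)
  finally have "?S = 0" using nt by (metis mult_cancel_right1)
  then show ?thesis using False inj_u by (simp add: sum.reindex inj_on_subset)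
qed

end

section \<open>Square-integrable functions\<close>

lemma L2_measurable [measurable_dest]: "f \<in> L2 M \<Longrightarrow> f \<in> borel_measurable M"
  by (simp add: L2_def)

lemma L2_integrable_square: "f \<in> L2 M \<Longrightarrow> integrable M (\<lambda>x. (cmod (f x))\<^sup>2)"
  by (simp add: L2_def)

lemma L2_dominated:
  assumes "f \<in> borel_measurable M" "integrable M g" "AE x in M. (cmod (f x))\<^sup>2 \<le> g x"
  shows "f \<in> L2 M"
proof -
  note [measurable] = assms(1)
  have "integrable M (\<lambda>x. (cmod (f x))\<^sup>2)"
    by (rule Bochner_Integration.integrable_bound[OF assms(2)]) (use assms(3) in auto)
  then show ?thesis using assms by (simp add: L2_def)
qed

lemma borel_measurable_cnj:
  "f \<in> borel_measurable M \<Longrightarrow> (\<lambda>x. cnj (f x)) \<in> borel_measurable M"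
  by (rule measurable_compose[OF _ borel_measurable_continuous_onI]) (auto intro: continuous_intros)

lemma L2_zero [simp]: "(\<lambda>x. 0) \<in> L2 M"
  by (simp add: L2_def)

lemma L2_mult_bounded:
  assumes f: "f \<in> L2 M" and b: "b \<in> borel_measurable M" "\<And>x. cmod (b x) \<le> C"
  shows "(\<lambda>x. b x * f x) \<in> L2 M"
proof (rule L2_dominated[where g = "\<lambda>x. C\<^sup>2 * (cmod (f x))\<^sup>2"])
  show "(\<lambda>x. b x * f x) \<in> borel_measurable M" using f b by (auto simp: L2_def)
  show "integrable M (\<lambda>x. C\<^sup>2 * (cmod (f x))\<^sup>2)" using f by (auto simp: L2_def)
  show "AE x in M. (cmod (b x * f x))\<^sup>2 \<le> C\<^sup>2 * (cmod (f x))\<^sup>2"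
    using b by (auto simp: norm_mult power_mult_distrib intro!: mult_right_mono power_mono)
qed

lemma L2_cmult [intro]: "f \<in> L2 M \<Longrightarrow> (\<lambda>x. a * f x) \<in> L2 M"
  by (rule L2_mult_bounded[where C = "cmod a"]) auto

lemma L2_add [intro]:
  assumes f: "f \<in> L2 M" and g: "g \<in> L2 M" shows "(\<lambda>x. f x + g x) \<in> L2 M"
proof (rule L2_dominated[where g = "\<lambda>x. 2 * (cmod (f x))\<^sup>2 + 2 * (cmod (g x))\<^sup>2"])
  show "(\<lambda>x. f x + g x) \<in> borel_measurable M" using f g by (auto simp: L2_def)
  show "integrable M (\<lambda>x. 2 * (cmod (f x))\<^sup>2 + 2 * (cmod (g x))\<^sup>2)" using f g by (auto simp: L2_def)
  have "(cmod (a + b))\<^sup>2 \<le> 2 * (cmod a)\<^sup>2 + 2 * (cmod b)\<^sup>2" for a b :: complex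
  proof -
    have "(cmod (a + b))\<^sup>2 \<le> (cmod a + cmod b)\<^sup>2" by (simp add: power_mono norm_triangle_ineq)
    also have "\<dots> \<le> 2 * (cmod a)\<^sup>2 + 2 * (cmod b)\<^sup>2"
      using zero_le_power2[of "cmod a - cmod b"] by (simp add: power2_eq_square algebra_simps)
    finally show ?thesis .
  qed
  then show "AE x in M. (cmod (f x + g x))\<^sup>2 \<le> 2 * (cmod (f x))\<^sup>2 + 2 * (cmod (g x))\<^sup>2"
    by auto
qed

lemma L2_diff [intro]: "f \<in> L2 M \<Longrightarrow> g \<in> L2 M \<Longrightarrow> (\<lambda>x. f x - g x) \<in> L2 M"
  using L2_add[of f M "\<lambda>x. (-1) * g x"] L2_cmult[of g M "-1"] by simp

lemma L2_sum [intro]: "(\<And>i. i \<in> A \<Longrightarrow> f i \<in> L2 M) \<Longrightarrow> (\<lambda>x. \<Sum>i\<in>A. f i x) \<in> L2 M"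
  by (induction A rule: infinite_finite_induct) auto

lemma L2_cnj [intro]: "f \<in> L2 M \<Longrightarrow> (\<lambda>x. cnj (f x)) \<in> L2 M"
  by (simp add: L2_def borel_measurable_cnj)

lemma L2_cong_AE:
  assumes "f \<in> L2 M" "g \<in> borel_measurable M" "AE x in M. f x = g x" shows "g \<in> L2 M"
  by (rule L2_dominated[OF assms(2) L2_integrable_square[OF assms(1)]]) (use assms(3) in auto)

lemma mult_le_sum_squares:
  fixes a b :: real
  assumes "a \<ge> 0" "b \<ge> 0" shows "a * b \<le> a\<^sup>2 + b\<^sup>2"
  using zero_le_power2[of "a - b"] mult_nonneg_nonneg[OF assms] by (simp add: power2_eq_square algebra_simps)

lemma L2_integrable_norm_mult:
  assumes f: "f \<in> L2 M" and g: "g \<in> L2 M"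
  shows "integrable M (\<lambda>x. cmod (f x) * cmod (g x))"
proof (rule Bochner_Integration.integrable_bound[where f = "\<lambda>x. (cmod (f x))\<^sup>2 + (cmod (g x))\<^sup>2"])
  show "integrable M (\<lambda>x. (cmod (f x))\<^sup>2 + (cmod (g x))\<^sup>2)" using f g by (auto simp: L2_def)
  show "(\<lambda>x. cmod (f x) * cmod (g x)) \<in> borel_measurable M" using f g by (auto simp: L2_def)
  show "AE x in M. norm (cmod (f x) * cmod (g x)) \<le> norm ((cmod (f x))\<^sup>2 + (cmod (g x))\<^sup>2)"
    by (simp add: mult_le_sum_squares)
qed

lemma L2_integrable_mult:
  assumes f: "f \<in> L2 M" and g: "g \<in> L2 M"
  shows "integrable M (\<lambda>x. f x * g x)"
  by (rule Bochner_Integration.integrable_bound[OF L2_integrable_norm_mult[OF f g]])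
     (use f g in \<open>auto simp: norm_mult L2_def\<close>)

lemma L2_integrable_mult_cnj:
  "f \<in> L2 M \<Longrightarrow> g \<in> L2 M \<Longrightarrow> integrable M (\<lambda>x. f x * cnj (g x))"
  by (rule L2_integrable_mult) auto

lemma L2_norm_nonneg [simp]: "0 \<le> L2_norm M f"
  by (simp add: L2_norm_def)

lemma L2_norm_sq: "(L2_norm M f)\<^sup>2 = (\<integral>x. (cmod (f x))\<^sup>2 \<partial>M)"
  by (simp add: L2_norm_def)

lemma L2_inner_self: "L2_inner M f f = of_real ((L2_norm M f)\<^sup>2)"
  unfolding L2_inner_def L2_norm_sq integral_complex_of_real[symmetric] complex_norm_square ..

lemma L2_inner_commute: "L2_inner M g f = cnj (L2_inner M f g)"
proof -
  have "(\<lambda>x. g x * cnj (f x)) = (\<lambda>x. cnj (f x * cnj (g x)))" by (simp add: mult.commute)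
  then show ?thesis unfolding L2_inner_def by (simp only: Bochner_Integration.integral_cnj)
qed

lemma L2_inner_add_left: "f \<in> L2 M \<Longrightarrow> g \<in> L2 M \<Longrightarrow> h \<in> L2 M \<Longrightarrow>
    L2_inner M (\<lambda>x. f x + g x) h = L2_inner M f h + L2_inner M g h"
  by (simp add: L2_inner_def distrib_right L2_integrable_mult_cnj)

lemma L2_inner_diff_left: "f \<in> L2 M \<Longrightarrow> g \<in> L2 M \<Longrightarrow> h \<in> L2 M \<Longrightarrow>
    L2_inner M (\<lambda>x. f x - g x) h = L2_inner M f h - L2_inner M g h"
  by (simp add: L2_inner_def left_diff_distrib L2_integrable_mult_cnj)

lemma L2_inner_add_right: "f \<in> L2 M \<Longrightarrow> g \<in> L2 M \<Longrightarrow> h \<in> L2 M \<Longrightarrow>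
    L2_inner M h (\<lambda>x. f x + g x) = L2_inner M h f + L2_inner M h g"
  by (simp add: L2_inner_def distrib_left L2_integrable_mult_cnj)

lemma L2_inner_diff_right: "f \<in> L2 M \<Longrightarrow> g \<in> L2 M \<Longrightarrow> h \<in> L2 M \<Longrightarrow>
    L2_inner M h (\<lambda>x. f x - g x) = L2_inner M h f - L2_inner M h g"
  by (simp add: L2_inner_def right_diff_distrib L2_integrable_mult_cnj)

lemma L2_inner_cmult_left: "L2_inner M (\<lambda>x. a * f x) h = a * L2_inner M f h"
  by (simp add: L2_inner_def mult.assoc)

lemma L2_inner_cmult_right: "L2_inner M h (\<lambda>x. a * f x) = cnj a * L2_inner M h f"
  by (simp add: L2_inner_def mult.left_commute)

lemma L2_inner_sum_left: "(\<And>i. i \<in> A \<Longrightarrow> f i \<in> L2 M) \<Longrightarrow> h \<in> L2 M \<Longrightarrow>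
    L2_inner M (\<lambda>x. \<Sum>i\<in>A. f i x) h = (\<Sum>i\<in>A. L2_inner M (f i) h)"
  by (simp add: L2_inner_def sum_distrib_right L2_integrable_mult_cnj)

lemma L2_inner_sum_right: "(\<And>i. i \<in> A \<Longrightarrow> f i \<in> L2 M) \<Longrightarrow> h \<in> L2 M \<Longrightarrow>
    L2_inner M h (\<lambda>x. \<Sum>i\<in>A. f i x) = (\<Sum>i\<in>A. L2_inner M h (f i))"
  by (simp add: L2_inner_def sum_distrib_left L2_integrable_mult_cnj)

lemma quadratic_nonneg_discriminant:
  fixes a b I :: real
  assumes "\<And>t. 0 \<le> a * t\<^sup>2 + 2 * I * t + b" "a \<ge> 0"
  shows "I\<^sup>2 \<le> a * b"
proof (cases "a = 0")
  case True
  have "I = 0"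
  proof (rule ccontr)
    assume "I \<noteq> 0"
    with assms(1)[of "- (b + 1) / (2 * I)"] True show False by simp
  qed
  then show ?thesis using True by simp
next
  case False
  then have "a > 0" using assms by simp
  have "0 \<le> a * (a * (- I / a)\<^sup>2 + 2 * I * (- I / a) + b)"
    by (intro mult_nonneg_nonneg assms)
  also have "\<dots> = a * b - I\<^sup>2" using \<open>a > 0\<close> by (simp add: power2_eq_square field_simps)
  finally show ?thesis by simp
qed

lemma L2_norm_mult_integral_le:
  assumes f: "f \<in> L2 M" and g: "g \<in> L2 M"
  shows "(\<integral>x. cmod (f x) * cmod (g x) \<partial>M) \<le> L2_norm M f * L2_norm M g"
proof -
  let ?I = "\<integral>x. cmod (f x) * cmod (g x) \<partial>M"
  note int = L2_integrable_square[OF f] L2_integrable_square[OF g] L2_integrable_norm_mult[OF f g]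
  have "0 \<le> (L2_norm M f)\<^sup>2 * t\<^sup>2 + 2 * ?I * t + (L2_norm M g)\<^sup>2" for t
  proof -
    have "0 \<le> (\<integral>x. (t * cmod (f x) + cmod (g x))\<^sup>2 \<partial>M)" by simp
    also have "(\<lambda>x. (t * cmod (f x) + cmod (g x))\<^sup>2)
        = (\<lambda>x. t\<^sup>2 * (cmod (f x))\<^sup>2 + (2 * t) * (cmod (f x) * cmod (g x)) + (cmod (g x))\<^sup>2)"
      by (auto simp: power2_eq_square algebra_simps)
    also have "(\<integral>x. \<dots> x \<partial>M) = t\<^sup>2 * (L2_norm M f)\<^sup>2 + (2 * t) * ?I + (L2_norm M g)\<^sup>2"
      using int by (simp add: L2_norm_sq)
    finally show ?thesis by (simp add: algebra_simps)
  qed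
  then have "?I\<^sup>2 \<le> (L2_norm M f)\<^sup>2 * (L2_norm M g)\<^sup>2"
    by (rule quadratic_nonneg_discriminant) auto
  then have "?I\<^sup>2 \<le> (L2_norm M f * L2_norm M g)\<^sup>2" by (simp add: power_mult_distrib)
  then show ?thesis by (rule power2_le_imp_le) auto
qed

lemma L2_Cauchy_Schwarz:
  assumes f: "f \<in> L2 M" and g: "g \<in> L2 M"
  shows "cmod (L2_inner M f g) \<le> L2_norm M f * L2_norm M g"
proof -
  have "cmod (L2_inner M f g) \<le> (\<integral>x. cmod (f x * cnj (g x)) \<partial>M)"
    unfolding L2_inner_def by (rule integral_norm_bound)
  also have "\<dots> \<le> L2_norm M f * L2_norm M g"
    using L2_norm_mult_integral_le[OF f g] by (simp add: norm_mult)
  finally show ?thesis .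
qed

lemma L2_norm_triangle:
  assumes f: "f \<in> L2 M" and g: "g \<in> L2 M"
  shows "L2_norm M (\<lambda>x. f x + g x) \<le> L2_norm M f + L2_norm M g"
proof (rule power2_le_imp_le)
  have "complex_of_real ((L2_norm M (\<lambda>x. f x + g x))\<^sup>2)
      = L2_inner M f f + L2_inner M f g + (cnj (L2_inner M f g) + L2_inner M g g)"
    using f g by (simp add: L2_inner_self[symmetric] L2_inner_add_left L2_inner_add_right L2_add
        L2_inner_commute[of M g f] del: of_real_power)
  then have "(L2_norm M (\<lambda>x. f x + g x))\<^sup>2 = (L2_norm M f)\<^sup>2 + 2 * Re (L2_inner M f g) + (L2_norm M g)\<^sup>2"
    by (simp add: complex_eq_iff L2_inner_self del: of_real_power)
  also have "Re (L2_inner M f g) \<le> L2_norm M f * L2_norm M g"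
    using L2_Cauchy_Schwarz[OF f g] complex_Re_le_cmod order_trans by blast
  finally show "(L2_norm M (\<lambda>x. f x + g x))\<^sup>2 \<le> (L2_norm M f + L2_norm M g)\<^sup>2"
    by (simp add: power2_eq_square algebra_simps)
qed simp

lemma L2_norm_minus_commute: "L2_norm M (\<lambda>x. f x - g x) = L2_norm M (\<lambda>x. g x - f x)"
  by (simp add: L2_norm_def norm_minus_commute)

lemma L2_norm_cmult: "L2_norm M (\<lambda>x. a * f x) = cmod a * L2_norm M f"
  by (simp add: L2_norm_def norm_mult power_mult_distrib real_sqrt_mult)

lemma L2_norm_le_diff:
  assumes f: "f \<in> L2 M" and g: "g \<in> L2 M"
  shows "L2_norm M f \<le> L2_norm M g + L2_norm M (\<lambda>x. f x - g x)"
  using L2_norm_triangle[OF g L2_diff[OF f g]] by simp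

lemma L2_norm_diff_triangle:
  assumes "f \<in> L2 M" "g \<in> L2 M" "h \<in> L2 M"
  shows "L2_norm M (\<lambda>x. f x - h x) \<le> L2_norm M (\<lambda>x. f x - g x) + L2_norm M (\<lambda>x. g x - h x)"
  using L2_norm_triangle[OF L2_diff[OF assms(1,2)] L2_diff[OF assms(2,3)]] by simp

lemma L2_norm_mono:
  assumes "g \<in> L2 M" "f \<in> borel_measurable M" "AE x in M. cmod (f x) \<le> cmod (g x)"
  shows "L2_norm M f \<le> L2_norm M g"
proof -
  have *: "AE x in M. (cmod (f x))\<^sup>2 \<le> (cmod (g x))\<^sup>2" using assms(3) by (auto intro: power_mono)
  have "f \<in> L2 M" by (rule L2_dominated[OF assms(2) L2_integrable_square[OF assms(1)] *])
  then show ?thesis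
    unfolding L2_norm_def using * assms by (intro real_sqrt_le_mono integral_mono_AE) (auto simp: L2_def)
qed

lemma L2_tendsto_inner_left:
  assumes f: "\<And>n. f n \<in> L2 M" "g \<in> L2 M" "h \<in> L2 M" and lim: "(\<lambda>n. L2_norm M (\<lambda>x. f n x - g x)) \<longlonglongrightarrow> 0"
  shows "(\<lambda>n. L2_inner M (f n) h) \<longlonglongrightarrow> L2_inner M g h"
proof (rule Lim_null_comparison[THEN Lim_null[THEN iffD2]])
  show "\<forall>\<^sub>F n in sequentially. norm (L2_inner M (f n) h - L2_inner M g h)
      \<le> L2_norm M (\<lambda>x. f n x - g x) * L2_norm M h"
    using f L2_Cauchy_Schwarz[OF L2_diff[OF f(1,2)] f(3)]
    by (auto intro!: always_eventually simp: L2_inner_diff_left)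
  show "(\<lambda>n. L2_norm M (\<lambda>x. f n x - g x) * L2_norm M h) \<longlonglongrightarrow> 0"
    using tendsto_mult_left_zero[OF lim] by simp
qed

lemma L2_tendsto_inner_right:
  assumes f: "\<And>n. f n \<in> L2 M" "g \<in> L2 M" "h \<in> L2 M" and lim: "(\<lambda>n. L2_norm M (\<lambda>x. f n x - g x)) \<longlonglongrightarrow> 0"
  shows "(\<lambda>n. L2_inner M h (f n)) \<longlonglongrightarrow> L2_inner M h g"
proof -
  have "(\<lambda>n. cnj (L2_inner M (f n) h)) \<longlonglongrightarrow> cnj (L2_inner M g h)"
    by (intro tendsto_cnj L2_tendsto_inner_left assms)
  then show ?thesis
    by (subst L2_inner_commute, subst (2) L2_inner_commute)
qed

lemma L2_dominated_convergence:
  assumes s: "\<And>n. s n \<in> borel_measurable M" and f: "f \<in> borel_measurable M"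
    and w: "integrable M w" "\<And>n. AE x in M. (cmod (s n x - f x))\<^sup>2 \<le> w x"
    and lim: "AE x in M. (\<lambda>n. s n x) \<longlonglongrightarrow> f x"
  shows "(\<lambda>n. L2_norm M (\<lambda>x. s n x - f x)) \<longlonglongrightarrow> 0"
proof -
  note [measurable] = s f
  have "(\<lambda>n. \<integral>x. (cmod (s n x - f x))\<^sup>2 \<partial>M) \<longlonglongrightarrow> (\<integral>x. 0 \<partial>M)"
  proof (rule integral_dominated_convergence[where w = w])
    show "AE x in M. (\<lambda>n. (cmod (s n x - f x))\<^sup>2) \<longlonglongrightarrow> 0"
      using lim
    proof eventually_elim
      case (elim x)
      then have "(\<lambda>n. s n x - f x) \<longlonglongrightarrow> 0" by (rule LIM_zero)
      then have "(\<lambda>n. cmod (s n x - f x)) \<longlonglongrightarrow> 0" by (rule tendsto_norm_zero)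
      from tendsto_power[OF this, of 2] show ?case by simp
    qed
  qed (use w in auto)
  from tendsto_real_sqrt[OF this] show ?thesis by (simp add: L2_norm_def)
qed

lemma L2_norm_eq_0_iff:
  assumes "f \<in> L2 M" shows "L2_norm M f = 0 \<longleftrightarrow> (AE x in M. f x = 0)"
proof -
  have "L2_norm M f = 0 \<longleftrightarrow> (\<integral>x. (cmod (f x))\<^sup>2 \<partial>M) = 0" by (simp add: L2_norm_def)
  also have "\<dots> \<longleftrightarrow> (AE x in M. (cmod (f x))\<^sup>2 = 0)"
    by (rule integral_nonneg_eq_0_iff_AE[OF L2_integrable_square[OF assms]]) auto
  finally show ?thesis by simp
qed

section \<open>Haar measure\<close>

context local_field_setup
begin

lemma sets_M [simp, measurable_cong]: "sets M = sets borel"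
  using haar by (simp add: haar_measure_def)

lemma space_M [simp]: "space M = UNIV"
  using sets_eq_imp_space_eq[OF sets_M] by simp

definition coset :: "'a \<Rightarrow> int \<Rightarrow> 'a set" where
  "coset a k = {x. x - a \<in> disc k}"

lemma coset_eq_image: "coset a k = (+) a ` disc k"
  unfolding coset_def using coset_iff by auto

lemma coset_0 [simp]: "coset 0 k = disc k"
  by (simp add: coset_def)

lemma coset_refl [simp]: "a \<in> coset a k"
  by (simp add: coset_def)

lemma coset_eq: "b \<in> coset a k \<Longrightarrow> coset b k = coset a k"
proof -
  assume "b \<in> coset a k"
  then have "x - b \<in> disc k \<longleftrightarrow> x - a \<in> disc k" for x
    using disc_add_iff[of "b - a" k "x - b"] by (simp add: coset_def)
  then show ?thesis by (simp add: coset_def)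
qed

lemma coset_mono: "k \<le> l \<Longrightarrow> coset a k \<subseteq> coset a l"
  using disc_mono[of k l] by (auto simp: coset_def)

lemma borel_measurable_M_continuous: "continuous_on UNIV f \<Longrightarrow> f \<in> borel_measurable M"
  using borel_measurable_continuous_onI[of f] by (simp add: measurable_cong_sets[OF sets_M refl])

lemma coset_borel [measurable]: "coset a k \<in> sets borel"
  unfolding coset_eq_image by (intro borel_open open_coset)

lemma disc_borel [measurable]: "disc k \<in> sets borel"
  using coset_borel[of 0 k] by simp

lemma measurable_translate [measurable]: "(\<lambda>x. x + a) \<in> borel_measurable (borel :: 'a measure)"
  by (intro borel_measurable_continuous_onI continuous_on_add_const_local_field)

lemma measurable_mult_left [measurable]: "(\<lambda>x. a * x) \<in> borel_measurable (borel :: 'a measure)"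
  by (intro borel_measurable_continuous_onI continuous_on_mult_left_local_field)

lemma measurable_chi [measurable]: "chi \<in> borel_measurable borel"
  by (intro borel_measurable_continuous_onI continuous_on_chi)

lemma measurable_chi_mult [measurable]: "(\<lambda>x. chi (a * x)) \<in> borel_measurable borel"
  by (rule measurable_compose[OF measurable_mult_left measurable_chi])

lemma measurable_comp_affine:
  assumes "f \<in> borel_measurable M" shows "(\<lambda>x. f (a * x + b)) \<in> borel_measurable M"
proof -
  have "(\<lambda>x. a * x + b) \<in> measurable M M" by simp
  from measurable_compose[OF this assms] show ?thesis .
qed

lemma measurable_comp_translate: "f \<in> borel_measurable M \<Longrightarrow> (\<lambda>x. f (x + b)) \<in> borel_measurable M"
  using measurable_comp_affine[of f 1 b] by simp

lemma measurable_comp_mult: "f \<in> borel_measurable M \<Longrightarrow> (\<lambda>x. f (a * x)) \<in> borel_measurable M"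
  using measurable_comp_affine[of f a 0] by simp

lemma distr_translate: "distr M M (\<lambda>x. x + a) = M"
proof (rule measure_eqI)
  fix A assume "A \<in> sets (distr M M (\<lambda>x. x + a))"
  then have [measurable]: "A \<in> sets borel" by simp
  have "emeasure (distr M M (\<lambda>x. x + a)) A = emeasure M {x. x + a \<in> A}"
    by (subst emeasure_distr) (auto simp: vimage_def)
  also have "{x. x + a \<in> A} \<in> sets borel"
    using measurable_sets[OF measurable_translate[of a], of A] by (simp add: vimage_def)
  then have "emeasure M {x. x + a \<in> A} = emeasure M ((+) a ` {x. x + a \<in> A})"
    using haar by (simp add: haar_measure_def)
  also have "(+) a ` {x. x + a \<in> A} = A"
    by (auto simp: add.commute intro!: image_eqI[of _ _ "_ - a"])
  finally show "emeasure (distr M M (\<lambda>x. x + a)) A = emeasure M A" .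
qed simp

lemma AE_translate: "(AE x in M. P x) \<Longrightarrow> (AE x in M. P (x + a))"
  by (rule AE_distrD[of "\<lambda>x. x + a" M M P]) (simp_all only: distr_translate, simp)

lemma integral_translate:
  fixes f :: "'a \<Rightarrow> 'b :: {banach, second_countable_topology}"
  assumes "f \<in> borel_measurable M"
  shows "(\<integral>x. f (x + a) \<partial>M) = (\<integral>x. f x \<partial>M)"
  using integral_distr[of "\<lambda>x. x + a" M M f] assms by (simp add: distr_translate)

lemma integrable_translate:
  fixes f :: "'a \<Rightarrow> 'b :: {banach, second_countable_topology}"
  assumes "f \<in> borel_measurable M"
  shows "integrable M (\<lambda>x. f (x + a)) \<longleftrightarrow> integrable M f"
  using integrable_distr_eq[of "\<lambda>x. x + a" M M f] assms by (simp add: distr_translate)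

lemma pp_powi_coset_iff: "\<pp> powi k * x \<in> coset a l \<longleftrightarrow> x \<in> coset (\<pp> powi (- k) * a) (l + k)"
proof -
  have "\<pp> powi k * (x - \<pp> powi (- k) * a) = \<pp> powi k * x - a"
    by (simp only: right_diff_distrib mult.assoc[symmetric] pp_powi_inverse mult_1)
  then show ?thesis using pp_powi_disc_iff[of k "x - \<pp> powi (- k) * a" l]
    unfolding coset_def mem_Collect_eq by simp
qed

text \<open>The scaled representatives decompose a disc into cosets of a smaller one. This is the source
  of the Haar measure of discs and of the expansion of locally constant functions.\<close>

lemma disc_split: "disc (k + int n) = (\<Union>i<q ^ n. coset (\<pp> powi (- k) * u i) k)"
  and disc_split_disjoint: "disjoint_family_on (\<lambda>i. coset (\<pp> powi (- k) * u i) k) {..<q ^ n}"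
proof -
  have *: "x \<in> coset (\<pp> powi (- k) * u i) k \<longleftrightarrow> \<pp> powi k * x - u i \<in> disc 0" for x i
    using pp_powi_coset_iff[of k x "u i" 0] by (simp add: coset_def)
  have **: "x \<in> disc (k + int n) \<longleftrightarrow> \<pp> powi k * x \<in> disc (int n)" for x
    using pp_powi_disc_iff[of k x "int n"] by (simp add: add.commute)
  show "disc (k + int n) = (\<Union>i<q ^ n. coset (\<pp> powi (- k) * u i) k)"
  proof (intro equalityI subsetI)
    fix x assume "x \<in> disc (k + int n)"
    then show "x \<in> (\<Union>i<q ^ n. coset (\<pp> powi (- k) * u i) k)"
      unfolding ** using ex_coset_rep by (auto simp: *)
  next
    fix x assume "x \<in> (\<Union>i<q ^ n. coset (\<pp> powi (- k) * u i) k)"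
    then obtain i where i: "i < q ^ n" "\<pp> powi k * x - u i \<in> disc 0" by (auto simp: *)
    have "(\<pp> powi k * x - u i) + u i \<in> disc (int n)"
      using i disc_mono[of 0 "int n"] u_in_disc[OF i(1)] by (intro disc_add) auto
    then show "x \<in> disc (k + int n)" by (simp add: **)
  qed
  show "disjoint_family_on (\<lambda>i. coset (\<pp> powi (- k) * u i) k) {..<q ^ n}"
    unfolding disjoint_family_on_def
  proof safe
    fix i j x assume "x \<in> coset (\<pp> powi (- k) * u i) k" "x \<in> coset (\<pp> powi (- k) * u j) k" "i \<noteq> j"
    then have "(\<pp> powi k * x - u j) - (\<pp> powi k * x - u i) \<in> disc 0"
      unfolding * using disc_diff[of "\<pp> powi k * x - u j" 0 "\<pp> powi k * x - u i"] by simp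
    then have "i = j" using u_eq_iff[of i j] by simp
    then show "x \<in> {}" using \<open>i \<noteq> j\<close> by simp
  qed
qed

lemma emeasure_disc_finite: "emeasure M (disc k) < \<infinity>"
  using haar compact_disc by (auto simp: haar_measure_def)

lemma emeasure_coset_disc: "emeasure M (coset a k) = emeasure M (disc k)"
  unfolding coset_eq_image using haar disc_borel by (simp add: haar_measure_def)

lemma measure_disc: "measure M (disc k) = real q powi k"
proof -
  have *: "measure M (disc (k + int n)) = real q ^ n * measure M (disc k)" for k n
  proof -
    have "measure M (disc (k + int n)) = (\<Sum>i<q ^ n. measure M (coset (\<pp> powi (- k) * u i) k))"
      unfolding disc_split using disc_split_disjoint[of k n] emeasure_disc_finite[of k]
      by (intro measure_UNION') (auto simp: emeasure_coset_disc fmeasurable_def pairwise_def disjoint_family_on_def disjnt_def)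
    also have "\<dots> = (\<Sum>i<q ^ n. measure M (disc k))"
      by (simp add: measure_def emeasure_coset_disc)
    finally show ?thesis by simp
  qed
  have 1: "measure M (disc 0) = 1" using haar by (simp add: measure_def disc_0)
  show ?thesis
  proof (cases "k \<ge> 0")
    case True
    then show ?thesis using *[of 0 "nat k"] 1 by (simp add: power_int_def)
  next
    case False
    then have "real q ^ nat (- k) * measure M (disc k) = 1" using *[of k "nat (- k)"] 1 by simp
    moreover have "real q powi k = inverse (real q ^ nat (- k))" using False by (simp add: power_int_def power_inverse)
    ultimately show ?thesis by (metis inverse_unique)
  qed
qed

lemma measure_coset: "measure M (coset a k) = real q powi k"
  using measure_disc by (simp add: measure_def emeasure_coset_disc)

lemma emeasure_coset: "emeasure M (coset a k) = ennreal (real q powi k)"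
  using emeasure_eq_ennreal_measure[of M "coset a k"] emeasure_disc_finite[of k]
  by (simp add: measure_coset emeasure_coset_disc)

subsection \<open>The cosets generate the Borel sets\<close>

lemma ex_coset_center: "\<exists>i. x \<in> coset (\<pp> powi (- k) * u i) k"
proof -
  obtain n where n: "x \<in> disc (int n)" using disc_exhaust by blast
  have "disc (int n) \<subseteq> disc (k + int (n + nat (- k)))" by (intro disc_mono) auto
  then show ?thesis using n unfolding disc_split by auto
qed

lemma countable_cosets: "countable (range (\<lambda>(a, k). coset a k))"
proof -
  have "range (\<lambda>(a, k). coset a k) \<subseteq> range (\<lambda>(i, k). coset (\<pp> powi (- k) * u i) k)"
  proof clarify
    fix a k
    obtain i where "a \<in> coset (\<pp> powi (- k) * u i) k" using ex_coset_center by blast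
    then have "coset a k = coset (\<pp> powi (- k) * u i) k" by (rule coset_eq)
    then show "coset a k \<in> range (\<lambda>(i, k). coset (\<pp> powi (- k) * u i) k)"
      by (intro image_eqI[of _ _ "(i, k)"]) auto
  qed
  then show ?thesis by (rule countable_subset) auto
qed

abbreviation cosets :: "'a set set" where "cosets \<equiv> insert {} (range (\<lambda>(a, k). coset a k))"

lemma Int_stable_cosets: "Int_stable cosets"
proof (rule Int_stableI)
  have *: "coset a k \<inter> coset b l \<in> cosets" if "k \<le> l" for a b k l
  proof (cases "coset a k \<inter> coset b l = {}")
    case False
    then obtain x where x: "x \<in> coset a k" "x \<in> coset b l" by blast
    then have "coset a k \<subseteq> coset b l" using coset_eq coset_mono[OF that, of x] by metis
    then have "coset a k \<inter> coset b l = coset a k" by blast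
    then show ?thesis by (auto intro: image_eqI[of _ _ "(a, k)"])
  qed simp
  fix A B assume "A \<in> cosets" "B \<in> cosets"
  then consider "A \<inter> B = {}" | a k b l where "A = coset a k" "B = coset b l" by auto
  then show "A \<inter> B \<in> cosets"
  proof cases
    case 2
    then show ?thesis using *[of k l a b] *[of l k b a] by (cases "k \<le> l") (auto simp: Int_commute)
  qed simp
qed

text \<open>Every open set is a union of cosets of discs, and there are only countably many of these,
  because their centres can be chosen among the scaled representatives.\<close>

lemma borel_eq_sigma_cosets: "sets (borel :: 'a measure) = sigma_sets UNIV cosets"
proof
  show "sigma_sets UNIV cosets \<subseteq> sets (borel :: 'a measure)"
  proof -
    have "cosets \<subseteq> sets (borel :: 'a measure)" by auto
    from sets.sigma_sets_subset[OF this] show ?thesis by simp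
  qed
  have "U \<in> sigma_sets UNIV cosets" if opn: "open U" for U :: "'a set"
  proof -
    have "U = \<Union>{C \<in> range (\<lambda>(a, k). coset a k). C \<subseteq> U}"
    proof (intro equalityI subsetI)
      fix x assume "x \<in> U"
      obtain n :: nat where "coset x (- int n) \<subseteq> U"
        using coset_subset_open[OF opn \<open>x \<in> U\<close>] by (auto simp: coset_eq_image)
      then show "x \<in> \<Union>{C \<in> range (\<lambda>(a, k). coset a k). C \<subseteq> U}"
        by (intro UnionI[of "coset x (- int n)"]) (auto intro: image_eqI[of _ _ "(x, - int n)"])
    qed auto
    moreover have "\<Union>{C \<in> range (\<lambda>(a, k). coset a k). C \<subseteq> U} \<in> sigma_sets UNIV cosets"
      using countable_cosets
      by (intro sigma_sets_UNION) (auto intro: countable_subset)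
    ultimately show ?thesis by simp
  qed
  then show "sets (borel :: 'a measure) \<subseteq> sigma_sets UNIV cosets"
    unfolding borel_def by (subst sets_measure_of) (auto intro!: sigma_sets_mono)
qed

lemma measure_eqI_cosets:
  fixes N1 N2 :: "'a measure"
  assumes "sets N1 = sets borel" "sets N2 = sets borel"
    and eq: "\<And>a k. emeasure N1 (coset a k) = emeasure N2 (coset a k)"
    and fin: "\<And>a. emeasure N1 (coset a 0) \<noteq> \<infinity>"
  shows "N1 = N2"
proof (rule measure_eqI_generator_eq[OF Int_stable_cosets, where A = "\<lambda>i. coset (u i) 0"])
  show "range (\<lambda>i. coset (u i) 0) \<subseteq> cosets" by (auto intro: image_eqI[of _ _ "(u _, 0)"])
  show "(\<Union>i. coset (u i) 0) = UNIV" using ex_coset_center[of _ 0] by auto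
qed (use assms borel_eq_sigma_cosets in auto)

subsection \<open>Dilations\<close>

text \<open>Multiplication by \<open>\<pp> powi k\<close> maps cosets to cosets, and two measures that agree on cosets
  are equal.\<close>

lemma distr_dilate: "distr M M (\<lambda>x. \<pp> powi k * x) = density M (\<lambda>_. real q powi k)"
proof (rule measure_eqI_cosets)
  have eq: "emeasure (distr M M (\<lambda>x. \<pp> powi k * x)) (coset a l) = ennreal (real q powi (l + k))" for a l
  proof -
    have "emeasure (distr M M (\<lambda>x. \<pp> powi k * x)) (coset a l) = emeasure M {x. \<pp> powi k * x \<in> coset a l}"
      by (subst emeasure_distr) (auto simp: vimage_def)
    then show ?thesis by (simp add: pp_powi_coset_iff emeasure_coset)
  qed
  show "emeasure (distr M M (\<lambda>x. \<pp> powi k * x)) (coset a l)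
      = emeasure (density M (\<lambda>_. real q powi k)) (coset a l)" for a l
    unfolding eq by (simp add: emeasure_density_const emeasure_coset power_int_add mult.commute flip: ennreal_mult)
  show "emeasure (distr M M (\<lambda>x. \<pp> powi k * x)) (coset a 0) \<noteq> \<infinity>" for a
    unfolding eq by simp
qed simp_all

lemma distr_dilate': "distr M M ((*) (\<pp> powi k)) = density M (\<lambda>_. real q powi k)"
  by (rule distr_dilate)

lemma integral_dilate:
  fixes f :: "'a \<Rightarrow> 'b :: {banach, second_countable_topology}"
  assumes "f \<in> borel_measurable M"
  shows "(\<integral>x. f (\<pp> powi k * x) \<partial>M) = (real q powi k) *\<^sub>R (\<integral>x. f x \<partial>M)"
  using integral_distr[of "\<lambda>x. \<pp> powi k * x" M M f] integral_density[of f M "\<lambda>_. real q powi k"] assms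
  by (simp add: distr_dilate')

lemma integrable_dilate:
  fixes f :: "'a \<Rightarrow> 'b :: {banach, second_countable_topology}"
  assumes "f \<in> borel_measurable M"
  shows "integrable M (\<lambda>x. f (\<pp> powi k * x)) \<longleftrightarrow> integrable M f"
proof -
  have "integrable M (\<lambda>x. f (\<pp> powi k * x)) \<longleftrightarrow> integrable M (\<lambda>x. (real q powi k) *\<^sub>R f x)"
    using integrable_distr_eq[of "\<lambda>x. \<pp> powi k * x" M M f] integrable_density[of f M "\<lambda>_. real q powi k"] assms
    by (simp add: distr_dilate')
  also have "\<dots> \<longleftrightarrow> integrable M f"
    using integrable_scaleR_right[of "inverse (real q powi k)" M "\<lambda>x. (real q powi k) *\<^sub>R f x"]
    by auto
  finally show ?thesis .
qed

lemma AE_dilate: "(AE x in M. P x) \<Longrightarrow> (AE x in M. P (\<pp> powi k * x))"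
  by (rule AE_distrD[of "\<lambda>x. \<pp> powi k * x" M M P]) (simp_all only: distr_dilate', simp_all add: AE_density)

lemma L2_translate: "f \<in> L2 M \<Longrightarrow> (\<lambda>x. f (x + a)) \<in> L2 M"
  using integrable_translate[of "\<lambda>x. (cmod (f x))\<^sup>2" a]
  by (auto simp: L2_def measurable_comp_translate)

lemma L2_norm_translate: "f \<in> L2 M \<Longrightarrow> L2_norm M (\<lambda>x. f (x + a)) = L2_norm M f"
  using integral_translate[of "\<lambda>x. (cmod (f x))\<^sup>2" a] by (auto simp: L2_def L2_norm_def)

lemma L2_dilate: "f \<in> L2 M \<Longrightarrow> (\<lambda>x. f (\<pp> powi k * x)) \<in> L2 M"
  using integrable_dilate[of "\<lambda>x. (cmod (f x))\<^sup>2" k]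
  by (auto simp: L2_def measurable_comp_mult)

text \<open>A nontrivial character integrates to 0 over a compact group: translating by an element on
  which it is not 1 multiplies the integral by that value.\<close>

lemma disc_character_integral:
  "(\<integral>x. indicator (disc k) x * chi (y * x) \<partial>M) = (if y \<in> disc (- k) then of_real (real q powi k) else 0)"
proof (cases "y \<in> disc (- k)")
  case True
  have "indicator (disc k) x * chi (y * x) = of_real (indicator (disc k) x)" for x
    using disc_mult[OF True, of x k] by (auto simp: indicator_def chi_disc)
  then show ?thesis using True measure_disc[of k] by simp
next
  case False
  obtain z where z: "z \<in> disc k" "chi (y * z) \<noteq> 1" using chi_nontrivial_disc[of y k] False by blast
  let ?f = "\<lambda>x. indicator (disc k) x * chi (y * x)"
  have "(\<integral>x. ?f x \<partial>M) = (\<integral>x. ?f (x + z) \<partial>M)"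
    by (rule integral_translate[symmetric]) simp
  also have "\<dots> = (\<integral>x. chi (y * z) * ?f x \<partial>M)"
    using disc_add_iff[OF z(1)] by (intro Bochner_Integration.integral_cong) (auto simp: indicator_def chi_add distrib_left)
  also have "\<dots> = chi (y * z) * (\<integral>x. ?f x \<partial>M)" by simp
  finally have "(\<integral>x. ?f x \<partial>M) = 0" using z(2) by (metis mult_cancel_right1)
  then show ?thesis using False by simp
qed

section \<open>Locally constant functions with compact support\<close>

text \<open>The Schwartz-Bruhat functions, with explicit parameters: \<open>disc k\<close> is a group of periods and
  \<open>disc R\<close> contains the support. The Fourier transform exchanges the two parameters.\<close>

definition step_fun :: "int \<Rightarrow> int \<Rightarrow> ('a \<Rightarrow> complex) \<Rightarrow> bool" where
  "step_fun k R f \<longleftrightarrow> (\<forall>x y. y \<in> disc k \<longrightarrow> f (x + y) = f x) \<and> (\<forall>x. x \<notin> disc R \<longrightarrow> f x = 0)"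

lemma step_fun_mono: "step_fun k R f \<Longrightarrow> k' \<le> k \<Longrightarrow> R \<le> R' \<Longrightarrow> step_fun k' R' f"
  using disc_mono[of k' k] disc_mono[of R R'] unfolding step_fun_def by blast

lemma step_fun_normalize:
  assumes "step_fun k R f" obtains n where "step_fun k (k + int n) f" "R \<le> k + int n"
  using step_fun_mono[OF assms, of k "k + int (nat (R - k))"] that[of "nat (R - k)"] by simp

lemma step_fun_expand:
  assumes "step_fun k (k + int n) f"
  shows "f x = (\<Sum>i<q ^ n. f (\<pp> powi (- k) * u i) * indicator (coset (\<pp> powi (- k) * u i) k) x)"
proof -
  have *: "f (\<pp> powi (- k) * u i) * indicator (coset (\<pp> powi (- k) * u i) k) x
      = f x * indicator (coset (\<pp> powi (- k) * u i) k) x" for i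
    using assms[unfolded step_fun_def, THEN conjunct1, rule_format, of "x - \<pp> powi (- k) * u i" "\<pp> powi (- k) * u i"]
    by (auto simp: indicator_def coset_def)
  have "(\<Sum>i<q ^ n. f (\<pp> powi (- k) * u i) * indicator (coset (\<pp> powi (- k) * u i) k) x)
      = f x * (\<Sum>i<q ^ n. indicator (coset (\<pp> powi (- k) * u i) k) x)"
    by (simp only: * sum_distrib_left)
  also have "(\<Sum>i<q ^ n. indicator (coset (\<pp> powi (- k) * u i) k) x) = (indicator (disc (k + int n)) x :: complex)"
    unfolding disc_split by (rule indicator_UN_disjoint[symmetric]) (auto simp: disc_split_disjoint)
  also have "f x * indicator (disc (k + int n)) x = f x"
    using assms by (auto simp: step_fun_def indicator_def)
  finally show ?thesis by simp
qed

lemma L2_indicator: "A \<in> sets borel \<Longrightarrow> emeasure M A < \<infinity> \<Longrightarrow> (indicator A :: 'a \<Rightarrow> complex) \<in> L2 M"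
  by (rule L2_dominated[where g = "indicator A :: 'a \<Rightarrow> real"]) (auto simp: indicator_def)

lemma L2_indicator_coset: "(indicator (coset a k) :: 'a \<Rightarrow> complex) \<in> L2 M"
  by (rule L2_indicator) (auto simp: emeasure_coset)

lemma integrable_indicator_coset: "integrable M (indicator (coset a k) :: 'a \<Rightarrow> complex)"
proof -
  have "integrable M (\<lambda>x. of_real (indicator (coset a k) x) :: complex)"
    by (intro integrable_of_real integrable_real_indicator) (auto simp: emeasure_coset)
  moreover have "(\<lambda>x. of_real (indicator (coset a k) x) :: complex) = indicator (coset a k)"
    by (auto simp: indicator_def)
  ultimately show ?thesis by metis
qed

lemma step_fun_L2: assumes "step_fun k R f" shows "f \<in> L2 M"
proof -
  obtain n where n: "step_fun k (k + int n) f" using step_fun_normalize[OF assms] .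
  have "(\<lambda>x. \<Sum>i<q ^ n. f (\<pp> powi (- k) * u i) * indicator (coset (\<pp> powi (- k) * u i) k) x) \<in> L2 M"
    by (intro L2_sum L2_cmult L2_indicator_coset)
  moreover have "f = (\<lambda>x. \<Sum>i<q ^ n. f (\<pp> powi (- k) * u i) * indicator (coset (\<pp> powi (- k) * u i) k) x)"
    by (rule ext) (rule step_fun_expand[OF n])
  ultimately show ?thesis by metis
qed

lemma step_fun_measurable: "step_fun k R f \<Longrightarrow> f \<in> borel_measurable M"
  using step_fun_L2 L2_measurable by blast

lemma step_fun_integrable: assumes "step_fun k R f" shows "integrable M f"
proof -
  obtain n where n: "step_fun k (k + int n) f" using step_fun_normalize[OF assms] .
  have "integrable M (\<lambda>x. \<Sum>i<q ^ n. f (\<pp> powi (- k) * u i) * indicator (coset (\<pp> powi (- k) * u i) k) x)"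
    by (intro Bochner_Integration.integrable_sum integrable_mult_right integrable_indicator_coset)
  moreover have "f = (\<lambda>x. \<Sum>i<q ^ n. f (\<pp> powi (- k) * u i) * indicator (coset (\<pp> powi (- k) * u i) k) x)"
    by (rule ext) (rule step_fun_expand[OF n])
  ultimately show ?thesis by metis
qed

lemma step_fun_bounded: assumes "step_fun k R f" shows "\<exists>C. \<forall>x. cmod (f x) \<le> C"
proof -
  obtain n where n: "step_fun k (k + int n) f" using step_fun_normalize[OF assms] .
  show ?thesis
  proof (intro exI allI)
    fix x
    have "cmod (f x) \<le> (\<Sum>i<q ^ n. cmod (f (\<pp> powi (- k) * u i) * indicator (coset (\<pp> powi (- k) * u i) k) x))"
      by (subst step_fun_expand[OF n]) (rule norm_sum)
    also have "\<dots> \<le> (\<Sum>i<q ^ n. cmod (f (\<pp> powi (- k) * u i)))"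
      by (intro sum_mono) (auto simp: norm_mult indicator_def)
    finally show "cmod (f x) \<le> (\<Sum>i<q ^ n. cmod (f (\<pp> powi (- k) * u i)))" .
  qed
qed

lemma step_fun_coset: "step_fun k R (indicator (coset a k \<inter> disc R))" if "k \<le> R"
proof -
  have "x + y \<in> coset a k \<inter> disc R \<longleftrightarrow> x \<in> coset a k \<inter> disc R" if y: "y \<in> disc k" for x y
  proof -
    have eq: "x + y - a = (x - a) + y" by simp
    have "x + y - a \<in> disc k \<longleftrightarrow> x - a \<in> disc k" unfolding eq by (rule disc_add_iff[OF y])
    moreover have "y \<in> disc R" using y disc_mono[OF \<open>k \<le> R\<close>] by blast
    then have "x + y \<in> disc R \<longleftrightarrow> x \<in> disc R" by (rule disc_add_iff)
    ultimately show ?thesis by (simp add: coset_def)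
  qed
  then show ?thesis unfolding step_fun_def by (simp add: indicator_def)
qed

lemma step_fun_add:
  assumes "step_fun k R f" "step_fun l S g" shows "step_fun (min k l) (max R S) (\<lambda>x. f x + g x)"
  using step_fun_mono[OF assms(1), of "min k l" "max R S"] step_fun_mono[OF assms(2), of "min k l" "max R S"]
  by (auto simp: step_fun_def)

lemma step_fun_cmult: "step_fun k R f \<Longrightarrow> step_fun k R (\<lambda>x. a * f x)"
  by (auto simp: step_fun_def)

lemma step_fun_translate:
  assumes f: "step_fun k R f" and a: "a \<in> disc R" shows "step_fun k R (\<lambda>x. f (x + a))"
proof -
  have "f (x + y + a) = f (x + a)" if "y \<in> disc k" for x y
  proof -
    have "x + y + a = (x + a) + y" by simp
    then show ?thesis using f that unfolding step_fun_def by metis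
  qed
  moreover have "f (x + a) = 0" if "x \<notin> disc R" for x
    using f disc_add_iff[OF a, of x] that by (simp add: step_fun_def)
  ultimately show ?thesis by (simp add: step_fun_def)
qed

lemma step_fun_dilate: "step_fun k R f \<Longrightarrow> step_fun (k + j) (R + j) (\<lambda>x. f (\<pp> powi j * x))"
  unfolding step_fun_def distrib_left by (simp add: pp_powi_disc_iff)

subsection \<open>Density\<close>

definition step_approx :: "('a \<Rightarrow> complex) \<Rightarrow> bool" where
  "step_approx f \<longleftrightarrow> f \<in> L2 M \<and> (\<forall>e>0. \<exists>k R s. step_fun k R s \<and> L2_norm M (\<lambda>x. f x - s x) < e)"

lemma step_approx_L2: "step_approx f \<Longrightarrow> f \<in> L2 M"
  by (simp add: step_approx_def)

lemma step_approx_step: "step_fun k R f \<Longrightarrow> step_approx f"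
  unfolding step_approx_def
  by (intro conjI allI impI step_fun_L2, assumption)
     (rule exI[of _ k], rule exI[of _ R], rule exI[of _ f], simp add: L2_norm_def)

lemma step_approx_zero: "step_approx (\<lambda>x. 0)"
  by (rule step_approx_step[of 0 0]) (simp add: step_fun_def)

lemma step_approx_disc: "step_approx (indicator (disc R))"
  using step_approx_step[OF step_fun_coset[of R R 0]] by simp

lemma step_approx_add:
  assumes f: "step_approx f" and g: "step_approx g" shows "step_approx (\<lambda>x. f x + g x)"
  unfolding step_approx_def
proof (intro conjI allI impI)
  show "(\<lambda>x. f x + g x) \<in> L2 M" using f g by (auto simp: step_approx_def)
  fix e :: real assume "e > 0"
  then have "e / 2 > 0" by simp
  then obtain k R s l S t where st: "step_fun k R s" "L2_norm M (\<lambda>x. f x - s x) < e / 2"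
      "step_fun l S t" "L2_norm M (\<lambda>x. g x - t x) < e / 2"
    using f g unfolding step_approx_def by meson
  have "L2_norm M (\<lambda>x. (f x - s x) + (g x - t x)) \<le> L2_norm M (\<lambda>x. f x - s x) + L2_norm M (\<lambda>x. g x - t x)"
    using f g st by (intro L2_norm_triangle L2_diff) (auto simp: step_approx_def step_fun_L2)
  also have "(\<lambda>x. (f x - s x) + (g x - t x)) = (\<lambda>x. f x + g x - (s x + t x))" by auto
  finally show "\<exists>k R s. step_fun k R s \<and> L2_norm M (\<lambda>x. f x + g x - s x) < e"
    using step_fun_add[OF st(1,3)] st(2,4) by fastforce
qed

lemma step_approx_cmult:
  assumes f: "step_approx f" shows "step_approx (\<lambda>x. a * f x)"
proof (cases "a = 0")
  case True
  then show ?thesis using step_approx_zero by simp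
next
  case False
  show ?thesis unfolding step_approx_def
  proof (intro conjI allI impI)
    show "(\<lambda>x. a * f x) \<in> L2 M" using f by (auto simp: step_approx_def)
    fix e :: real assume "e > 0"
    then have "e / cmod a > 0" using False by simp
    then obtain k R s where s: "step_fun k R s" "L2_norm M (\<lambda>x. f x - s x) < e / cmod a"
      using f unfolding step_approx_def by meson
    have "L2_norm M (\<lambda>x. a * f x - a * s x) = cmod a * L2_norm M (\<lambda>x. f x - s x)"
      by (simp add: right_diff_distrib[symmetric] L2_norm_cmult)
    then have "L2_norm M (\<lambda>x. a * f x - a * s x) < e" using s(2) False by (simp add: field_simps)
    then show "\<exists>k R s. step_fun k R s \<and> L2_norm M (\<lambda>x. a * f x - s x) < e"
      using step_fun_cmult[OF s(1)] by blast
  qed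
qed

lemma step_approx_sum: "finite A \<Longrightarrow> (\<And>i. i \<in> A \<Longrightarrow> step_approx (f i)) \<Longrightarrow> step_approx (\<lambda>x. \<Sum>i\<in>A. f i x)"
proof (induction A rule: finite_induct)
  case empty
  show ?case using step_approx_zero by simp
qed (auto intro: step_approx_add)

lemma step_approx_limit:
  assumes s: "\<And>n. step_approx (s n)" and f: "f \<in> L2 M" and lim: "(\<lambda>n. L2_norm M (\<lambda>x. s n x - f x)) \<longlonglongrightarrow> 0"
  shows "step_approx f"
  unfolding step_approx_def
proof (intro conjI allI impI f)
  fix e :: real assume "e > 0"
  then have "\<forall>\<^sub>F n in sequentially. L2_norm M (\<lambda>x. s n x - f x) < e / 2"
    using lim by (intro order_tendstoD) auto
  then obtain n where n: "L2_norm M (\<lambda>x. s n x - f x) < e / 2" by (auto simp: eventually_sequentially)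
  obtain k R t where t: "step_fun k R t" "L2_norm M (\<lambda>x. s n x - t x) < e / 2"
    using s[of n] \<open>e > 0\<close> unfolding step_approx_def by (meson half_gt_zero)
  have "L2_norm M (\<lambda>x. f x - t x) \<le> L2_norm M (\<lambda>x. f x - s n x) + L2_norm M (\<lambda>x. s n x - t x)"
    by (rule L2_norm_diff_triangle) (use f s t step_approx_L2 step_fun_L2 in blast)+
  then have "L2_norm M (\<lambda>x. f x - t x) < e"
    using n t(2) by (simp add: L2_norm_minus_commute[of M f "s n"])
  then show "\<exists>k R s. step_fun k R s \<and> L2_norm M (\<lambda>x. f x - s x) < e" using t by blast
qed

text \<open>The sets \<open>A\<close> for which the claim holds form a Dynkin system containing the cosets.\<close>

lemma step_approx_indicator_bounded:
  assumes "A \<in> sets borel" shows "step_approx (indicator (A \<inter> disc (int N)))"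
proof -
  have "cosets \<subseteq> Pow UNIV" "A \<in> sigma_sets UNIV cosets"
    using assms borel_eq_sigma_cosets by simp_all
  with Int_stable_cosets show ?thesis
  proof (induction rule: sigma_sets_induct_disjoint)
    case (basic A)
    then consider "A = {}" | a k where "A = coset a k" by auto
    then show ?case
    proof cases
      case 1
      then show ?thesis using step_approx_zero by simp
    next
      case (2 a k)
      show ?thesis
      proof (cases "k \<le> int N")
        case True
        then show ?thesis using step_fun_coset 2 step_approx_step by blast
      next
        case False
        have "coset a k \<inter> disc (int N) = (if 0 \<in> coset a k then disc (int N) else {})"
        proof (cases "\<exists>x. x \<in> coset a k \<inter> disc (int N)")
          case True
          then obtain x where x: "x \<in> coset a k" "x \<in> disc (int N)" by blast
          have "disc (int N) \<subseteq> coset x k"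
            using disc_diff[OF _ x(2)] disc_mono[of "int N" k] False by (auto simp: coset_def)
          moreover have "0 \<in> disc (int N)" by simp
          ultimately show ?thesis using coset_eq[OF x(1)] by (auto simp del: zero_in_disc)
        next
          case False
          then show ?thesis by (auto simp: disjoint_iff)
        qed
        then show ?thesis using 2 step_approx_zero step_approx_disc by simp
      qed
    qed
  next
    case empty
    show ?case using step_approx_zero by simp
  next
    case (compl A)
    have "step_approx (\<lambda>x. indicator (disc (int N)) x + (- 1) * indicator (A \<inter> disc (int N)) x)"
      using compl by (intro step_approx_add step_approx_cmult step_approx_disc)
    also have "(\<lambda>x. indicator (disc (int N)) x + (- 1) * indicator (A \<inter> disc (int N)) x)
        = (indicator ((UNIV - A) \<inter> disc (int N)) :: 'a \<Rightarrow> complex)"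
      by (auto simp: fun_eq_iff indicator_def)
    finally show ?case .
  next
    case (union A)
    have meas [measurable]: "A i \<in> sets borel" for i using union borel_eq_sigma_cosets by auto
    have sum: "(\<lambda>x. \<Sum>i<n. indicator (A i \<inter> disc (int N)) x)
        = (indicator ((\<Union>i<n. A i \<inter> disc (int N))) :: 'a \<Rightarrow> complex)" for n
      using union(1) by (intro ext indicator_UN_disjoint[symmetric])
        (auto simp: disjoint_family_on_def)
    show ?case
    proof (rule step_approx_limit)
      show "step_approx (indicator (\<Union>i<n. A i \<inter> disc (int N)))" for n
        using step_approx_sum[of "{..<n}" "\<lambda>i. indicator (A i \<inter> disc (int N))"] union(3) by (simp add: sum)
      have fin: "emeasure M (\<Union> (range A) \<inter> disc (int N)) < \<infinity>"
        using emeasure_mono[of "\<Union> (range A) \<inter> disc (int N)" "disc (int N)" M] emeasure_disc_finite[of "int N"]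
        by (auto intro: le_less_trans)
      show "indicator (\<Union> (range A) \<inter> disc (int N)) \<in> L2 M"
        using fin by (intro L2_indicator) auto
      show "(\<lambda>n. L2_norm M (\<lambda>x. indicator (\<Union>i<n. A i \<inter> disc (int N)) x
          - indicator (\<Union> (range A) \<inter> disc (int N)) x)) \<longlonglongrightarrow> 0"
      proof (rule L2_dominated_convergence[where w = "indicator (disc (int N))"])
        show "integrable M (indicator (disc (int N)) :: 'a \<Rightarrow> real)"
          using emeasure_disc_finite[of "int N"] by (intro integrable_real_indicator) auto
        have "(\<lambda>n. indicator (\<Union>i<n. A i \<inter> disc (int N)) x :: complex)
            \<longlonglongrightarrow> indicator (\<Union>i. A i \<inter> disc (int N)) x" for x
          by (rule LIMSEQ_indicator_UN)
        then show "AE x in M. (\<lambda>n. indicator (\<Union>i<n. A i \<inter> disc (int N)) x :: complex)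
            \<longlonglongrightarrow> indicator (\<Union> (range A) \<inter> disc (int N)) x"
          by simp
      qed (auto simp: indicator_def)
    qed
  qed
qed

lemma step_approx_indicator:
  assumes A: "A \<in> sets borel" "emeasure M A < \<infinity>" shows "step_approx (indicator A)"
proof (rule step_approx_limit[OF step_approx_indicator_bounded[OF A(1)] L2_indicator[OF A]])
  note [measurable] = A(1)
  show "(\<lambda>N. L2_norm M (\<lambda>x. indicator (A \<inter> disc (int N)) x - indicator A x)) \<longlonglongrightarrow> 0"
  proof (rule L2_dominated_convergence[where w = "indicator A"])
    show "integrable M (indicator A :: 'a \<Rightarrow> real)"
      using A by (intro integrable_real_indicator) auto
    have "(\<lambda>N. indicator (A \<inter> disc (int N)) x :: complex) \<longlonglongrightarrow> indicator A x" for x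
    proof -
      obtain n where "x \<in> disc (int n)" using disc_exhaust by blast
      then have "x \<in> disc (int N)" if "N \<ge> n" for N using disc_mono[of "int n" "int N"] that by auto
      then have "\<forall>\<^sub>F N in sequentially. indicator (A \<inter> disc (int N)) x = (indicator A x :: complex)"
        by (auto simp: eventually_sequentially indicator_def intro!: exI[of _ n])
      then show ?thesis by (rule tendsto_eventually)
    qed
    then show "AE x in M. (\<lambda>N. indicator (A \<inter> disc (int N)) x :: complex) \<longlonglongrightarrow> indicator A x" by simp
  qed (auto simp: indicator_def)
qed

text \<open>A square-integrable function is a dominated limit of simple functions, whose level sets for
  nonzero values have finite measure.\<close>

theorem step_approx_L2_iff: "step_approx f \<longleftrightarrow> f \<in> L2 M"
proof
  assume f: "f \<in> L2 M"
  have fm [measurable]: "f \<in> borel_measurable M" using f by (simp add: L2_def)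
  obtain s where s: "\<And>i. simple_function M (s i)" "\<And>x. (\<lambda>i. s i x) \<longlonglongrightarrow> f x"
      "\<And>i x. cmod (s i x) \<le> 2 * cmod (f x)"
    using borel_measurable_implies_sequence_metric[OF fm, of 0] by auto
  have sm [measurable]: "s i \<in> borel_measurable M" for i using s(1) borel_measurable_simple_function by blast
  have dom: "s i \<in> L2 M" for i
  proof (rule L2_dominated)
    show "integrable M (\<lambda>x. 4 * (cmod (f x))\<^sup>2)" using f by (simp add: L2_def)
    show "AE x in M. (cmod (s i x))\<^sup>2 \<le> 4 * (cmod (f x))\<^sup>2"
      using power_mono[OF s(3), of i _ 2] by (simp add: power_mult_distrib)
  qed simp
  have sapp: "step_approx (s i)" for i
  proof -
    have fin: "finite (s i ` UNIV)" using s(1)[of i] by (simp add: simple_function_def)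
    have app: "step_approx (\<lambda>x. y * indicator (s i -` {y}) x)" for y
    proof (cases "y = 0")
      case True
      then show ?thesis using step_approx_zero by simp
    next
      case False
      have meas: "s i -` {y} \<in> sets borel" using measurable_sets[OF sm, of "{y}" i] by simp
      have "integrable M (\<lambda>x. indicator (s i -` {y}) x :: real)"
      proof (rule Bochner_Integration.integrable_bound)
        show "integrable M (\<lambda>x. (cmod (s i x))\<^sup>2 / (cmod y)\<^sup>2)" using dom[of i] by (simp add: L2_def)
        show "AE x in M. norm (indicator (s i -` {y}) x :: real) \<le> norm ((cmod (s i x))\<^sup>2 / (cmod y)\<^sup>2)"
          using False by (auto simp: indicator_def)
      qed (use meas in auto)
      then have "emeasure M (s i -` {y}) < \<infinity>" by (simp add: integrable_indicator_iff)
      then show ?thesis by (intro step_approx_cmult step_approx_indicator meas)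
    qed
    have "step_approx (\<lambda>x. \<Sum>y\<in>s i ` UNIV. y * indicator (s i -` {y}) x)"
      using fin app by (rule step_approx_sum)
    also have "(\<lambda>x. \<Sum>y\<in>s i ` UNIV. y * indicator (s i -` {y}) x) = s i"
    proof
      fix x
      have "(\<Sum>y\<in>s i ` UNIV. y * indicator (s i -` {y}) x) = (\<Sum>y\<in>s i ` UNIV. if s i x = y then y else 0)"
        by (intro sum.cong) (auto simp: indicator_def)
      then show "(\<Sum>y\<in>s i ` UNIV. y * indicator (s i -` {y}) x) = s i x"
        using fin by (simp add: sum.delta)
    qed
    finally show ?thesis .
  qed
  show "step_approx f"
  proof (rule step_approx_limit[OF sapp f])
    show "(\<lambda>n. L2_norm M (\<lambda>x. s n x - f x)) \<longlonglongrightarrow> 0"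
    proof (rule L2_dominated_convergence[where w = "\<lambda>x. 9 * (cmod (f x))\<^sup>2"])
      show "integrable M (\<lambda>x. 9 * (cmod (f x))\<^sup>2)" using f by (simp add: L2_def)
      have "(cmod (s n x - f x))\<^sup>2 \<le> 9 * (cmod (f x))\<^sup>2" for n x
      proof -
        have "cmod (s n x - f x) \<le> 3 * cmod (f x)"
          using norm_triangle_ineq4[of "s n x" "f x"] s(3)[of n x] by simp
        from power_mono[OF this, of 2] show ?thesis by (simp add: power_mult_distrib)
      qed
      then show "AE x in M. (cmod (s n x - f x))\<^sup>2 \<le> 9 * (cmod (f x))\<^sup>2" for n by simp
    qed (use s in auto)
  qed
qed (rule step_approx_L2)

lemma step_fun_restrict:
  assumes "step_fun k R f" shows "step_fun (min k S) S (\<lambda>x. indicator (disc S) x * f x)"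
proof -
  have "indicator (disc S) (x + y) * f (x + y) = indicator (disc S) x * f x" if y: "y \<in> disc (min k S)" for x y
  proof -
    have "y \<in> disc k" "y \<in> disc S" using y disc_mono[of "min k S" k] disc_mono[of "min k S" S] by auto
    then show ?thesis using assms disc_add_iff[of y S x] by (simp add: step_fun_def indicator_def)
  qed
  then show ?thesis by (simp add: step_fun_def)
qed

lemma ex_step_fun_close:
  assumes f: "f \<in> L2 M" and supp: "AE x in M. x \<notin> disc S \<longrightarrow> f x = 0" and e: "e > 0"
  obtains k s where "step_fun k S s" "L2_norm M (\<lambda>x. f x - s x) < e"
proof -
  obtain k R t where t: "step_fun k R t" "L2_norm M (\<lambda>x. f x - t x) < e"
    using f e step_approx_L2_iff[of f] unfolding step_approx_def by meson
  let ?s = "\<lambda>x. indicator (disc S) x * t x"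
  have s: "step_fun (min k S) S ?s" using step_fun_restrict[OF t(1)] .
  have "L2_norm M (\<lambda>x. f x - ?s x) \<le> L2_norm M (\<lambda>x. f x - t x)"
  proof (rule L2_norm_mono)
    show "(\<lambda>x. f x - t x) \<in> L2 M" using f t step_fun_L2 by blast
    show "(\<lambda>x. f x - ?s x) \<in> borel_measurable M"
      using step_fun_L2[OF s] f by (intro L2_measurable) auto
    show "AE x in M. cmod (f x - ?s x) \<le> cmod (f x - t x)"
      using supp by eventually_elim (auto simp: indicator_def)
  qed
  then show ?thesis using that s t(2) by fastforce
qed

end

section \<open>The Fourier transform of locally constant functions\<close>

context local_field_setup
begin

abbreviation FT :: "('a \<Rightarrow> complex) \<Rightarrow> 'a \<Rightarrow> complex" where
  "FT \<equiv> fourier_integral M chi"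

lemma measurable_chi_mult_M: "(\<lambda>x. chi (a * x)) \<in> borel_measurable M"
  by simp

lemma measurable_cnj_chi_mult: "(\<lambda>x. cnj (chi (a * x))) \<in> borel_measurable M"
  by (intro borel_measurable_cnj measurable_chi_mult_M)

lemma measurable_FT_integrand:
  "h \<in> borel_measurable M \<Longrightarrow> (\<lambda>x. h x * cnj (chi (a * x))) \<in> borel_measurable M"
  by (intro borel_measurable_times measurable_cnj_chi_mult)

lemma integrable_mult_bounded:
  assumes h: "integrable M (h :: 'a \<Rightarrow> complex)" and b: "b \<in> borel_measurable M" "\<And>x. cmod (b x) \<le> C"
  shows "integrable M (\<lambda>x. h x * b x)"
proof (rule Bochner_Integration.integrable_bound)
  show "integrable M (\<lambda>x. C * cmod (h x))" using h by auto
  have "norm (h x * b x) \<le> norm (C * cmod (h x))" for x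
  proof -
    have "cmod (h x) * cmod (b x) \<le> cmod (h x) * C" by (intro mult_left_mono b) simp
    also have "\<dots> \<le> \<bar>C * cmod (h x)\<bar>" by (simp add: mult.commute)
    finally show ?thesis by (simp add: norm_mult)
  qed
  then show "AE x in M. norm (h x * b x) \<le> norm (C * cmod (h x))" by simp
qed (use assms in auto)

lemma integrable_FT_integrand: "integrable M h \<Longrightarrow> integrable M (\<lambda>x. h x * cnj (chi (a * x)))"
  by (rule integrable_mult_bounded[where C = 1]) (simp_all add: measurable_cnj_chi_mult)

lemma FT_bound: "integrable M h \<Longrightarrow> cmod (FT h \<xi>) \<le> (\<integral>x. cmod (h x) \<partial>M)"
  using integral_norm_bound[of M "\<lambda>x. h x * cnj (chi (\<xi> * x))"]
  by (simp add: fourier_integral_def norm_mult)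

text \<open>\<open>chi (\<eta> * x) = 1\<close> for \<open>\<eta>\<close> in \<open>disc (- R)\<close> and \<open>x\<close> in \<open>disc R\<close>.\<close>

lemma FT_periodic:
  assumes h: "h \<in> borel_measurable M" "AE x in M. x \<notin> disc R \<longrightarrow> h x = 0" and \<eta>: "\<eta> \<in> disc (- R)"
  shows "FT h (\<xi> + \<eta>) = FT h \<xi>"
  unfolding fourier_integral_def
proof (rule integral_cong_AE)
  show "AE x in M. h x * cnj (chi ((\<xi> + \<eta>) * x)) = h x * cnj (chi (\<xi> * x))"
    using h(2)
  proof eventually_elim
    case (elim x)
    show ?case
    proof (cases "x \<in> disc R")
      case True
      then have "chi (\<eta> * x) = 1" using disc_mult[OF \<eta> True] by (simp add: chi_disc)
      then show ?thesis by (simp add: distrib_right chi_add)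
    qed (use elim in auto)
  qed
qed (intro measurable_FT_integrand h)+

lemma FT_translate:
  assumes "h \<in> borel_measurable M" shows "FT (\<lambda>x. h (x + a)) \<xi> = chi (\<xi> * a) * FT h \<xi>"
proof -
  have "FT h \<xi> = (\<integral>x. h (x + a) * cnj (chi (\<xi> * (x + a))) \<partial>M)"
    unfolding fourier_integral_def by (rule integral_translate[symmetric]) (rule measurable_FT_integrand[OF assms])
  also have "\<dots> = cnj (chi (\<xi> * a)) * FT (\<lambda>x. h (x + a)) \<xi>"
    unfolding fourier_integral_def by (simp add: distrib_left chi_add mult_ac flip: integral_mult_right_zero)
  finally have "chi (\<xi> * a) * FT h \<xi> = (chi (\<xi> * a) * cnj (chi (\<xi> * a))) * FT (\<lambda>x. h (x + a)) \<xi>"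
    by (simp only: mult.assoc)
  then show ?thesis by (simp only: chi_cnj_mult mult_1)
qed

lemma FT_dilate:
  assumes "h \<in> borel_measurable M"
  shows "FT (\<lambda>x. h (\<pp> powi j * x)) \<xi> = of_real (real q powi j) * FT h (\<pp> powi (- j) * \<xi>)"
proof -
  have eq: "(\<pp> powi (- j) * \<xi>) * (\<pp> powi j * x) = \<xi> * x" for x
  proof -
    have "(\<pp> powi (- j) * \<xi>) * (\<pp> powi j * x) = (\<pp> powi (- j) * \<pp> powi j) * (\<xi> * x)"
      by (simp only: mult_ac)
    then show ?thesis by (simp only: pp_powi_inverse mult_1)
  qed
  have "(\<integral>x. h (\<pp> powi j * x) * cnj (chi ((\<pp> powi (- j) * \<xi>) * (\<pp> powi j * x))) \<partial>M)
      = (real q powi j) *\<^sub>R FT h (\<pp> powi (- j) * \<xi>)"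
    unfolding fourier_integral_def
    by (rule integral_dilate[of "\<lambda>x. h x * cnj (chi ((\<pp> powi (- j) * \<xi>) * x))"])
       (rule measurable_FT_integrand[OF assms])
  then show ?thesis unfolding eq by (simp add: fourier_integral_def scaleR_conv_of_real)
qed

text \<open>Dually to the periodicity, the transform vanishes at \<open>\<xi>\<close> as soon as the character \<open>\<xi>\<close> is
  nontrivial on a period of \<open>f\<close>, because a translation by that period multiplies it by a factor
  other than 1.\<close>

lemma FT_step: assumes f: "step_fun k R f" shows "step_fun (- R) (- k) (FT f)"
  unfolding step_fun_def
proof (intro conjI allI impI)
  show "FT f (\<xi> + \<eta>) = FT f \<xi>" if "\<eta> \<in> disc (- R)" for \<xi> \<eta>
    using f that by (intro FT_periodic step_fun_measurable) (auto simp: step_fun_def)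
  fix \<xi> assume "\<xi> \<notin> disc (- k)"
  then obtain y where y: "y \<in> disc k" "chi (\<xi> * y) \<noteq> 1" using chi_nontrivial_disc by blast
  have "(\<lambda>x. f (x + y)) = f" using f y by (auto simp: step_fun_def)
  then have "FT f \<xi> = chi (\<xi> * y) * FT f \<xi>" using FT_translate[OF step_fun_measurable[OF f], of y \<xi>] by simp
  then show "FT f \<xi> = 0" using y(2) by (metis mult_cancel_right1)
qed

lemma coset_indicator_eq: "indicator (coset a k) x = indicator (disc k) (x - a)"
  by (simp add: coset_def indicator_def)

lemma FT_indicator_coset:
  "FT (indicator (coset a k)) \<xi> = of_real (real q powi k) * (cnj (chi (\<xi> * a)) * indicator (disc (- k)) \<xi>)"
proof -
  have "FT (indicator (disc k)) \<xi> = cnj (\<integral>x. indicator (disc k) x * chi (\<xi> * x) \<partial>M)"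
    unfolding fourier_integral_def Bochner_Integration.integral_cnj[symmetric]
    by (intro Bochner_Integration.integral_cong) (auto simp: indicator_def)
  also have "\<dots> = of_real (real q powi k) * indicator (disc (- k)) \<xi>"
    by (simp add: disc_character_integral)
  finally have *: "FT (indicator (disc k)) \<xi> = of_real (real q powi k) * indicator (disc (- k)) \<xi>" .
  have "FT (\<lambda>x. indicator (disc k) (x + - a)) \<xi> = chi (\<xi> * - a) * FT (indicator (disc k)) \<xi>"
    by (rule FT_translate) simp
  moreover have "(\<lambda>x. indicator (disc k) (x + - a)) = (indicator (coset a k) :: 'a \<Rightarrow> complex)"
    by (simp add: coset_indicator_eq fun_eq_iff)
  ultimately show ?thesis using * by (simp add: chi_minus mult_ac)
qed

text \<open>Integrating a Fourier transform over a disc recovers an average of the function. The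
  transform of a compactly supported \<open>h\<close> is periodic, so the integral over the disc is a finite
  sum, which can be interchanged with the integral defining the transform; the sum over the
  characters is then a Dirichlet kernel.\<close>

lemma FT_disc_integral_supported:
  assumes h: "integrable M h" "\<And>x. x \<notin> disc R \<Longrightarrow> h x = 0" and a: "a \<in> disc R" and n: "- R \<le> n"
  shows "(\<integral>\<xi>. indicator (disc n) \<xi> * (chi (\<xi> * a) * FT h \<xi>) \<partial>M)
    = of_real (real q powi n) * (\<integral>x. indicator (coset a (- n)) x * h x \<partial>M)"
proof -
  have hm: "h \<in> borel_measurable M" using h by auto
  \<comment> \<open>\<open>disc n\<close> is the union of \<open>q ^ N\<close> cosets of the period disc \<open>disc (- R)\<close> of the integrand.\<close>
  define N where "N = nat (n + R)"
  have N: "n = - R + int N" using n by (simp add: N_def)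
  define g where "g = (\<lambda>\<xi>. indicator (disc n) \<xi> * (chi (\<xi> * a) * FT h \<xi>))"
  define b where "b = (\<lambda>i. \<pp> powi R * u i)"
  have per: "chi ((\<xi> + \<eta>) * a) * FT h (\<xi> + \<eta>) = chi (\<xi> * a) * FT h \<xi>" if "\<eta> \<in> disc (- R)" for \<xi> \<eta>
  proof -
    have "chi (\<eta> * a) = 1" using disc_mult[OF that a] by (simp add: chi_disc)
    moreover have "FT h (\<xi> + \<eta>) = FT h \<xi>" using that h hm by (intro FT_periodic[where R = R]) auto
    ultimately show ?thesis by (simp add: distrib_right chi_add)
  qed
  have step: "step_fun (- R) (- R + int N) g"
    unfolding step_fun_def
  proof (intro conjI allI impI)
    fix \<xi> \<eta> assume \<eta>: "\<eta> \<in> disc (- R)"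
    then have "\<eta> \<in> disc n" using disc_mono[OF n] by blast
    then show "g (\<xi> + \<eta>) = g \<xi>" using per[OF \<eta>] disc_add_iff[of \<eta> n \<xi>] by (simp add: g_def indicator_def)
  qed (use N in \<open>auto simp: g_def\<close>)
  have bdisc: "b i \<in> disc n" if "i < q ^ N" for i
    using u_in_disc[OF that] N by (simp add: b_def pp_powi_disc_iff)
  have ind: "(\<integral>\<xi>. indicator (coset (b i) (- R)) \<xi> \<partial>M) = complex_of_real (real q powi (- R))" for i
  proof -
    have "(\<integral>\<xi>. indicator (coset (b i) (- R)) \<xi> \<partial>M) = (\<integral>\<xi>. complex_of_real (indicator (coset (b i) (- R)) \<xi>) \<partial>M)"
      by (intro Bochner_Integration.integral_cong) (auto simp: indicator_def)
    then show ?thesis by (simp add: measure_coset)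
  qed
  have kernel: "(\<Sum>i<q ^ N. h x * chi (b i * (a - x))) = of_nat (q ^ N) * (indicator (coset a (- n)) x * h x)" for x
  proof (cases "x \<in> disc R")
    case True
    have y: "\<pp> powi R * (a - x) \<in> disc 0" using disc_diff[OF a True] by (simp add: pp_powi_disc_iff)
    have "(\<Sum>i<q ^ N. h x * chi (b i * (a - x))) = h x * (\<Sum>i<q ^ N. chi (u i * (\<pp> powi R * (a - x))))"
      unfolding sum_distrib_left b_def by (simp only: mult_ac)
    also have "\<pp> powi R * (a - x) \<in> disc (- int N) \<longleftrightarrow> x \<in> coset a (- n)"
      using N disc_uminus[of "x - a"] by (simp add: pp_powi_disc_iff coset_def)
    then have "(\<Sum>i<q ^ N. chi (u i * (\<pp> powi R * (a - x)))) = of_nat (q ^ N) * indicator (coset a (- n)) x"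
      using dirichlet_kernel[OF y, of N] by (simp add: indicator_def)
    finally show ?thesis by (simp only: mult_ac)
  qed (use h in auto)
  have "(\<integral>\<xi>. g \<xi> \<partial>M) = (\<integral>\<xi>. (\<Sum>i<q ^ N. g (b i) * indicator (coset (b i) (- R)) \<xi>) \<partial>M)"
    by (subst step_fun_expand[OF step]) (simp add: b_def)
  also have "\<dots> = (\<Sum>i<q ^ N. g (b i) * (\<integral>\<xi>. indicator (coset (b i) (- R)) \<xi> \<partial>M))"
    by (subst Bochner_Integration.integral_sum)
       (intro integrable_mult_right integrable_indicator_coset, simp only: integral_mult_right_zero)
  also have "\<dots> = (\<Sum>i<q ^ N. g (b i) * complex_of_real (real q powi (- R)))"
    by (simp only: ind)
  also have "\<dots> = of_real (real q powi (- R)) * (\<Sum>i<q ^ N. \<integral>x. h x * chi (b i * (a - x)) \<partial>M)"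
    unfolding sum_distrib_left
  proof (intro sum.cong refl)
    fix i assume "i \<in> {..<q ^ N}"
    then have "g (b i) = chi (b i * a) * FT h (b i)" using bdisc by (simp add: g_def)
    also have "\<dots> = (\<integral>x. h x * chi (b i * (a - x)) \<partial>M)"
      unfolding fourier_integral_def by (simp add: right_diff_distrib chi_diff mult_ac flip: integral_mult_right_zero)
    finally show "g (b i) * complex_of_real (real q powi (- R))
        = of_real (real q powi (- R)) * (\<integral>x. h x * chi (b i * (a - x)) \<partial>M)" by simp
  qed
  also have "(\<Sum>i<q ^ N. \<integral>x. h x * chi (b i * (a - x)) \<partial>M) = (\<integral>x. (\<Sum>i<q ^ N. h x * chi (b i * (a - x))) \<partial>M)"
  proof (rule Bochner_Integration.integral_sum[symmetric])
    fix i
    show "integrable M (\<lambda>x. h x * chi (b i * (a - x)))"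
      using measurable_comp_affine[of chi "- b i" "b i * a"]
      by (intro integrable_mult_bounded[where C = 1] h) (auto simp: algebra_simps)
  qed
  also have "(\<integral>x. (\<Sum>i<q ^ N. h x * chi (b i * (a - x))) \<partial>M)
      = (\<integral>x. of_nat (q ^ N) * (indicator (coset a (- n)) x * h x) \<partial>M)"
    by (simp only: kernel)
  also have "of_real (real q powi (- R)) * (\<integral>x. of_nat (q ^ N) * (indicator (coset a (- n)) x * h x) \<partial>M)
      = of_real (real q powi n) * (\<integral>x. indicator (coset a (- n)) x * h x \<partial>M)"
  proof -
    have "real q powi (- R) * real (q ^ N) = real q powi n" unfolding N by (subst power_int_add) auto
    then have "complex_of_real (real q powi (- R)) * of_nat (q ^ N) = of_real (real q powi n)"
      by (metis of_real_mult of_real_of_nat_eq)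
    moreover have "(\<integral>x. of_nat (q ^ N) * (indicator (coset a (- n)) x * h x) \<partial>M)
        = of_nat (q ^ N) * (\<integral>x. indicator (coset a (- n)) x * h x \<partial>M)"
      by (rule integral_mult_right_zero)
    ultimately show ?thesis by (metis mult.assoc)
  qed
  finally show ?thesis by (simp add: g_def)
qed

lemma truncate_integrable:
  assumes "integrable M (h :: 'a \<Rightarrow> complex)" shows "integrable M (\<lambda>x. indicator (disc R) x * h x)"
  using integrable_mult_bounded[OF assms, of "indicator (disc R)" 1]
  by (simp add: indicator_def mult.commute)

lemma truncate_tendsto: "(\<lambda>r. indicator (disc (int r)) x * (h x :: complex)) \<longlonglongrightarrow> h x"
proof -
  obtain n where "x \<in> disc (int n)" using disc_exhaust by blast
  then have "x \<in> disc (int N)" if "N \<ge> n" for N using disc_mono[of "int n" "int N"] that by auto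
  then have "\<forall>\<^sub>F N in sequentially. indicator (disc (int N)) x * h x = h x"
    by (auto simp: eventually_sequentially indicator_def intro!: exI[of _ n])
  then show ?thesis by (rule tendsto_eventually)
qed

lemma FT_truncate_tendsto:
  assumes h: "integrable M h"
  shows "(\<lambda>r. FT (\<lambda>x. indicator (disc (int r)) x * h x) \<xi>) \<longlonglongrightarrow> FT h \<xi>"
  unfolding fourier_integral_def
proof (rule integral_dominated_convergence[where w = "\<lambda>x. cmod (h x)"])
  show "AE x in M. (\<lambda>r. indicator (disc (int r)) x * h x * cnj (chi (\<xi> * x))) \<longlonglongrightarrow> h x * cnj (chi (\<xi> * x))"
    by (intro always_eventually allI tendsto_intros truncate_tendsto)
  show "AE x in M. norm (indicator (disc (int r)) x * h x * cnj (chi (\<xi> * x))) \<le> cmod (h x)" for r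
    by (auto simp: norm_mult indicator_def)
  show "(\<lambda>x. h x * cnj (chi (\<xi> * x))) \<in> borel_measurable M"
    using h by (intro measurable_FT_integrand) auto
  show "(\<lambda>x. indicator (disc (int r)) x * h x * cnj (chi (\<xi> * x))) \<in> borel_measurable M" for r
    using truncate_integrable[OF h] by (intro measurable_FT_integrand) auto
qed (use h in auto)

lemma FT_measurable_supported:
  assumes h: "h \<in> borel_measurable M" "AE x in M. x \<notin> disc R \<longrightarrow> h x = 0"
  shows "FT h \<in> borel_measurable M"
proof (rule borel_measurable_M_continuous)
  show "continuous_on UNIV (FT h)"
    unfolding continuous_on_iff
  proof safe
    fix \<xi> and e :: real assume "e > 0"
    have eq: "FT h \<eta> = FT h \<xi>" if "dist \<eta> \<xi> < real q powi (- R)" for \<eta>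
      using FT_periodic[OF h, of "\<eta> - \<xi>" \<xi>] that by (simp add: disc_def dist_absv)
    show "\<exists>d>0. \<forall>\<eta>\<in>UNIV. dist \<eta> \<xi> < d \<longrightarrow> dist (FT h \<eta>) (FT h \<xi>) < e"
    proof (intro exI conjI ballI impI)
      show "dist (FT h \<eta>) (FT h \<xi>) < e" if "dist \<eta> \<xi> < real q powi (- R)" for \<eta>
        using \<open>e > 0\<close> eq[OF that] by simp
    qed simp
  qed
qed

lemma FT_measurable: assumes h: "integrable M h" shows "FT h \<in> borel_measurable M"
proof (rule borel_measurable_LIMSEQ_metric)
  show "FT (\<lambda>x. indicator (disc (int r)) x * h x) \<in> borel_measurable M" for r
  proof (rule FT_measurable_supported)
    show "(\<lambda>x. indicator (disc (int r)) x * h x) \<in> borel_measurable M"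
      using truncate_integrable[OF h, of "int r"] by (rule borel_measurable_integrable)
    show "AE x in M. x \<notin> disc (int r) \<longrightarrow> indicator (disc (int r)) x * h x = 0" by simp
  qed
  show "(\<lambda>r. FT (\<lambda>x. indicator (disc (int r)) x * h x) \<xi>) \<longlonglongrightarrow> FT h \<xi>" for \<xi>
    by (rule FT_truncate_tendsto[OF h])
qed

text \<open>Truncating \<open>h\<close> to larger and larger discs, both sides converge by dominated convergence.\<close>

lemma FT_disc_integral:
  assumes h: "integrable M h"
  shows "(\<integral>\<xi>. indicator (disc n) \<xi> * (chi (\<xi> * a) * FT h \<xi>) \<partial>M)
    = of_real (real q powi n) * (\<integral>x. indicator (coset a (- n)) x * h x \<partial>M)"
proof (rule LIMSEQ_unique)
  define hr where "hr = (\<lambda>(r::nat) x. indicator (disc (int r)) x * h x)"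
  have hr: "integrable M (hr r)" for r unfolding hr_def by (rule truncate_integrable[OF h])
  have hrb: "cmod (hr r x) \<le> cmod (h x)" for r x by (auto simp: hr_def norm_mult indicator_def)
  have mc: "(\<lambda>\<xi>. chi (\<xi> * a)) \<in> borel_measurable M"
    by (subst mult.commute) (rule measurable_chi_mult_M)
  let ?C = "\<integral>x. cmod (h x) \<partial>M"
  show "(\<lambda>r. \<integral>\<xi>. indicator (disc n) \<xi> * (chi (\<xi> * a) * FT (hr r) \<xi>) \<partial>M)
      \<longlonglongrightarrow> (\<integral>\<xi>. indicator (disc n) \<xi> * (chi (\<xi> * a) * FT h \<xi>) \<partial>M)"
  proof (rule integral_dominated_convergence[where w = "\<lambda>\<xi>. indicator (disc n) \<xi> * ?C"])
    show "integrable M (\<lambda>\<xi>. indicator (disc n) \<xi> * ?C)"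
      using emeasure_disc_finite[of n] by (intro integrable_mult_left integrable_real_indicator) auto
    show "(\<lambda>\<xi>. indicator (disc n) \<xi> * (chi (\<xi> * a) * FT h \<xi>)) \<in> borel_measurable M"
      using FT_measurable[OF h] mc by (intro borel_measurable_times) auto
    show "(\<lambda>\<xi>. indicator (disc n) \<xi> * (chi (\<xi> * a) * FT (hr r) \<xi>)) \<in> borel_measurable M" for r
      using FT_measurable[OF hr] mc by (intro borel_measurable_times) auto
    show "AE \<xi> in M. (\<lambda>r. indicator (disc n) \<xi> * (chi (\<xi> * a) * FT (hr r) \<xi>))
        \<longlonglongrightarrow> indicator (disc n) \<xi> * (chi (\<xi> * a) * FT h \<xi>)"
      unfolding hr_def by (intro always_eventually allI tendsto_intros FT_truncate_tendsto[OF h])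
    have "cmod (FT (hr r) \<xi>) \<le> ?C" for r \<xi>
      using FT_bound[OF hr] integral_mono[OF integrable_norm[OF hr] integrable_norm[OF h], of r] hrb
      by (meson order_trans)
    then show "AE \<xi> in M. norm (indicator (disc n) \<xi> * (chi (\<xi> * a) * FT (hr r) \<xi>)) \<le> indicator (disc n) \<xi> * ?C" for r
      by (auto simp: norm_mult indicator_def)
  qed
  have rhs: "(\<lambda>r. of_real (real q powi n) * (\<integral>x. indicator (coset a (- n)) x * hr r x \<partial>M))
      \<longlonglongrightarrow> of_real (real q powi n) * (\<integral>x. indicator (coset a (- n)) x * h x \<partial>M)"
  proof (intro tendsto_mult_left integral_dominated_convergence[where w = "\<lambda>x. cmod (h x)"])
    show "AE x in M. (\<lambda>r. indicator (coset a (- n)) x * hr r x) \<longlonglongrightarrow> indicator (coset a (- n)) x * h x"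
      unfolding hr_def by (intro always_eventually allI tendsto_intros truncate_tendsto)
    show "AE x in M. norm (indicator (coset a (- n)) x * hr r x) \<le> cmod (h x)" for r
      using hrb[of r] by (auto simp: norm_mult indicator_def)
    show "(\<lambda>x. indicator (coset a (- n)) x * h x) \<in> borel_measurable M"
      using h by (intro borel_measurable_times) auto
    show "(\<lambda>x. indicator (coset a (- n)) x * hr r x) \<in> borel_measurable M" for r
      using hr[of r] by (intro borel_measurable_times) auto
  qed (use h in auto)
  obtain r0 where r0: "a \<in> disc (int r0)" using disc_exhaust by blast
  have "\<forall>\<^sub>F r in sequentially. of_real (real q powi n) * (\<integral>x. indicator (coset a (- n)) x * hr r x \<partial>M)
      = (\<integral>\<xi>. indicator (disc n) \<xi> * (chi (\<xi> * a) * FT (hr r) \<xi>) \<partial>M)"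
    unfolding eventually_sequentially
  proof (intro exI allI impI)
    fix r assume "max r0 (nat (- n)) \<le> r"
    then show "of_real (real q powi n) * (\<integral>x. indicator (coset a (- n)) x * hr r x \<partial>M)
      = (\<integral>\<xi>. indicator (disc n) \<xi> * (chi (\<xi> * a) * FT (hr r) \<xi>) \<partial>M)"
      using r0 disc_mono[of "int r0" "int r"] hr[of r]
      by (intro FT_disc_integral_supported[symmetric, where R = "int r"]) (auto simp: hr_def)
  qed
  with rhs show "(\<lambda>r. \<integral>\<xi>. indicator (disc n) \<xi> * (chi (\<xi> * a) * FT (hr r) \<xi>) \<partial>M)
      \<longlonglongrightarrow> of_real (real q powi n) * (\<integral>x. indicator (coset a (- n)) x * h x \<partial>M)"
    by (rule Lim_transform_eventually)
qed

lemma plancherel_indicator: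
  assumes h: "integrable M h"
  shows "L2_inner M (FT (indicator (coset a k))) (FT h) = L2_inner M (indicator (coset a k)) h"
proof -
  have "L2_inner M (FT (indicator (coset a k))) (FT h)
      = (\<integral>\<xi>. of_real (real q powi k) * cnj (indicator (disc (- k)) \<xi> * (chi (\<xi> * a) * FT h \<xi>)) \<partial>M)"
    unfolding L2_inner_def FT_indicator_coset
    by (intro Bochner_Integration.integral_cong) (auto simp: indicator_def)
  also have "\<dots> = of_real (real q powi k) * cnj (\<integral>\<xi>. indicator (disc (- k)) \<xi> * (chi (\<xi> * a) * FT h \<xi>) \<partial>M)"
    by (simp only: integral_mult_right_zero Bochner_Integration.integral_cnj)
  also have "\<dots> = of_real (real q powi k * real q powi (- k)) * cnj (\<integral>x. indicator (coset a k) x * h x \<partial>M)"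
    unfolding FT_disc_integral[OF h] by simp
  also have "real q powi k * real q powi (- k) = 1" by (subst power_int_add[symmetric]) auto
  also have "of_real 1 * cnj (\<integral>x. indicator (coset a k) x * h x \<partial>M) = L2_inner M (indicator (coset a k)) h"
    unfolding L2_inner_def Bochner_Integration.integral_cnj[symmetric]
    by (simp, intro Bochner_Integration.integral_cong) (auto simp: indicator_def)
  finally show ?thesis .
qed

lemma integrable_step_mult:
  assumes f: "step_fun k R f" and h: "integrable M h" shows "integrable M (\<lambda>x. f x * cnj (h x))"
proof -
  obtain C where "\<forall>x. cmod (f x) \<le> C" using step_fun_bounded[OF f] ..
  then have "integrable M (\<lambda>x. cnj (h x) * f x)"
    by (intro integrable_mult_bounded[where C = C] integrable_cnj h step_fun_measurable[OF f]) simp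
  then show ?thesis by (simp only: mult.commute)
qed

lemma integrable_step_mult_bounded:
  assumes f: "step_fun k R f" and h: "h \<in> borel_measurable M" "\<And>x. cmod (h x) \<le> C"
  shows "integrable M (\<lambda>x. f x * cnj (h x))"
  by (intro integrable_mult_bounded[where C = C] step_fun_integrable[OF f] borel_measurable_cnj h) (simp add: h)

lemma FT_sum_cmult:
  assumes "finite A" "\<And>i. i \<in> A \<Longrightarrow> integrable M (f i)"
  shows "FT (\<lambda>x. \<Sum>i\<in>A. a i * f i x) \<xi> = (\<Sum>i\<in>A. a i * FT (f i) \<xi>)"
proof -
  have "FT (\<lambda>x. \<Sum>i\<in>A. a i * f i x) \<xi> = (\<integral>x. (\<Sum>i\<in>A. a i * (f i x * cnj (chi (\<xi> * x)))) \<partial>M)"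
    unfolding fourier_integral_def by (simp only: sum_distrib_right mult.assoc)
  also have "\<dots> = (\<Sum>i\<in>A. a i * FT (f i) \<xi>)"
    unfolding fourier_integral_def
    using integrable_FT_integrand[OF assms(2)] by (subst Bochner_Integration.integral_sum) auto
  finally show ?thesis .
qed

text \<open>Both sides are linear in \<open>f\<close>, so \<open>f\<close> may be taken to be the indicator function of a coset.\<close>

lemma plancherel_step:
  assumes f: "step_fun k R f" and h: "integrable M h"
  shows "L2_inner M (FT f) (FT h) = L2_inner M f h"
proof -
  obtain n where n: "step_fun k (k + int n) f" using step_fun_normalize[OF f] .
  define b where "b = (\<lambda>i. \<pp> powi (- k) * u i)"
  define e where "e = (\<lambda>i. (indicator (coset (b i) k) :: 'a \<Rightarrow> complex))"
  have e: "step_fun k (max k (k + int n)) (e i)" if "i < q ^ n" for i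
  proof -
    have "b i \<in> disc (k + int n)" using u_in_disc[OF that] by (simp add: b_def pp_powi_disc_iff add.commute)
    then have "coset (b i) k \<subseteq> disc (k + int n)" 
      using disc_add[of _ "k + int n" "b i"] disc_mono[of k "k + int n"] by (fastforce simp: coset_def)
    then have "coset (b i) k \<inter> disc (k + int n) = coset (b i) k" by blast
    then show ?thesis using step_fun_coset[of k "k + int n" "b i"] by (simp add: e_def)
  qed
  have feq: "f = (\<lambda>x. \<Sum>i<q ^ n. f (b i) * e i x)"
    unfolding b_def e_def by (rule ext) (rule step_fun_expand[OF n])
  have "FT (\<lambda>x. \<Sum>i<q ^ n. f (b i) * e i x) \<xi> = (\<Sum>i<q ^ n. f (b i) * FT (e i) \<xi>)" for \<xi>
    by (intro FT_sum_cmult) (auto simp: e_def integrable_indicator_coset)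
  then have FTeq: "FT f \<xi> = (\<Sum>i<q ^ n. f (b i) * FT (e i) \<xi>)" for \<xi>
    using feq by metis
  have "L2_inner M (FT f) (FT h) = (\<integral>\<xi>. (\<Sum>i<q ^ n. f (b i) * (FT (e i) \<xi> * cnj (FT h \<xi>))) \<partial>M)"
    unfolding L2_inner_def FTeq by (simp only: sum_distrib_right mult.assoc)
  also have "\<dots> = (\<Sum>i<q ^ n. f (b i) * L2_inner M (FT (e i)) (FT h))"
    unfolding L2_inner_def
    using integrable_step_mult_bounded[OF FT_step[OF e] FT_measurable[OF h] FT_bound[OF h]]
    by (subst Bochner_Integration.integral_sum) auto
  also have "\<dots> = (\<Sum>i<q ^ n. f (b i) * L2_inner M (e i) h)"
    unfolding e_def plancherel_indicator[OF h] ..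
  also have "\<dots> = (\<integral>x. (\<Sum>i<q ^ n. f (b i) * (e i x * cnj (h x))) \<partial>M)"
    unfolding L2_inner_def using integrable_step_mult[OF e h]
    by (subst Bochner_Integration.integral_sum) auto
  also have "\<dots> = (\<integral>x. (\<Sum>i<q ^ n. f (b i) * e i x) * cnj (h x) \<partial>M)"
    by (simp only: sum_distrib_right mult.assoc)
  also have "\<dots> = L2_inner M f h" unfolding L2_inner_def using feq by metis
  finally show ?thesis .
qed

lemma FT_step_L2_norm: assumes "step_fun k R f" shows "L2_norm M (FT f) = L2_norm M f"
proof -
  have "complex_of_real ((L2_norm M (FT f))\<^sup>2) = of_real ((L2_norm M f)\<^sup>2)"
    unfolding L2_inner_self[symmetric] by (rule plancherel_step[OF assms step_fun_integrable[OF assms]])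
  then have "(L2_norm M (FT f))\<^sup>2 = (L2_norm M f)\<^sup>2" by (simp only: of_real_eq_iff)
  then show ?thesis by simp
qed

lemma plancherel:
  assumes f: "step_fun k R f" and g: "has_fourier_transform M chi \<psi> g"
  shows "L2_inner M (FT f) g = L2_inner M f \<psi>"
proof -
  obtain h where h: "\<And>n. h n \<in> L2 M" "\<And>n. integrable M (h n)" "\<And>n. FT (h n) \<in> L2 M"
      "(\<lambda>n. L2_norm M (\<lambda>x. h n x - \<psi> x)) \<longlonglongrightarrow> 0" "(\<lambda>n. L2_norm M (\<lambda>\<xi>. FT (h n) \<xi> - g \<xi>)) \<longlonglongrightarrow> 0"
    and L2: "\<psi> \<in> L2 M" "g \<in> L2 M"
    using g unfolding has_fourier_transform_def by blast
  have A: "(\<lambda>n. L2_inner M f (h n)) \<longlonglongrightarrow> L2_inner M f \<psi>"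
    by (rule L2_tendsto_inner_right[OF h(1) L2(1) step_fun_L2[OF f] h(4)])
  have B: "(\<lambda>n. L2_inner M (FT f) (FT (h n))) \<longlonglongrightarrow> L2_inner M (FT f) g"
    by (rule L2_tendsto_inner_right[OF h(3) L2(2) step_fun_L2[OF FT_step[OF f]] h(5)])
  show ?thesis
    by (rule LIMSEQ_unique[OF B[unfolded plancherel_step[OF f h(2)]] A])
qed

end

section \<open>Fourier coefficients along the coset representatives\<close>

lemma L2_Bessel:
  assumes G: "G \<in> L2 M" and fin: "finite A" and e: "\<And>i. i \<in> A \<Longrightarrow> e i \<in> L2 M"
    and orth: "\<And>i j. i \<in> A \<Longrightarrow> j \<in> A \<Longrightarrow> L2_inner M (e i) (e j) = (if i = j then of_real K else 0)"
    and K: "K \<ge> 0"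
  shows "(\<Sum>i\<in>A. (cmod (L2_inner M G (e i)))\<^sup>2) \<le> K * (L2_norm M G)\<^sup>2"
proof -
  define a where "a = (\<lambda>i. L2_inner M G (e i))"
  define S where "S = (\<lambda>x. \<Sum>i\<in>A. a i * e i x)"
  define B where "B = (\<Sum>i\<in>A. (cmod (a i))\<^sup>2)"
  have S: "S \<in> L2 M" unfolding S_def by (intro L2_sum L2_cmult e)
  have sq: "cnj z * z = of_real ((cmod z)\<^sup>2)" for z
    unfolding complex_norm_square by (rule mult.commute)
  \<comment> \<open>With \<open>S\<close> the sum of \<open>L2_inner M G (e i) * e i\<close>, both \<open>L2_inner M G S\<close> and \<open>L2_inner M S S / K\<close>
    equal \<open>B\<close>; the Cauchy-Schwarz inequality for \<open>G\<close> and \<open>S\<close> is then the claim.\<close>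
  have GS: "L2_inner M G S = of_real B"
  proof -
    have "L2_inner M G S = (\<Sum>i\<in>A. L2_inner M G (\<lambda>x. a i * e i x))"
      unfolding S_def by (intro L2_inner_sum_right L2_cmult e G)
    also have "\<dots> = (\<Sum>i\<in>A. cnj (a i) * a i)" by (simp add: L2_inner_cmult_right a_def)
    finally show ?thesis by (simp only: sq B_def of_real_sum)
  qed
  have "L2_inner M S S = (\<Sum>i\<in>A. a i * L2_inner M (e i) S)"
  proof -
    have "L2_inner M S S = (\<Sum>i\<in>A. L2_inner M (\<lambda>x. a i * e i x) S)"
      by (subst (1) S_def) (intro L2_inner_sum_left L2_cmult e S)
    then show ?thesis by (simp only: L2_inner_cmult_left)
  qed
  also have "\<dots> = (\<Sum>i\<in>A. a i * (cnj (a i) * of_real K))"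
  proof (intro sum.cong refl arg_cong2[where f = "(*)"])
    fix i assume i: "i \<in> A"
    have "L2_inner M (e i) S = (\<Sum>j\<in>A. cnj (a j) * L2_inner M (e i) (e j))"
      unfolding S_def using e i by (subst L2_inner_sum_right) (auto simp: L2_inner_cmult_right)
    also have "\<dots> = (\<Sum>j\<in>A. if j = i then cnj (a i) * of_real K else 0)"
      using orth i by (intro sum.cong) auto
    finally show "L2_inner M (e i) S = cnj (a i) * of_real K" using i fin by simp
  qed
  also have "\<dots> = of_real (K * B)"
    unfolding B_def by (simp add: complex_norm_square sum_distrib_left mult_ac del: of_real_power)
  finally have SS: "(L2_norm M S)\<^sup>2 = K * B" unfolding L2_inner_self of_real_eq_iff .
  have B0: "B \<ge> 0" by (simp add: B_def sum_nonneg)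
  have "B \<le> L2_norm M G * L2_norm M S" using L2_Cauchy_Schwarz[OF G S] GS B0 by simp
  then have "B\<^sup>2 \<le> (L2_norm M G * L2_norm M S)\<^sup>2" using B0 by (rule power_mono)
  then have "B * B \<le> (K * (L2_norm M G)\<^sup>2) * B" unfolding power_mult_distrib SS by (simp add: power2_eq_square mult_ac)
  then show ?thesis
  proof (cases "B = 0")
    case True
    have "0 \<le> K * (L2_norm M G)\<^sup>2" using K by simp
    then show ?thesis using True by (simp add: B_def a_def)
  next
    case False
    then have "B > 0" using B0 by simp
    then show ?thesis using \<open>B * B \<le> (K * (L2_norm M G)\<^sup>2) * B\<close> by (simp add: B_def a_def)
  qed
qed

context local_field_setup
begin

definition coef :: "nat \<Rightarrow> ('a \<Rightarrow> complex) \<Rightarrow> complex" where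
  "coef i G = (\<integral>x. G x * chi (u i * x) \<partial>M)"

definition supported_in :: "int \<Rightarrow> ('a \<Rightarrow> complex) \<Rightarrow> bool" where
  "supported_in R G \<longleftrightarrow> (AE x in M. x \<notin> disc R \<longrightarrow> G x = 0)"

text \<open>Cutting off the characters makes them square-integrable, so that the coefficients of functions
  supported in \<open>disc R\<close> become inner products.\<close>

definition coef_fun :: "int \<Rightarrow> nat \<Rightarrow> 'a \<Rightarrow> complex" where
  "coef_fun R i x = cnj (chi (u i * x)) * indicator (disc R) x"

lemma coef_fun_L2: "coef_fun R i \<in> L2 M"
proof -
  have "(\<lambda>x. cnj (chi (u i * x)) * indicator (coset 0 R) x) \<in> L2 M"
    by (rule L2_mult_bounded[OF L2_indicator_coset, where C = 1]) (simp_all add: measurable_cnj_chi_mult)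
  then show ?thesis by (simp add: coef_fun_def[abs_def])
qed

lemma coef_eq_inner:
  assumes G: "G \<in> borel_measurable M" "supported_in R G"
  shows "coef i G = L2_inner M G (coef_fun R i)"
  unfolding coef_def L2_inner_def
proof (rule integral_cong_AE)
  show "(\<lambda>x. G x * chi (u i * x)) \<in> borel_measurable M"
    by (intro borel_measurable_times G measurable_chi_mult_M)
  show "(\<lambda>x. G x * cnj (coef_fun R i x)) \<in> borel_measurable M"
    by (intro borel_measurable_times borel_measurable_cnj G L2_measurable coef_fun_L2)
  show "AE x in M. G x * chi (u i * x) = G x * cnj (coef_fun R i x)"
    using G(2) unfolding supported_in_def by eventually_elim (auto simp: coef_fun_def indicator_def)
qed

lemma coef_fun_orthogonal:
  assumes "R \<ge> 0"
  shows "L2_inner M (coef_fun R i) (coef_fun R j) = (if i = j then of_real (real q powi R) else 0)"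
proof -
  have eq: "L2_inner M (coef_fun R i) (coef_fun R j) = (\<integral>x. indicator (disc R) x * chi ((u j - u i) * x) \<partial>M)"
    unfolding L2_inner_def coef_fun_def
    by (intro Bochner_Integration.integral_cong) (auto simp: indicator_def left_diff_distrib right_diff_distrib chi_diff mult_ac)
  have "u j - u i \<in> disc (- R) \<longleftrightarrow> i = j"
  proof
    assume "u j - u i \<in> disc (- R)"
    then have "u j - u i \<in> disc 0" using disc_mono[of "- R" 0] assms by auto
    then show "i = j" by (simp add: u_eq_iff)
  qed simp
  then have "(\<integral>x. indicator (disc R) x * chi ((u j - u i) * x) \<partial>M) = (if i = j then of_real (real q powi R) else 0)"
    unfolding disc_character_integral by simp
  with eq show ?thesis by simp
qed

lemma coef_Bessel:
  assumes G: "G \<in> L2 M" "supported_in R G" and "R \<ge> 0" "finite A"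
  shows "(\<Sum>i\<in>A. (cmod (coef i G))\<^sup>2) \<le> real q powi R * (L2_norm M G)\<^sup>2"
  unfolding coef_eq_inner[OF L2_measurable[OF G(1)] G(2)]
  using assms coef_fun_orthogonal coef_fun_L2 by (intro L2_Bessel) auto

definition partial_form :: "nat \<Rightarrow> ('a \<Rightarrow> complex) \<Rightarrow> ('a \<Rightarrow> complex) \<Rightarrow> complex" where
  "partial_form n G H = (\<Sum>i<q ^ n. coef i G * cnj (coef i H))"

text \<open>On functions supported in \<open>disc R\<close> this is the inner product over \<open>disc 0\<close> of the two
  periodizations with respect to the group of representatives; only the \<open>q ^ R\<close> representatives
  in \<open>disc R\<close> can contribute. Written as an autocorrelation, it exhibits the products
  of two mask values that the relations between the masks control.\<close>

definition period_form :: "nat \<Rightarrow> ('a \<Rightarrow> complex) \<Rightarrow> ('a \<Rightarrow> complex) \<Rightarrow> complex" where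
  "period_form R G H = (\<Sum>i<q ^ R. \<integral>x. G (x + u i) * cnj (H x) \<partial>M)"

lemma partial_form_bound:
  assumes G: "G \<in> L2 M" "supported_in (int R) G" and H: "H \<in> L2 M" "supported_in (int R) H"
  shows "cmod (partial_form n G H) \<le> real (q ^ R) * (L2_norm M G * L2_norm M H)"
proof -
  have "cmod (partial_form n G H) \<le> (\<Sum>i<q ^ n. cmod (coef i G) * cmod (coef i H))"
    unfolding partial_form_def by (rule order_trans[OF norm_sum]) (simp add: norm_mult)
  also have "\<dots> \<le> L2_set (\<lambda>i. cmod (coef i G)) {..<q ^ n} * L2_set (\<lambda>i. cmod (coef i H)) {..<q ^ n}"
    using L2_set_mult_ineq[of "\<lambda>i. cmod (coef i G)" "\<lambda>i. cmod (coef i H)"] by simp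
  also have "\<dots> \<le> (sqrt (real (q ^ R)) * L2_norm M G) * (sqrt (real (q ^ R)) * L2_norm M H)"
  proof (intro mult_mono)
    show "L2_set (\<lambda>i. cmod (coef i G)) {..<q ^ n} \<le> sqrt (real (q ^ R)) * L2_norm M G"
      using coef_Bessel[OF G, of "{..<q ^ n}"] unfolding L2_set_def
      by (intro real_le_lsqrt) (auto simp: power_mult_distrib)
    show "L2_set (\<lambda>i. cmod (coef i H)) {..<q ^ n} \<le> sqrt (real (q ^ R)) * L2_norm M H"
      using coef_Bessel[OF H, of "{..<q ^ n}"] unfolding L2_set_def
      by (intro real_le_lsqrt) (auto simp: power_mult_distrib)
  qed (auto simp: L2_set_nonneg)
  also have "\<dots> = real (q ^ R) * (L2_norm M G * L2_norm M H)"
    using real_sqrt_mult_self[of "real (q ^ R)"] by (simp add: mult_ac)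
  finally show ?thesis .
qed

lemma period_form_bound:
  assumes G: "G \<in> L2 M" and H: "H \<in> L2 M"
  shows "cmod (period_form R G H) \<le> real (q ^ R) * (L2_norm M G * L2_norm M H)"
proof -
  have "cmod (\<integral>x. G (x + u i) * cnj (H x) \<partial>M) \<le> L2_norm M G * L2_norm M H" for i
    using L2_Cauchy_Schwarz[OF L2_translate[OF G] H, of "u i"] by (simp add: L2_inner_def L2_norm_translate[OF G])
  then have "cmod (period_form R G H) \<le> (\<Sum>i<q ^ R. L2_norm M G * L2_norm M H)"
    unfolding period_form_def by (intro order_trans[OF norm_sum] sum_mono) auto
  then show ?thesis by simp
qed

text \<open>Off \<open>disc 0\<close> the Dirichlet kernel repeats periodically with respect to the representatives.\<close>

lemma coset_kernel:
  assumes y: "y \<in> disc (int R)"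
  shows "(\<Sum>i<q ^ n. chi (u i * y)) = of_nat (q ^ n) * (\<Sum>j<q ^ R. indicator (coset (u j) (- int n)) y)"
proof -
  obtain j where j: "j < q ^ R" "y - u j \<in> disc 0" using ex_coset_rep[OF y] by blast
  have "chi (u i * y) = chi (u i * (y - u j))" for i by (simp add: right_diff_distrib chi_diff)
  then have "(\<Sum>i<q ^ n. chi (u i * y)) = of_nat (q ^ n) * indicator (coset (u j) (- int n)) y"
    using dirichlet_kernel[OF j(2), of n] by (simp add: indicator_def coset_def)
  also have "indicator (coset (u j) (- int n)) y = (\<Sum>j'<q ^ R. if j' = j then indicator (coset (u j) (- int n)) y else 0 :: complex)"
    using j by simp
  also have "\<dots> = (\<Sum>j'<q ^ R. indicator (coset (u j') (- int n)) y)"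
  proof (intro sum.cong refl)
    fix j'
    have "y \<notin> coset (u j') (- int n)" if "j' \<noteq> j"
    proof
      assume "y \<in> coset (u j') (- int n)"
      then have "y - u j' \<in> disc 0" using disc_mono[of "- int n" 0] by (auto simp: coset_def)
      then have "(y - u j) - (y - u j') \<in> disc 0" by (rule disc_diff[OF j(2)])
      then show False using u_eq_iff[of j' j] that by simp
    qed
    then show "(if j' = j then indicator (coset (u j) (- int n)) y else 0)
        = (indicator (coset (u j') (- int n)) y :: complex)"
      by (auto simp: indicator_def)
  qed
  finally show ?thesis .
qed

lemma coef_indicator_coset:
  assumes "i < q ^ n"
  shows "coef i (indicator (coset b (- int n))) = of_real (real q powi (- int n)) * chi (u i * b)"
proof -
  have "coef i (indicator (coset b (- int n))) = cnj (FT (indicator (coset b (- int n))) (u i))"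
    unfolding coef_def fourier_integral_def Bochner_Integration.integral_cnj[symmetric]
    by (intro Bochner_Integration.integral_cong) (auto simp: indicator_def)
  then show ?thesis using u_in_disc[OF assms] by (simp add: FT_indicator_coset)
qed

text \<open>Summing over \<open>i\<close> under the integral produces the Dirichlet kernel, that is, the indicator
  function of the translates of the coset by representatives.\<close>

lemma forms_agree_coset:
  assumes G: "G \<in> L2 M" "supported_in (int R) G" and b: "b \<in> disc (int R)"
  shows "partial_form n G (indicator (coset b (- int n))) = period_form R G (indicator (coset b (- int n)))"
proof -
  let ?c = "complex_of_real (real q powi (- int n))"
  have Gm: "G \<in> borel_measurable M" by (rule L2_measurable[OF G(1)])
  have int: "integrable M (\<lambda>x. G x * chi (u i * x))" for i
  proof -
    have "integrable M (\<lambda>x. G x * cnj (coef_fun (int R) i x))"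
      by (rule L2_integrable_mult_cnj[OF G(1) coef_fun_L2])
    then show ?thesis
    proof (rule integrable_cong_AE_imp)
      show "AE x in M. G x * cnj (coef_fun (int R) i x) = G x * chi (u i * x)"
        using G(2) unfolding supported_in_def by eventually_elim (auto simp: coef_fun_def indicator_def)
      show "(\<lambda>x. G x * chi (u i * x)) \<in> borel_measurable M"
        by (intro borel_measurable_times Gm measurable_chi_mult_M)
    qed
  qed
  have "partial_form n G (indicator (coset b (- int n)))
      = (\<Sum>i<q ^ n. ?c * (\<integral>x. cnj (chi (u i * b)) * (G x * chi (u i * x)) \<partial>M))"
    unfolding partial_form_def
  proof (intro sum.cong refl)
    fix i assume "i \<in> {..<q ^ n}"
    then show "coef i G * cnj (coef i (indicator (coset b (- int n))))
        = ?c * (\<integral>x. cnj (chi (u i * b)) * (G x * chi (u i * x)) \<partial>M)"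
      by (simp add: coef_indicator_coset coef_def[of i G])
  qed
  also have "\<dots> = ?c * (\<integral>x. (\<Sum>i<q ^ n. cnj (chi (u i * b)) * (G x * chi (u i * x))) \<partial>M)"
    unfolding sum_distrib_left[symmetric]
    by (subst Bochner_Integration.integral_sum) (auto intro!: integrable_mult_right int)
  also have "(\<integral>x. (\<Sum>i<q ^ n. cnj (chi (u i * b)) * (G x * chi (u i * x))) \<partial>M)
      = (\<integral>x. of_nat (q ^ n) * (\<Sum>j<q ^ R. G x * cnj (indicator (coset b (- int n)) (x + - u j))) \<partial>M)"
  proof (rule integral_cong_AE)
    have ind: "(\<lambda>x. indicator (coset b (- int n)) (x + - u j)) \<in> borel_measurable M" for j
      by (rule measurable_comp_translate) simp
    show "(\<lambda>x. \<Sum>i<q ^ n. cnj (chi (u i * b)) * (G x * chi (u i * x))) \<in> borel_measurable M"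
      by (intro borel_measurable_sum borel_measurable_times Gm measurable_chi_mult_M) simp
    show "(\<lambda>x. of_nat (q ^ n) * (\<Sum>j<q ^ R. G x * cnj (indicator (coset b (- int n)) (x + - u j)))) \<in> borel_measurable M"
      by (intro borel_measurable_sum borel_measurable_times Gm borel_measurable_cnj ind) simp
    show "AE x in M. (\<Sum>i<q ^ n. cnj (chi (u i * b)) * (G x * chi (u i * x)))
        = of_nat (q ^ n) * (\<Sum>j<q ^ R. G x * cnj (indicator (coset b (- int n)) (x + - u j)))"
      using G(2) unfolding supported_in_def
    proof eventually_elim
      case (elim x)
      show ?case
      proof (cases "x \<in> disc (int R)")
        case True
        have ind_eq: "indicator (coset (u j) (- int n)) (x - b)
            = cnj (indicator (coset b (- int n)) (x + - u j))" for j
        proof -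
          have "x - b - u j = x + - u j - b" by simp
          then show ?thesis unfolding coset_indicator_eq by (simp only: indicator_def) simp
        qed
        have "(\<Sum>i<q ^ n. cnj (chi (u i * b)) * (G x * chi (u i * x))) = G x * (\<Sum>i<q ^ n. chi (u i * (x - b)))"
          unfolding sum_distrib_left by (intro sum.cong) (simp_all add: right_diff_distrib chi_diff)
        also have "(\<Sum>i<q ^ n. chi (u i * (x - b))) = of_nat (q ^ n) * (\<Sum>j<q ^ R. cnj (indicator (coset b (- int n)) (x + - u j)))"
          unfolding coset_kernel[OF disc_diff[OF True b]] ind_eq ..
        finally show ?thesis by (simp only: sum_distrib_left mult_ac)
      qed (use elim in simp)
    qed
  qed
  also have "?c * (\<integral>x. of_nat (q ^ n) * (\<Sum>j<q ^ R. G x * cnj (indicator (coset b (- int n)) (x + - u j))) \<partial>M)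
      = (\<integral>x. (\<Sum>j<q ^ R. G x * cnj (indicator (coset b (- int n)) (x + - u j))) \<partial>M)"
  proof -
    have "real q powi (- int n) * real (q ^ n) = 1" by (simp add: power_int_minus)
    then have "?c * of_nat (q ^ n) = 1" by (metis of_real_1 of_real_mult of_real_of_nat_eq)
    then show ?thesis by (simp only: integral_mult_right_zero mult.assoc[symmetric] mult_1)
  qed
  also have "\<dots> = (\<Sum>j<q ^ R. \<integral>x. G x * cnj (indicator (coset b (- int n)) (x + - u j)) \<partial>M)"
    by (intro Bochner_Integration.integral_sum L2_integrable_mult_cnj[OF G(1)] L2_translate L2_indicator_coset)
  also have "\<dots> = period_form R G (indicator (coset b (- int n)))"
    unfolding period_form_def
  proof (intro sum.cong refl)
    fix j
    let ?f = "\<lambda>x. G x * cnj (indicator (coset b (- int n)) (x + - u j))"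
    have "?f \<in> borel_measurable M"
      by (intro borel_measurable_times borel_measurable_cnj Gm measurable_comp_translate) simp
    from integral_translate[OF this, of "u j"]
    show "(\<integral>x. ?f x \<partial>M) = (\<integral>x. G (x + u j) * cnj (indicator (coset b (- int n)) x) \<partial>M)" by simp
  qed
  finally show ?thesis .
qed

lemma coef_eq_FT: "coef i h = FT h (- u i)"
  unfolding coef_def fourier_integral_def by (simp add: chi_minus)

lemma forms_agree_step:
  assumes G: "G \<in> L2 M" "supported_in (int R) G" and s: "step_fun (- int n) (int R) s"
  shows "partial_form n G s = period_form R G s"
proof -
  have s': "step_fun (- int n) (- int n + int (n + R)) s" using s by simp
  define b where "b = (\<lambda>i. \<pp> powi (- (- int n)) * u i)"
  define e where "e = (\<lambda>i. (indicator (coset (b i) (- int n)) :: 'a \<Rightarrow> complex))"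
  have seq: "s = (\<lambda>x. \<Sum>j<q ^ (n + R). s (b j) * e j x)"
    unfolding b_def e_def by (rule ext) (rule step_fun_expand[OF s'])
  have b: "b j \<in> disc (int R)" if "j < q ^ (n + R)" for j
    using u_in_disc[OF that] pp_powi_disc_iff[of "int n" "u j" "int R"] by (simp add: b_def add.commute)
  have int_e: "integrable M (e j)" for j unfolding e_def by (rule integrable_indicator_coset)
  have e_L2: "e j \<in> L2 M" for j unfolding e_def by (rule L2_indicator_coset)
  have coef_s: "coef i s = (\<Sum>j<q ^ (n + R). s (b j) * coef i (e j))" for i
  proof -
    have "coef i (\<lambda>x. \<Sum>j<q ^ (n + R). s (b j) * e j x) = (\<Sum>j<q ^ (n + R). s (b j) * coef i (e j))"
      unfolding coef_eq_FT by (intro FT_sum_cmult int_e) simp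
    then show ?thesis using seq by metis
  qed
  have "partial_form n G s = (\<Sum>i<q ^ n. \<Sum>j<q ^ (n + R). cnj (s (b j)) * (coef i G * cnj (coef i (e j))))"
    unfolding partial_form_def coef_s cnj_sum sum_distrib_left complex_cnj_mult by (simp only: mult_ac)
  also have "\<dots> = (\<Sum>j<q ^ (n + R). cnj (s (b j)) * partial_form n G (e j))"
    unfolding partial_form_def sum_distrib_left by (rule sum.swap)
  also have "\<dots> = (\<Sum>j<q ^ (n + R). cnj (s (b j)) * period_form R G (e j))"
    unfolding e_def using forms_agree_coset[OF G b, of _ n] by (intro sum.cong) auto
  also have "\<dots> = (\<Sum>i<q ^ R. \<Sum>j<q ^ (n + R). cnj (s (b j)) * L2_inner M (\<lambda>x. G (x + u i)) (e j))"
    unfolding period_form_def sum_distrib_left L2_inner_def by (rule sum.swap)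
  also have "\<dots> = (\<Sum>i<q ^ R. L2_inner M (\<lambda>x. G (x + u i)) (\<lambda>x. \<Sum>j<q ^ (n + R). s (b j) * e j x))"
  proof (rule sum.cong[OF refl])
    fix i
    have "L2_inner M (\<lambda>x. G (x + u i)) (\<lambda>x. \<Sum>j<q ^ (n + R). s (b j) * e j x)
        = (\<Sum>j<q ^ (n + R). L2_inner M (\<lambda>x. G (x + u i)) (\<lambda>x. s (b j) * e j x))"
      by (intro L2_inner_sum_right L2_cmult e_L2 L2_translate G(1))
    then show "(\<Sum>j<q ^ (n + R). cnj (s (b j)) * L2_inner M (\<lambda>x. G (x + u i)) (e j))
        = L2_inner M (\<lambda>x. G (x + u i)) (\<lambda>x. \<Sum>j<q ^ (n + R). s (b j) * e j x)"
      by (simp only: L2_inner_cmult_right)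
  qed
  also have "\<dots> = (\<Sum>i<q ^ R. L2_inner M (\<lambda>x. G (x + u i)) s)" using seq by metis
  finally show ?thesis by (simp only: period_form_def L2_inner_def)
qed

lemma supported_in_diff:
  assumes "supported_in R f" "supported_in R g" shows "supported_in R (\<lambda>x. f x - g x)"
  using assms unfolding supported_in_def by eventually_elim simp

lemma step_fun_supported: "step_fun k R f \<Longrightarrow> supported_in R f"
  unfolding supported_in_def step_fun_def by auto

lemma partial_form_diff_right:
  assumes H: "H \<in> L2 M" "supported_in R H" and s: "s \<in> L2 M" "supported_in R s"
  shows "partial_form n G (\<lambda>x. H x - s x) = partial_form n G H - partial_form n G s"
proof -
  have "coef i (\<lambda>x. H x - s x) = coef i H - coef i s" for i
    using coef_eq_inner[OF L2_measurable[OF L2_diff[OF H(1) s(1)]] supported_in_diff[OF H(2) s(2)]]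
      coef_eq_inner[OF L2_measurable[OF H(1)] H(2)] coef_eq_inner[OF L2_measurable[OF s(1)] s(2)]
      L2_inner_diff_left[OF H(1) s(1) coef_fun_L2] by simp
  then show ?thesis unfolding partial_form_def by (simp add: right_diff_distrib sum_subtractf)
qed

lemma period_form_diff_right:
  assumes "G \<in> L2 M" "H \<in> L2 M" "s \<in> L2 M"
  shows "period_form R G (\<lambda>x. H x - s x) = period_form R G H - period_form R G s"
proof -
  have "(\<integral>x. G (x + u i) * cnj (H x - s x) \<partial>M)
      = (\<integral>x. G (x + u i) * cnj (H x) \<partial>M) - (\<integral>x. G (x + u i) * cnj (s x) \<partial>M)" for i
    using L2_inner_diff_right[OF assms(2,3) L2_translate[OF assms(1), of "u i"]] by (simp add: L2_inner_def)
  then show ?thesis unfolding period_form_def by (simp only: sum_subtractf)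
qed

text \<open>For locally constant \<open>H\<close> the two forms agree as soon as \<open>n\<close> is large. Both are bounded
  uniformly in \<open>n\<close>, the first one by Bessel's inequality, so density does the rest.\<close>

lemma partial_form_tendsto:
  assumes G: "G \<in> L2 M" "supported_in (int R) G" and H: "H \<in> L2 M" "supported_in (int R) H"
  shows "(\<lambda>n. partial_form n G H) \<longlonglongrightarrow> period_form R G H"
proof (rule LIMSEQ_I)
  fix e :: real assume e: "e > 0"
  \<comment> \<open>Both forms are bounded by \<open>q ^ R * L2_norm M G\<close> times the norm of the second argument; the
    summand 1 keeps \<open>K\<close> positive.\<close>
  define K where "K = 2 * real (q ^ R) * L2_norm M G + 1"
  have K: "K > 0" unfolding K_def by (intro add_nonneg_pos mult_nonneg_nonneg) auto
  obtain k s where s: "step_fun k (int R) s" "L2_norm M (\<lambda>x. H x - s x) < e / K"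
    using ex_step_fun_close[OF H(1) H(2)[unfolded supported_in_def], of "e / K"] e K by auto
  note sL = step_fun_L2[OF s(1)] step_fun_supported[OF s(1)]
  note d = L2_diff[OF H(1) sL(1)] supported_in_diff[OF H(2) sL(2)]
  have "norm (partial_form n G H - period_form R G H) < e" if "n \<ge> nat (- k)" for n
  proof -
    have "step_fun (- int n) (int R) s" using step_fun_mono[OF s(1), of "- int n" "int R"] that by simp
    then have eq: "partial_form n G s = period_form R G s" by (rule forms_agree_step[OF G])
    have "partial_form n G H - period_form R G H
        = partial_form n G (\<lambda>x. H x - s x) - period_form R G (\<lambda>x. H x - s x)"
      unfolding partial_form_diff_right[OF H sL] period_form_diff_right[OF G(1) H(1) sL(1)] eq by simp
    then have "norm (partial_form n G H - period_form R G H)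
        \<le> cmod (partial_form n G (\<lambda>x. H x - s x)) + cmod (period_form R G (\<lambda>x. H x - s x))"
      by (metis norm_triangle_ineq4)
    also have "\<dots> \<le> 2 * (real (q ^ R) * (L2_norm M G * L2_norm M (\<lambda>x. H x - s x)))"
      using partial_form_bound[OF G d, of n] period_form_bound[OF G(1) d(1), of R] by simp
    also have "\<dots> \<le> K * L2_norm M (\<lambda>x. H x - s x)"
      unfolding K_def by (simp add: algebra_simps)
    also have "\<dots> < e" using s(2) K by (simp add: field_simps)
    finally show ?thesis .
  qed
  then show "\<exists>no. \<forall>n\<ge>no. norm (partial_form n G H - period_form R G H) < e" by blast
qed

lemma coef_square_summable:
  assumes G: "G \<in> L2 M" "supported_in (int R) G"
  shows "(\<lambda>i. (cmod (coef i G))\<^sup>2) summable_on UNIV"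
proof (rule nonneg_bdd_above_summable_on)
  show "bdd_above (sum (\<lambda>i. (cmod (coef i G))\<^sup>2) ` {F. F \<subseteq> UNIV \<and> finite F})"
    using coef_Bessel[OF G] by (intro bdd_aboveI[of _ "real q powi int R * (L2_norm M G)\<^sup>2"]) auto
qed simp

text \<open>Parseval's identity for the periodizations of \<open>G\<close> and \<open>H\<close>. Bessel's inequality gives absolute
  convergence; the sum is then identified along the partial sums of length \<open>q ^ n\<close>.\<close>

theorem coef_has_sum:
  assumes G: "G \<in> L2 M" "supported_in (int R) G" and H: "H \<in> L2 M" "supported_in (int R) H"
  shows "((\<lambda>i. coef i G * cnj (coef i H)) has_sum period_form R G H) UNIV"
proof -
  have "(\<lambda>i. cmod (coef i G * cnj (coef i H))) summable_on UNIV"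
  proof (rule summable_on_comparison_test)
    show "(\<lambda>i. (cmod (coef i G))\<^sup>2 + (cmod (coef i H))\<^sup>2) summable_on UNIV"
      by (intro summable_on_add coef_square_summable[OF G] coef_square_summable[OF H])
    show "cmod (coef i G * cnj (coef i H)) \<le> (cmod (coef i G))\<^sup>2 + (cmod (coef i H))\<^sup>2" for i
      by (simp add: norm_mult mult_le_sum_squares)
  qed simp
  then have "(\<lambda>i. coef i G * cnj (coef i H)) summable_on UNIV" by (rule abs_summable_summable)
  then obtain S where S: "((\<lambda>i. coef i G * cnj (coef i H)) has_sum S) UNIV" by (auto simp: summable_on_def)
  have "(\<lambda>n. \<Sum>i<n. coef i G * cnj (coef i H)) \<longlonglongrightarrow> S"
    using has_sum_imp_sums[OF S] by (simp add: sums_def)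
  \<comment> \<open>The forms \<open>partial_form n\<close> are the partial sums of length \<open>q ^ n\<close> of the series.\<close>
  moreover have "strict_mono (\<lambda>n. q ^ n)" using q_ge_2 by (intro strict_monoI power_strict_increasing) auto
  ultimately have "(\<lambda>n. partial_form n G H) \<longlonglongrightarrow> S"
    unfolding partial_form_def using LIMSEQ_subseq_LIMSEQ[of _ S "\<lambda>n. q ^ n"] by (simp add: o_def)
  then have "S = period_form R G H" using partial_form_tendsto[OF G H] LIMSEQ_unique by blast
  then show ?thesis using S by simp
qed

end

section \<open>Frame identities from a dense class\<close>

lemma finite_subset_incseq:
  assumes "finite F" "F \<subseteq> (\<Union>n. X n)" "incseq X" shows "\<exists>n::nat. F \<subseteq> X n"
  using assms(1,2)
proof (induction F rule: finite_induct)
  case (insert a F)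
  obtain m n where "F \<subseteq> X m" "a \<in> X n" using insert by auto
  then have "insert a F \<subseteq> X (max m n)"
    using incseqD[OF assms(3), of m "max m n"] incseqD[OF assms(3), of n "max m n"] by auto
  then show ?case ..
qed simp

lemma has_sum_exhaust:
  fixes g :: "'i \<Rightarrow> 'b :: real_normed_vector"
  assumes T: "(g has_sum T) I" and X: "incseq X" "(\<Union>n. X n) = I" and s: "\<And>n. (g has_sum s n) (X n)"
  shows "s \<longlonglongrightarrow> T"
proof (rule LIMSEQ_I)
  fix e :: real assume "e > 0"
  then have e: "e / 2 > 0" by simp
  have "\<forall>\<^sub>F F in finite_subsets_at_top I. dist (sum g F) T < e / 2"
    using T e unfolding has_sum_def by (rule tendstoD)
  then obtain F0 where F0: "finite F0" "F0 \<subseteq> I"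
      "\<And>F. finite F \<Longrightarrow> F0 \<subseteq> F \<Longrightarrow> F \<subseteq> I \<Longrightarrow> dist (sum g F) T < e / 2"
    unfolding eventually_finite_subsets_at_top by auto
  obtain n0 where n0: "F0 \<subseteq> X n0"
    using finite_subset_incseq[OF F0(1) _ X(1)] F0(2) X(2) by auto
  have "norm (s n - T) < e" if "n \<ge> n0" for n
  proof -
    have F0n: "F0 \<subseteq> X n" using n0 X(1) that unfolding incseq_def by blast
    have "\<forall>\<^sub>F F in finite_subsets_at_top (X n). dist (sum g F) (s n) < e / 2"
      using s[of n] e unfolding has_sum_def by (rule tendstoD)
    then obtain F1 where F1: "finite F1" "F1 \<subseteq> X n"
        "\<And>F. finite F \<Longrightarrow> F1 \<subseteq> F \<Longrightarrow> F \<subseteq> X n \<Longrightarrow> dist (sum g F) (s n) < e / 2"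
      unfolding eventually_finite_subsets_at_top by auto
    have "dist (sum g (F0 \<union> F1)) (s n) < e / 2" using F0 F1 F0n by (intro F1(3)) auto
    moreover have "dist (sum g (F0 \<union> F1)) T < e / 2" using F0 F1 X(2) by (intro F0(3)) auto
    ultimately have "dist (s n) T < e / 2 + e / 2" by (metis dist_commute dist_triangle_less_add)
    then show ?thesis by (simp add: dist_norm)
  qed
  then show "\<exists>no. \<forall>n\<ge>no. norm (s n - T) < e" by blast
qed

lemma has_sum_exhaust_nonneg:
  fixes g :: "'i \<Rightarrow> real"
  assumes nn: "\<And>i. g i \<ge> 0" and X: "incseq X" "(\<Union>n. X n) = I"
    and s: "\<And>n. (g has_sum s n) (X n)" and S: "s \<longlonglongrightarrow> S"
  shows "(g has_sum S) I"
proof -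
  have inc: "incseq s"
    unfolding incseq_def
  proof (intro allI impI)
    fix a b :: nat assume "a \<le> b"
    then have "X a \<subseteq> X b" using X(1) by (simp add: incseq_def)
    then show "s a \<le> s b" using s nn by (intro has_sum_mono2[OF s s]) auto
  qed
  have "g summable_on I"
  proof (rule nonneg_bdd_above_summable_on)
    show "bdd_above (sum g ` {F. F \<subseteq> I \<and> finite F})"
    proof (intro bdd_aboveI[of _ S], clarify)
      fix F assume F: "F \<subseteq> I" "finite F"
      obtain n where n: "F \<subseteq> X n" using finite_subset_incseq[OF F(2) _ X(1)] F(1) X(2) by auto
      have "sum g F \<le> s n" using F(2) n nn by (intro finite_sum_le_has_sum[OF s]) auto
      also have "\<dots> \<le> S" using incseq_le[OF inc S] .
      finally show "sum g F \<le> S" .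
    qed
  qed (use nn in auto)
  then obtain T where T: "(g has_sum T) I" by (auto simp: summable_on_def)
  have "T = S" using LIMSEQ_unique[OF has_sum_exhaust[OF T X s] S] .
  then show ?thesis using T by simp
qed

lemma has_sum_finite_fibers:
  fixes g :: "'b \<times> 'c \<times> 'd \<Rightarrow> 'e :: {topological_comm_monoid_add, comm_monoid_add, t2_space}"
  assumes "finite A" "finite B" and v: "\<And>a b. a \<in> A \<Longrightarrow> b \<in> B \<Longrightarrow> ((\<lambda>k. g (a, b, k)) has_sum v a b) UNIV"
  shows "(g has_sum (\<Sum>b\<in>B. \<Sum>a\<in>A. v a b)) (A \<times> B \<times> UNIV)"
proof -
  have 1: "(g has_sum v a b) ({a} \<times> {b} \<times> UNIV)" if "a \<in> A" "b \<in> B" for a b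
  proof -
    have "(g has_sum v a b) ((\<lambda>k. (a, b, k)) ` UNIV)"
      using v[OF that] by (subst has_sum_reindex) (auto simp: inj_on_def o_def)
    moreover have "(\<lambda>k. (a, b, k)) ` UNIV = {a} \<times> {b} \<times> (UNIV :: 'd set)" by auto
    ultimately show ?thesis by simp
  qed
  have 2: "(g has_sum (\<Sum>a\<in>A. v a b)) (A \<times> {b} \<times> UNIV)" if "b \<in> B" for b
    using \<open>finite A\<close> 1[OF _ that]
  proof (induction A rule: finite_induct)
    case (insert a A)
    have "(g has_sum (v a b + (\<Sum>a\<in>A. v a b))) ({a} \<times> {b} \<times> UNIV \<union> A \<times> {b} \<times> UNIV)"
      using insert by (intro has_sum_Un_disjoint) auto
    moreover have "{a} \<times> {b} \<times> (UNIV :: 'd set) \<union> A \<times> {b} \<times> UNIV = insert a A \<times> {b} \<times> UNIV" by auto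
    ultimately show ?case using insert by simp
  qed simp
  show ?thesis using \<open>finite B\<close> 2
  proof (induction B rule: finite_induct)
    case (insert b B)
    have "(g has_sum ((\<Sum>a\<in>A. v a b) + (\<Sum>b\<in>B. \<Sum>a\<in>A. v a b))) (A \<times> {b} \<times> UNIV \<union> A \<times> B \<times> UNIV)"
      using insert by (intro has_sum_Un_disjoint) auto
    moreover have "A \<times> {b} \<times> (UNIV :: 'd set) \<union> A \<times> B \<times> UNIV = A \<times> insert b B \<times> UNIV" by auto
    ultimately show ?case using insert by simp
  qed simp
qed

text \<open>A family in \<open>L2 M\<close> that satisfies Parseval's identity on a dense class \<open>D\<close>.\<close>

locale L2_family =
  fixes M :: "'a measure" and D :: "('a \<Rightarrow> complex) set" and I :: "'i set" and e :: "'i \<Rightarrow> 'a \<Rightarrow> complex"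
  assumes D_L2: "\<And>s. s \<in> D \<Longrightarrow> s \<in> L2 M"
    and dense: "\<And>f \<epsilon>. f \<in> L2 M \<Longrightarrow> \<epsilon> > 0 \<Longrightarrow> \<exists>s\<in>D. L2_norm M (\<lambda>x. f x - s x) < \<epsilon>"
    and e_L2: "\<And>i. i \<in> I \<Longrightarrow> e i \<in> L2 M"
    and parseval_dense: "\<And>s. s \<in> D \<Longrightarrow> ((\<lambda>i. (cmod (L2_inner M s (e i)))\<^sup>2) has_sum (L2_norm M s)\<^sup>2) I"
begin

definition analysis_norm :: "'i set \<Rightarrow> ('a \<Rightarrow> complex) \<Rightarrow> real" where
  "analysis_norm F f = L2_set (\<lambda>i. cmod (L2_inner M f (e i))) F"

lemma analysis_norm_nonneg [simp]: "0 \<le> analysis_norm F f"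
  by (simp add: analysis_norm_def L2_set_nonneg)

lemma analysis_norm_diff:
  assumes "F \<subseteq> I" "f \<in> L2 M" "g \<in> L2 M"
  shows "analysis_norm F f \<le> analysis_norm F g + analysis_norm F (\<lambda>x. f x - g x)"
proof -
  have "analysis_norm F f \<le> L2_set (\<lambda>i. cmod (L2_inner M g (e i)) + cmod (L2_inner M (\<lambda>x. f x - g x) (e i))) F"
    unfolding analysis_norm_def
  proof (rule L2_set_mono)
    fix i assume "i \<in> F"
    then have "L2_inner M f (e i) = L2_inner M g (e i) + L2_inner M (\<lambda>x. f x - g x) (e i)"
      using assms e_L2 by (subst L2_inner_diff_left) auto
    then show "cmod (L2_inner M f (e i)) \<le> cmod (L2_inner M g (e i)) + cmod (L2_inner M (\<lambda>x. f x - g x) (e i))"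
      by (simp add: norm_triangle_ineq)
  qed simp
  also have "\<dots> \<le> analysis_norm F g + analysis_norm F (\<lambda>x. f x - g x)"
    unfolding analysis_norm_def by (rule L2_set_triangle_ineq)
  finally show ?thesis .
qed

lemma analysis_norm_dense_le:
  assumes "finite F" "F \<subseteq> I" "s \<in> D" shows "analysis_norm F s \<le> L2_norm M s"
proof -
  have "(\<Sum>i\<in>F. (cmod (L2_inner M s (e i)))\<^sup>2) \<le> (L2_norm M s)\<^sup>2"
    using assms by (intro finite_sum_le_has_sum[OF parseval_dense]) auto
  then show ?thesis unfolding analysis_norm_def L2_set_def by (intro real_le_lsqrt) auto
qed

lemma analysis_norm_crude:
  assumes "F \<subseteq> I" "f \<in> L2 M"
  shows "analysis_norm F f \<le> L2_norm M f * (\<Sum>i\<in>F. L2_norm M (e i))"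
proof -
  have "analysis_norm F f \<le> (\<Sum>i\<in>F. cmod (L2_inner M f (e i)))"
    unfolding analysis_norm_def by (rule L2_set_le_sum) simp
  also have "\<dots> \<le> (\<Sum>i\<in>F. L2_norm M f * L2_norm M (e i))"
    using assms e_L2 by (intro sum_mono L2_Cauchy_Schwarz) auto
  finally show ?thesis by (simp add: sum_distrib_left)
qed

text \<open>For a fixed finite \<open>F\<close> the left hand side is continuous in \<open>f\<close>, with a crude constant that
  depends on \<open>F\<close>; so the inequality passes from the dense class to all of \<open>L2 M\<close>.\<close>

lemma Bessel:
  assumes F: "finite F" "F \<subseteq> I" and f: "f \<in> L2 M" shows "analysis_norm F f \<le> L2_norm M f"
proof (rule field_le_epsilon)
  fix \<epsilon> :: real assume \<epsilon>: "\<epsilon> > 0"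
  define K where "K = (\<Sum>i\<in>F. L2_norm M (e i))"
  have K: "K \<ge> 0" by (simp add: K_def sum_nonneg)
  obtain s where s: "s \<in> D" "L2_norm M (\<lambda>x. f x - s x) < \<epsilon> / (K + 1)"
    using dense[OF f, of "\<epsilon> / (K + 1)"] K \<epsilon> by auto
  let ?d = "L2_norm M (\<lambda>x. f x - s x)"
  have sL: "s \<in> L2 M" by (rule D_L2[OF s(1)])
  have "analysis_norm F f \<le> analysis_norm F s + analysis_norm F (\<lambda>x. f x - s x)"
    by (rule analysis_norm_diff[OF F(2) f sL])
  also have "\<dots> \<le> L2_norm M s + ?d * K"
    using analysis_norm_dense_le[OF F s(1)] analysis_norm_crude[OF F(2) L2_diff[OF f sL]] by (simp add: K_def)
  also have "L2_norm M s \<le> L2_norm M f + ?d"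
    using L2_norm_le_diff[OF sL f] by (simp add: L2_norm_minus_commute[of M s f])
  also have "L2_norm M f + ?d + ?d * K = L2_norm M f + ?d * (K + 1)" by (simp add: algebra_simps)
  also have "\<dots> \<le> L2_norm M f + \<epsilon>" using s(2) K by (simp add: field_simps)
  finally show "analysis_norm F f \<le> L2_norm M f + \<epsilon>" by simp
qed

text \<open>The upper bound is Bessel's inequality. For the lower bound compare \<open>f\<close> with a close element
  of the dense class: by Bessel's inequality for the difference, the coefficients are close too.\<close>

theorem parseval:
  assumes f: "f \<in> L2 M"
  shows "((\<lambda>i. (cmod (L2_inner M f (e i)))\<^sup>2) has_sum (L2_norm M f)\<^sup>2) I"
proof -
  let ?g = "\<lambda>i. (cmod (L2_inner M f (e i)))\<^sup>2"
  have sum_eq: "(\<Sum>i\<in>F. (cmod (L2_inner M h (e i)))\<^sup>2) = (analysis_norm F h)\<^sup>2" for F h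
    unfolding analysis_norm_def L2_set_def by (simp add: sum_nonneg)
  have bound: "sum ?g F \<le> (L2_norm M f)\<^sup>2" if "finite F" "F \<subseteq> I" for F
    unfolding sum_eq using Bessel[OF that f] by (intro power_mono) auto
  have "?g summable_on I"
  proof (rule nonneg_bdd_above_summable_on)
    show "bdd_above (sum ?g ` {F. F \<subseteq> I \<and> finite F})"
      using bound by (intro bdd_aboveI[of _ "(L2_norm M f)\<^sup>2"]) auto
  qed simp
  then obtain T where T: "(?g has_sum T) I" by (auto simp: summable_on_def)
  have T0: "T \<ge> 0" using has_sum_nonneg[OF T] by simp
  have le: "T \<le> (L2_norm M f)\<^sup>2"
    using tendsto_upperbound[OF T[unfolded has_sum_def], of "(L2_norm M f)\<^sup>2"] bound
    by (auto simp: eventually_finite_subsets_at_top)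
  have "L2_norm M f \<le> sqrt T"
  proof (rule field_le_epsilon)
    fix \<epsilon> :: real assume "\<epsilon> > 0"
    then have \<epsilon>: "\<epsilon> / 3 > 0" by simp
    obtain s where s: "s \<in> D" "L2_norm M (\<lambda>x. f x - s x) < \<epsilon> / 3" using dense[OF f \<epsilon>] by blast
    have sL: "s \<in> L2 M" by (rule D_L2[OF s(1)])
    have "((\<lambda>F. analysis_norm F s) \<longlongrightarrow> L2_norm M s) (finite_subsets_at_top I)"
      using tendsto_real_sqrt[OF parseval_dense[OF s(1), unfolded has_sum_def]] by (simp add: sum_eq)
    then have "\<forall>\<^sub>F F in finite_subsets_at_top I. analysis_norm F s > L2_norm M s - \<epsilon> / 3"
      using \<epsilon> by (intro order_tendstoD) auto
    then obtain F where F: "finite F" "F \<subseteq> I" "analysis_norm F s > L2_norm M s - \<epsilon> / 3"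
      unfolding eventually_finite_subsets_at_top by blast
    have "L2_norm M f \<le> L2_norm M s + L2_norm M (\<lambda>x. f x - s x)" by (rule L2_norm_le_diff[OF f sL])
    also have "L2_norm M s \<le> analysis_norm F s + \<epsilon> / 3" using F(3) by simp
    also have "analysis_norm F s \<le> analysis_norm F f + analysis_norm F (\<lambda>x. s x - f x)"
      by (rule analysis_norm_diff[OF F(2) sL f])
    also have "analysis_norm F (\<lambda>x. s x - f x) \<le> L2_norm M (\<lambda>x. f x - s x)"
      using Bessel[OF F(1,2) L2_diff[OF sL f]] by (simp add: L2_norm_minus_commute[of M s f])
    also have "analysis_norm F f \<le> sqrt T"
    proof -
      have "(analysis_norm F f)\<^sup>2 \<le> T"
        unfolding sum_eq[symmetric] using F by (intro finite_sum_le_has_sum[OF T]) auto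
      then show ?thesis by (rule real_le_rsqrt)
    qed
    finally show "L2_norm M f \<le> sqrt T + \<epsilon>" using s(2) by simp
  qed
  then have "(L2_norm M f)\<^sup>2 \<le> (sqrt T)\<^sup>2" by (rule power_mono) simp
  then have "T = (L2_norm M f)\<^sup>2" using le T0 by simp
  then show ?thesis using T by simp
qed

text \<open>Synthesis is the adjoint of analysis, which is bounded by Bessel's inequality.\<close>

lemma synthesis_bound:
  assumes F: "finite F" "F \<subseteq> I"
  shows "L2_norm M (\<lambda>x. \<Sum>i\<in>F. a i * e i x) \<le> L2_set (\<lambda>i. cmod (a i)) F"
proof -
  define S where "S = (\<lambda>x. \<Sum>i\<in>F. a i * e i x)"
  have ei: "e i \<in> L2 M" if "i \<in> F" for i using that F e_L2 by blast
  have S: "S \<in> L2 M" unfolding S_def by (intro L2_sum L2_cmult ei)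
  have "L2_inner M S S = (\<Sum>i\<in>F. L2_inner M (\<lambda>x. a i * e i x) S)"
    by (subst (1) S_def) (intro L2_inner_sum_left L2_cmult ei S)
  then have eq: "L2_inner M S S = (\<Sum>i\<in>F. a i * cnj (L2_inner M S (e i)))"
    by (simp only: L2_inner_cmult_left L2_inner_commute[of M "e _" S])
  have "(L2_norm M S)\<^sup>2 = cmod (L2_inner M S S)"
    unfolding L2_inner_self by (simp only: norm_of_real abs_power2)
  also have "\<dots> \<le> (\<Sum>i\<in>F. cmod (a i) * cmod (L2_inner M S (e i)))"
    unfolding eq by (rule order_trans[OF norm_sum]) (simp add: norm_mult)
  also have "\<dots> \<le> L2_set (\<lambda>i. cmod (a i)) F * analysis_norm F S"
    unfolding analysis_norm_def
    using L2_set_mult_ineq[of "\<lambda>i. cmod (a i)" "\<lambda>i. cmod (L2_inner M S (e i))" F] by simp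
  also have "\<dots> \<le> L2_set (\<lambda>i. cmod (a i)) F * L2_norm M S"
    using Bessel[OF F S] by (intro mult_left_mono) (auto simp: L2_set_nonneg)
  finally have "L2_norm M S * L2_norm M S \<le> L2_set (\<lambda>i. cmod (a i)) F * L2_norm M S"
    by (simp add: power2_eq_square)
  then show ?thesis
    unfolding S_def[symmetric] using L2_set_nonneg[of "\<lambda>i. cmod (a i)" F] L2_norm_nonneg[of M S]
    by (cases "L2_norm M S = 0") auto
qed

end

text \<open>Two such families that are orthogonal to each other in the weak sense, on the dense class.\<close>

locale L2_family_pair = E: L2_family M D I e + E': L2_family M D I e'
  for M :: "'a measure" and D I and e e' :: "'i \<Rightarrow> 'a \<Rightarrow> complex" +
  assumes orthogonal_dense: "\<And>s t. s \<in> D \<Longrightarrow> t \<in> D \<Longrightarrow>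
    ((\<lambda>i. L2_inner M s (e i) * cnj (L2_inner M t (e' i))) has_sum 0) I"
begin

definition mixed_form :: "'i set \<Rightarrow> ('a \<Rightarrow> complex) \<Rightarrow> ('a \<Rightarrow> complex) \<Rightarrow> complex" where
  "mixed_form F f g = (\<Sum>i\<in>F. L2_inner M f (e i) * cnj (L2_inner M g (e' i)))"

lemma mixed_form_bound:
  assumes F: "finite F" "F \<subseteq> I" and f: "f \<in> L2 M" and g: "g \<in> L2 M"
  shows "cmod (mixed_form F f g) \<le> L2_norm M f * L2_norm M g"
proof -
  have "cmod (mixed_form F f g) \<le> (\<Sum>i\<in>F. cmod (L2_inner M f (e i)) * cmod (L2_inner M g (e' i)))"
    unfolding mixed_form_def by (rule order_trans[OF norm_sum]) (simp add: norm_mult)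
  also have "\<dots> \<le> E.analysis_norm F f * E'.analysis_norm F g"
    unfolding E.analysis_norm_def E'.analysis_norm_def
    using L2_set_mult_ineq[of "\<lambda>i. cmod (L2_inner M f (e i))" "\<lambda>i. cmod (L2_inner M g (e' i))" F] by simp
  also have "\<dots> \<le> L2_norm M f * L2_norm M g"
    using E.Bessel[OF F f] E'.Bessel[OF F g] by (intro mult_mono) auto
  finally show ?thesis .
qed

lemma mixed_form_split:
  assumes F: "F \<subseteq> I" and "f \<in> L2 M" "g \<in> L2 M" "s \<in> L2 M" "t \<in> L2 M"
  shows "mixed_form F f g = mixed_form F s t + mixed_form F (\<lambda>x. f x - s x) t + mixed_form F f (\<lambda>x. g x - t x)"
proof -
  have "L2_inner M f (e i) * cnj (L2_inner M g (e' i)) = L2_inner M s (e i) * cnj (L2_inner M t (e' i))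
      + L2_inner M (\<lambda>x. f x - s x) (e i) * cnj (L2_inner M t (e' i))
      + L2_inner M f (e i) * cnj (L2_inner M (\<lambda>x. g x - t x) (e' i))" if "i \<in> F" for i
  proof -
    have i: "i \<in> I" using that F by blast
    have eq1: "L2_inner M (\<lambda>x. f x - s x) (e i) = L2_inner M f (e i) - L2_inner M s (e i)"
      by (intro L2_inner_diff_left assms E.e_L2[OF i])
    have eq2: "L2_inner M (\<lambda>x. g x - t x) (e' i) = L2_inner M g (e' i) - L2_inner M t (e' i)"
      by (intro L2_inner_diff_left assms E'.e_L2[OF i])
    show ?thesis unfolding eq1 eq2 by (simp add: algebra_simps)
  qed
  then show ?thesis unfolding mixed_form_def sum.distrib[symmetric] by (intro sum.cong) auto
qed

lemma mixed_form_tendsto: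
  assumes f: "f \<in> L2 M" and g: "g \<in> L2 M"
  shows "((\<lambda>F. mixed_form F f g) \<longlongrightarrow> 0) (finite_subsets_at_top I)"
proof (rule tendstoI)
  fix \<epsilon> :: real assume "\<epsilon> > 0"
  then have \<epsilon>: "\<epsilon> / 3 > 0" by simp
  obtain t where t: "t \<in> D" "L2_norm M (\<lambda>x. g x - t x) < \<epsilon> / 3 / (L2_norm M f + 1)"
    using E.dense[OF g, of "\<epsilon> / 3 / (L2_norm M f + 1)"] \<epsilon> L2_norm_nonneg[of M f]
    by (auto simp: zero_less_divide_iff add_nonneg_pos)
  obtain s where s: "s \<in> D" "L2_norm M (\<lambda>x. f x - s x) < \<epsilon> / 3 / (L2_norm M t + 1)"
    using E.dense[OF f, of "\<epsilon> / 3 / (L2_norm M t + 1)"] \<epsilon> L2_norm_nonneg[of M t]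
    by (auto simp: zero_less_divide_iff add_nonneg_pos)
  note sL = E.D_L2[OF s(1)] and tL = E.D_L2[OF t(1)]
  have small: "a * b < \<epsilon> / 3" if "a < \<epsilon> / 3 / (b + 1)" "0 \<le> b" "0 \<le> a" for a b :: real
  proof -
    have "a * (b + 1) < \<epsilon> / 3" using that by (simp add: field_simps)
    then show ?thesis using that by (simp add: algebra_simps)
  qed
  have "((\<lambda>F. mixed_form F s t) \<longlongrightarrow> 0) (finite_subsets_at_top I)"
    using orthogonal_dense[OF s(1) t(1)] unfolding has_sum_def mixed_form_def .
  then have "\<forall>\<^sub>F F in finite_subsets_at_top I. dist (mixed_form F s t) 0 < \<epsilon> / 3"
    using \<epsilon> by (rule tendstoD)
  moreover have "\<forall>\<^sub>F F in finite_subsets_at_top I. finite F \<and> F \<subseteq> I"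
    by (rule eventually_finite_subsets_at_top_weakI) simp
  ultimately show "\<forall>\<^sub>F F in finite_subsets_at_top I. dist (mixed_form F f g) 0 < \<epsilon>"
  proof eventually_elim
    case (elim F)
    then have F: "finite F" "F \<subseteq> I" by auto
    have "cmod (mixed_form F f g) \<le> cmod (mixed_form F s t) + cmod (mixed_form F (\<lambda>x. f x - s x) t)
        + cmod (mixed_form F f (\<lambda>x. g x - t x))"
      unfolding mixed_form_split[OF F(2) f g sL tL]
      by (rule order_trans[OF norm_triangle_ineq]) (intro add_right_mono norm_triangle_ineq)
    moreover have "cmod (mixed_form F (\<lambda>x. f x - s x) t) \<le> L2_norm M (\<lambda>x. f x - s x) * L2_norm M t"
      by (rule mixed_form_bound[OF F L2_diff[OF f sL] tL])
    moreover have "L2_norm M (\<lambda>x. f x - s x) * L2_norm M t < \<epsilon> / 3"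
      by (rule small[OF s(2)]) simp_all
    moreover have "cmod (mixed_form F f (\<lambda>x. g x - t x)) \<le> L2_norm M f * L2_norm M (\<lambda>x. g x - t x)"
      by (rule mixed_form_bound[OF F f L2_diff[OF g tL]])
    moreover have "L2_norm M (\<lambda>x. g x - t x) * L2_norm M f < \<epsilon> / 3"
      by (rule small[OF t(2)]) simp_all
    ultimately show ?case using elim(1) by (simp add: mult.commute)
  qed
qed

text \<open>The mixed identity says that the partial sums tend weakly to 0. They form a Cauchy net by
  \<open>E'.synthesis_bound\<close>, hence they tend to 0 in norm.\<close>

theorem synthesis_tendsto_zero:
  assumes f: "f \<in> L2 M"
  shows "((\<lambda>F. L2_norm M (\<lambda>x. \<Sum>i\<in>F. L2_inner M f (e i) * e' i x)) \<longlongrightarrow> 0) (finite_subsets_at_top I)"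
proof (rule tendstoI)
  fix \<epsilon> :: real assume "\<epsilon> > 0"
  then have \<epsilon>: "\<epsilon> / 3 > 0" by simp
  define S where "S = (\<lambda>F x. \<Sum>i\<in>F. L2_inner M f (e i) * e' i x)"
  have S: "S F \<in> L2 M" if "F \<subseteq> I" for F
    unfolding S_def using that E'.e_L2 by (intro L2_sum L2_cmult) auto
  let ?g = "\<lambda>i. (cmod (L2_inner M f (e i)))\<^sup>2"
  have par: "(?g has_sum (L2_norm M f)\<^sup>2) I" by (rule E.parseval[OF f])
  have "\<forall>\<^sub>F F in finite_subsets_at_top I. sum ?g F > (L2_norm M f)\<^sup>2 - (\<epsilon> / 3)\<^sup>2"
    using par[unfolded has_sum_def] \<epsilon> by (intro order_tendstoD) auto
  then obtain F0 where F0: "finite F0" "F0 \<subseteq> I" "sum ?g F0 > (L2_norm M f)\<^sup>2 - (\<epsilon> / 3)\<^sup>2"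
    unfolding eventually_finite_subsets_at_top by blast
  \<comment> \<open>Outside \<open>F0\<close> the squared coefficients sum to less than \<open>(\<epsilon> / 3)\<^sup>2\<close>.\<close>
  have tail: "L2_norm M (S (F - F0)) \<le> \<epsilon> / 3" if F: "finite F" "F0 \<subseteq> F" "F \<subseteq> I" for F
  proof -
    have "sum ?g F \<le> (L2_norm M f)\<^sup>2" using F by (intro finite_sum_le_has_sum[OF par]) auto
    then have "sum ?g (F - F0) \<le> (\<epsilon> / 3)\<^sup>2" using F0 F by (simp add: sum_diff)
    then have "L2_set (\<lambda>i. cmod (L2_inner M f (e i))) (F - F0) \<le> \<epsilon> / 3"
      unfolding L2_set_def using \<epsilon> by (intro real_le_lsqrt) auto
    moreover have "L2_norm M (S (F - F0)) \<le> L2_set (\<lambda>i. cmod (L2_inner M f (e i))) (F - F0)"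
      unfolding S_def using F by (intro E'.synthesis_bound) auto
    ultimately show ?thesis by simp
  qed
  have split: "S F = (\<lambda>x. S F0 x + S (F - F0) x)" if "finite F" "F0 \<subseteq> F" for F
    unfolding S_def using sum.subset_diff[OF that(2,1)] by (auto simp: add.commute)
  have inner_S: "L2_inner M (S F) h = mixed_form F f h" if "F \<subseteq> I" "h \<in> L2 M" for F h
  proof -
    have "L2_inner M (S F) h = (\<Sum>i\<in>F. L2_inner M (\<lambda>x. L2_inner M f (e i) * e' i x) h)"
      unfolding S_def using that E'.e_L2 by (intro L2_inner_sum_left L2_cmult) auto
    then show ?thesis
      unfolding mixed_form_def by (simp only: L2_inner_cmult_left L2_inner_commute[of M "e' _" h])
  qed
  \<comment> \<open>Compare \<open>S F0\<close> with \<open>S F\<close>, whose inner product with \<open>S F0\<close> tends to 0 as \<open>F\<close> grows.\<close>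
  have head: "L2_norm M (S F0) \<le> \<epsilon> / 3"
  proof -
    have "(L2_norm M (S F0))\<^sup>2 \<le> \<epsilon> / 3 * L2_norm M (S F0)"
    proof (rule tendsto_lowerbound)
      show "((\<lambda>F. cmod (mixed_form F f (S F0)) + \<epsilon> / 3 * L2_norm M (S F0)) \<longlongrightarrow> \<epsilon> / 3 * L2_norm M (S F0))
          (finite_subsets_at_top I)"
        using tendsto_add[OF tendsto_norm[OF mixed_form_tendsto[OF f S[OF F0(2)]]] tendsto_const] by simp
      show "\<forall>\<^sub>F F in finite_subsets_at_top I.
          (L2_norm M (S F0))\<^sup>2 \<le> cmod (mixed_form F f (S F0)) + \<epsilon> / 3 * L2_norm M (S F0)"
        unfolding eventually_finite_subsets_at_top
      proof (rule exI[of _ F0], intro conjI allI impI F0(1,2))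
        fix F assume "finite F \<and> F0 \<subseteq> F \<and> F \<subseteq> I"
        then have F: "finite F" "F0 \<subseteq> F" "F \<subseteq> I" by auto
        have d: "F - F0 \<subseteq> I" using F by blast
        have "L2_inner M (S F) (S F0) = L2_inner M (S F0) (S F0) + L2_inner M (S (F - F0)) (S F0)"
          unfolding split[OF F(1,2)] by (rule L2_inner_add_left[OF S[OF F0(2)] S[OF d] S[OF F0(2)]])
        then have eq: "of_real ((L2_norm M (S F0))\<^sup>2) = mixed_form F f (S F0) - L2_inner M (S (F - F0)) (S F0)"
          unfolding inner_S[OF F(3) S[OF F0(2)]] L2_inner_self by simp
        have "(L2_norm M (S F0))\<^sup>2 = cmod (of_real ((L2_norm M (S F0))\<^sup>2))"
          by (simp only: norm_of_real abs_power2 abs_of_nonneg zero_le_power2)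
        also have "\<dots> \<le> cmod (mixed_form F f (S F0)) + cmod (L2_inner M (S (F - F0)) (S F0))"
          unfolding eq by (rule norm_triangle_ineq4)
        also have "cmod (L2_inner M (S (F - F0)) (S F0)) \<le> L2_norm M (S (F - F0)) * L2_norm M (S F0)"
          by (rule L2_Cauchy_Schwarz[OF S[OF d] S[OF F0(2)]])
        also have "\<dots> \<le> \<epsilon> / 3 * L2_norm M (S F0)" using tail[OF F] by (intro mult_right_mono) auto
        finally show "(L2_norm M (S F0))\<^sup>2 \<le> cmod (mixed_form F f (S F0)) + \<epsilon> / 3 * L2_norm M (S F0)" by simp
      qed
    qed simp
    then have "L2_norm M (S F0) * L2_norm M (S F0) \<le> \<epsilon> / 3 * L2_norm M (S F0)" by (simp add: power2_eq_square)
    then show ?thesis using \<epsilon> L2_norm_nonneg[of M "S F0"] by (cases "L2_norm M (S F0) = 0") auto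
  qed
  have "L2_norm M (S F) < \<epsilon>" if F: "finite F" "F0 \<subseteq> F" "F \<subseteq> I" for F
  proof -
    have d: "F - F0 \<subseteq> I" using F by blast
    have "L2_norm M (S F) \<le> L2_norm M (S F0) + L2_norm M (S (F - F0))"
      unfolding split[OF F(1,2)] by (rule L2_norm_triangle[OF S[OF F0(2)] S[OF d]])
    then show ?thesis using head tail[OF F] \<epsilon> by simp
  qed
  then show "\<forall>\<^sub>F F in finite_subsets_at_top I.
      dist (L2_norm M (\<lambda>x. \<Sum>i\<in>F. L2_inner M f (e i) * e' i x)) 0 < \<epsilon>"
    unfolding eventually_finite_subsets_at_top S_def using F0(1,2) by (intro exI[of _ F0]) (auto simp: dist_real_def)
qed

end

context local_field_setup
begin

section \<open>Masks\<close>

lemma indicator_disc_translate: "a \<in> disc R \<Longrightarrow> indicator (disc R) (x + a) = indicator (disc R) x"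
  by (simp add: indicator_def disc_add_iff)

text \<open>A mask is the mean-square limit, on every disc, of trigonometric polynomials that are
  periodic with respect to every representative.\<close>

lemma mask_periodic:
  assumes m: "is_mask M q chi u m"
  shows "AE \<xi> in M. m (\<xi> + u k) = m \<xi>"
proof -
  obtain d where d: "\<And>C. compact C \<Longrightarrow> (\<lambda>\<xi>. indicator C \<xi> * m \<xi>) \<in> L2 M"
      "\<And>C. compact C \<Longrightarrow> (\<lambda>N. L2_norm M (\<lambda>\<xi>. indicator C \<xi> *
         (m \<xi> - (1 / of_real (sqrt (real q))) * (\<Sum>k<N. d k * cnj (chi (u k * \<xi>)))))) \<longlonglongrightarrow> 0"
    using m unfolding is_mask_def by blast
  have mm: "m \<in> borel_measurable M" using m unfolding is_mask_def by blast
  define t where "t = (\<lambda>N \<xi>. (1 / of_real (sqrt (real q))) * (\<Sum>k<N. d k * cnj (chi (u k * \<xi>))) :: complex)"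
  \<comment> \<open>The partial sums are exactly periodic, since \<open>chi (u j * u k) = 1\<close>.\<close>
  have t_per: "t N (\<xi> + u k) = t N \<xi>" for N \<xi>
    unfolding t_def by (simp add: distrib_left chi_add)
  have t_L2: "(\<lambda>\<xi>. indicator (disc R) \<xi> * t N \<xi>) \<in> L2 M" for N R
  proof -
    have "(\<lambda>\<xi>. (1 / of_real (sqrt (real q))) * (\<Sum>k<N. d k * coef_fun R k \<xi>)) \<in> L2 M"
      by (intro L2_cmult L2_sum coef_fun_L2)
    moreover have "(1 / of_real (sqrt (real q))) * (\<Sum>k<N. d k * coef_fun R k \<xi>) = indicator (disc R) \<xi> * t N \<xi>" for \<xi>
      unfolding t_def coef_fun_def by (simp add: sum_distrib_left sum_distrib_right mult_ac)
    ultimately show ?thesis by (simp only:)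
  qed
  have "AE \<xi> in M. \<xi> \<in> disc (int R) \<longrightarrow> m (\<xi> + u k) = m \<xi>" if R: "u k \<in> disc (int R)" for R
  proof -
    define E where "E = (\<lambda>N \<xi>. indicator (disc (int R)) \<xi> * (m \<xi> - t N \<xi>))"
    define D where "D = (\<lambda>\<xi>. indicator (disc (int R)) \<xi> * (m (\<xi> + u k) - m \<xi>))"
    have E_L2: "E N \<in> L2 M" for N
      unfolding E_def right_diff_distrib by (intro L2_diff d(1) compact_disc t_L2)
    have D_eq: "D = (\<lambda>\<xi>. E N (\<xi> + u k) - E N \<xi>)" for N
      unfolding D_def E_def t_per indicator_disc_translate[OF R] by (simp add: algebra_simps)
    have D_L2: "D \<in> L2 M" unfolding D_eq[of 0] by (intro L2_diff L2_translate E_L2)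
    have le: "L2_norm M D \<le> 2 * L2_norm M (E N)" for N
    proof -
      have "L2_norm M D \<le> L2_norm M (\<lambda>\<xi>. E N (\<xi> + u k)) + L2_norm M (\<lambda>\<xi>. (-1) * E N \<xi>)"
        using L2_norm_triangle[OF L2_translate[OF E_L2] L2_cmult[OF E_L2, of "-1" N], of N "u k"]
        unfolding D_eq[of N] by simp
      then show ?thesis by (simp only: L2_norm_translate[OF E_L2] L2_norm_cmult) simp
    qed
    have lim: "(\<lambda>N. 2 * L2_norm M (E N)) \<longlonglongrightarrow> 0"
      using tendsto_mult_right_zero[OF d(2)[OF compact_disc, of "int R"], of 2] unfolding E_def t_def by simp
    have "L2_norm M D \<le> 0" by (rule LIMSEQ_le_const[OF lim]) (use le in simp)
    then have "L2_norm M D = 0" using L2_norm_nonneg[of M D] by simp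
    then have "AE \<xi> in M. D \<xi> = 0" using L2_norm_eq_0_iff[OF D_L2] by simp
    then show ?thesis by eventually_elim (auto simp: D_def)
  qed
  moreover have "u k \<in> disc (int R)" if "R \<ge> k" for R
  proof -
    have "k < q ^ R" using less_q_power[of R] that by simp
    then show ?thesis by (rule u_in_disc)
  qed
  ultimately have "\<forall>R. AE \<xi> in M. R \<ge> k \<longrightarrow> \<xi> \<in> disc (int R) \<longrightarrow> m (\<xi> + u k) = m \<xi>" by auto
  then have "AE \<xi> in M. \<forall>R. R \<ge> k \<longrightarrow> \<xi> \<in> disc (int R) \<longrightarrow> m (\<xi> + u k) = m \<xi>"
    by (subst AE_all_countable)
  then show ?thesis
  proof eventually_elim
    case (elim \<xi>)
    obtain n where "\<xi> \<in> disc (int n)" using disc_exhaust by blast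
    then have "\<xi> \<in> disc (int (max n k))" using disc_mono[of "int n" "int (max n k)"] by auto
    then show ?case by (intro elim[rule_format, of "max n k"]) simp_all
  qed
qed

lemma AE_pp_mult: "(AE x in M. P x) \<Longrightarrow> (AE x in M. P (\<pp> * x))"
  using AE_dilate[of P 1] by simp

text \<open>The cross-correlation of the two families over the shifts \<open>\<pp> * u k\<close> with \<open>0 \<le> k < q\<close> is \<open>a\<close>
  at the shift 0 and vanishes at the others. The hypotheses of the theorem are of this form with
  \<open>a = 1\<close> (both families equal, index 0 included) and with \<open>a = 0\<close> (different families, index 0
  left out).\<close>

definition mask_relation :: "'l set \<Rightarrow> ('l \<Rightarrow> 'a \<Rightarrow> complex) \<Rightarrow> ('l \<Rightarrow> 'a \<Rightarrow> complex) \<Rightarrow> complex \<Rightarrow> bool" where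
  "mask_relation I m m' a \<longleftrightarrow>
     (\<forall>k\<in>{1..q - 1}. AE \<xi> in M. (\<Sum>l\<in>I. cnj (m l \<xi>) * m' l \<xi>) = a \<and>
        (\<Sum>l\<in>I. cnj (m l (\<xi> + \<pp> * u k)) * m' l \<xi>) = 0)"

text \<open>Only the lowest base-\<open>q\<close> digit of \<open>n\<close> matters: the remaining digits shift the argument of the
  mask by a representative, which is a period.\<close>

lemma mask_relation_shift:
  assumes rel: "mask_relation I m m' a" and fin: "finite I" and per: "\<And>l. l \<in> I \<Longrightarrow> is_mask M q chi u (m l)"
  shows "AE \<xi> in M. (\<Sum>l\<in>I. cnj (m l (\<pp> * (\<xi> + u n))) * m' l (\<pp> * \<xi>)) = (if n mod q = 0 then a else 0)"
proof -
  define b n' where "b = n mod q" and "n' = n div q"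
  have b: "b < q" by (simp add: b_def)
  have n: "n = b + q * n'" by (simp add: b_def n'_def)
  have shift: "\<pp> * (\<xi> + u n) = (\<pp> * \<xi> + \<pp> * u b) + u n'" for \<xi>
    unfolding n u_split[OF b] by (simp add: distrib_left mult.assoc[symmetric])
  have "AE \<xi> in M. m l ((\<xi> + \<pp> * u b) + u n') = m l (\<xi> + \<pp> * u b)" if "l \<in> I" for l
    using AE_translate[OF mask_periodic[OF per[OF that], of n'], of "\<pp> * u b"] .
  then have "AE \<xi> in M. \<forall>l\<in>I. m l ((\<xi> + \<pp> * u b) + u n') = m l (\<xi> + \<pp> * u b)"
    using fin by (simp add: AE_ball_countable countable_finite)
  from AE_pp_mult[OF this]
  have A: "AE \<xi> in M. \<forall>l\<in>I. m l (\<pp> * (\<xi> + u n)) = m l (\<pp> * \<xi> + \<pp> * u b)"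
    by (simp only: shift)
  \<comment> \<open>The relation at shift 0 is contained in that for every \<open>k\<close>, in particular for \<open>k = 1 \<le> q - 1\<close>.\<close>
  define k where "k = (if b = 0 then 1 else b)"
  have "k \<in> {1..q - 1}" using b q_ge_2 by (auto simp: k_def)
  then have "AE \<xi> in M. (\<Sum>l\<in>I. cnj (m l \<xi>) * m' l \<xi>) = a \<and> (\<Sum>l\<in>I. cnj (m l (\<xi> + \<pp> * u k)) * m' l \<xi>) = 0"
    using rel unfolding mask_relation_def by blast
  from AE_pp_mult[OF this] A show ?thesis
  proof eventually_elim
    case (elim \<xi>)
    have "(\<Sum>l\<in>I. cnj (m l (\<pp> * (\<xi> + u n))) * m' l (\<pp> * \<xi>))
        = (\<Sum>l\<in>I. cnj (m l (\<pp> * \<xi> + \<pp> * u b)) * m' l (\<pp> * \<xi>))"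
      using elim(2) by (intro sum.cong) auto
    also have "\<dots> = (if b = 0 then a else 0)"
    proof (cases "b = 0")
      case False
      then show ?thesis using elim(1) by (simp add: k_def)
    qed (use elim(1) in simp)
    finally show ?case by (simp add: b_def)
  qed
qed

text \<open>The product of \<open>FT f\<close> with \<open>cnj (w (\<pp> * \<xi>) * FT \<phi>0 (\<pp> * \<xi>))\<close> has this form, where \<open>A\<close> does not
  depend on the mask \<open>w\<close>.\<close>

abbreviation filtered :: "('a \<Rightarrow> complex) \<Rightarrow> ('a \<Rightarrow> complex) \<Rightarrow> 'a \<Rightarrow> complex" where
  "filtered w A \<equiv> \<lambda>\<xi>. cnj (w (\<pp> * \<xi>)) * A \<xi>"

text \<open>The masks enter the autocorrelation only through their values at \<open>\<pp> * \<xi>\<close> and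
  \<open>\<pp> * (\<xi> + u n)\<close>, so summation over the family leaves just the indices divisible by \<open>q\<close>.\<close>

lemma period_form_masks:
  assumes rel: "mask_relation I m m' a" and fin: "finite I" and masks: "\<And>l. l \<in> I \<Longrightarrow> is_mask M q chi u (m l)"
    and G: "\<And>l. l \<in> I \<Longrightarrow> filtered (m l) A \<in> L2 M"
    and H: "\<And>l. l \<in> I \<Longrightarrow> filtered (m' l) B \<in> L2 M"
    and A: "A \<in> borel_measurable M" and B: "B \<in> borel_measurable M"
  shows "(\<Sum>l\<in>I. period_form R (filtered (m l) A) (filtered (m' l) B))
    = (\<Sum>n<q ^ R. (if n mod q = 0 then a else 0) * (\<integral>\<xi>. A (\<xi> + u n) * cnj (B \<xi>) \<partial>M))"
proof -
  let ?f = "\<lambda>l n \<xi>. cnj (m l (\<pp> * (\<xi> + u n))) * A (\<xi> + u n) * cnj (cnj (m' l (\<pp> * \<xi>)) * B \<xi>)"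
  have int: "integrable M (?f l n)" if "l \<in> I" for l n
    by (rule L2_integrable_mult_cnj[OF L2_translate[OF G[OF that]] H[OF that]])
  have "(\<Sum>l\<in>I. period_form R (filtered (m l) A) (filtered (m' l) B))
      = (\<Sum>n<q ^ R. \<Sum>l\<in>I. \<integral>\<xi>. ?f l n \<xi> \<partial>M)"
    unfolding period_form_def by (rule sum.swap)
  also have "\<dots> = (\<Sum>n<q ^ R. (if n mod q = 0 then a else 0) * (\<integral>\<xi>. A (\<xi> + u n) * cnj (B \<xi>) \<partial>M))"
  proof (rule sum.cong[OF refl])
    fix n
    have shift: "AE \<xi> in M. (\<Sum>l\<in>I. cnj (m l (\<pp> * (\<xi> + u n))) * m' l (\<pp> * \<xi>)) = (if n mod q = 0 then a else 0)"
      by (rule mask_relation_shift[OF rel fin]) (rule masks)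
    have "(\<Sum>l\<in>I. \<integral>\<xi>. ?f l n \<xi> \<partial>M) = (\<integral>\<xi>. (\<Sum>l\<in>I. ?f l n \<xi>) \<partial>M)"
      by (rule Bochner_Integration.integral_sum[symmetric]) (rule int)
    also have "\<dots> = (\<integral>\<xi>. (if n mod q = 0 then a else 0) * (A (\<xi> + u n) * cnj (B \<xi>)) \<partial>M)"
    proof (rule integral_cong_AE)
      show "(\<lambda>\<xi>. \<Sum>l\<in>I. ?f l n \<xi>) \<in> borel_measurable M"
        using int by (intro borel_measurable_sum borel_measurable_integrable)
      show "(\<lambda>\<xi>. (if n mod q = 0 then a else 0) * (A (\<xi> + u n) * cnj (B \<xi>))) \<in> borel_measurable M"
        by (intro borel_measurable_times borel_measurable_cnj measurable_comp_translate[OF A] B) simp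
      show "AE \<xi> in M. (\<Sum>l\<in>I. ?f l n \<xi>) = (if n mod q = 0 then a else 0) * (A (\<xi> + u n) * cnj (B \<xi>))"
        using shift
      proof eventually_elim
        case (elim \<xi>)
        have "(\<Sum>l\<in>I. ?f l n \<xi>)
            = (\<Sum>l\<in>I. cnj (m l (\<pp> * (\<xi> + u n))) * m' l (\<pp> * \<xi>)) * (A (\<xi> + u n) * cnj (B \<xi>))"
          unfolding sum_distrib_right by (intro sum.cong refl) (simp add: mult_ac)
        then show ?case using elim by simp
      qed
    qed
    also have "\<dots> = (if n mod q = 0 then a else 0) * (\<integral>\<xi>. A (\<xi> + u n) * cnj (B \<xi>) \<partial>M)"
      by (rule integral_mult_right_zero)
    finally show "(\<Sum>l\<in>I. \<integral>\<xi>. ?f l n \<xi> \<partial>M) = (if n mod q = 0 then a else 0) * (\<integral>\<xi>. A (\<xi> + u n) * cnj (B \<xi>) \<partial>M)" .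
  qed
  finally show ?thesis .
qed

section \<open>Translates by representatives on the Fourier side\<close>

text \<open>\<open>g\<close> represents the Fourier transform of \<open>\<psi>\<close> as far as inner products of locally constant
  functions with the translates of \<open>\<psi>\<close> are concerned. This covers the wavelets, whose transforms
  are given as limits in \<open>L2 M\<close>, and the integrable scaling function, for which \<open>g\<close> is an integral,
  and it allows \<open>g\<close> to be changed on null sets.\<close>

definition transform_pair :: "('a \<Rightarrow> complex) \<Rightarrow> ('a \<Rightarrow> complex) \<Rightarrow> bool" where
  "transform_pair \<psi> g \<longleftrightarrow> g \<in> borel_measurable M \<and>
     (\<forall>k R f. step_fun k R f \<longrightarrow> (\<lambda>\<xi>. FT f \<xi> * cnj (g \<xi>)) \<in> L2 M \<and>
       (\<forall>i. L2_inner M f (\<lambda>x. \<psi> (x - u i)) = coef i (\<lambda>\<xi>. FT f \<xi> * cnj (g \<xi>))))"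

lemma transform_pairI:
  assumes \<psi>: "\<psi> \<in> borel_measurable M" and g: "g \<in> borel_measurable M"
    and L2: "\<And>k R f. step_fun k R f \<Longrightarrow> (\<lambda>\<xi>. FT f \<xi> * cnj (g \<xi>)) \<in> L2 M"
    and planch: "\<And>k R f. step_fun k R f \<Longrightarrow> L2_inner M (FT f) g = L2_inner M f \<psi>"
  shows "transform_pair \<psi> g"
  unfolding transform_pair_def
proof (intro conjI allI impI g)
  fix k R f assume f: "step_fun k R f"
  show "(\<lambda>\<xi>. FT f \<xi> * cnj (g \<xi>)) \<in> L2 M" by (rule L2[OF f])
  fix i
  note fm = step_fun_measurable[OF f]
  have "u i \<in> disc (max R (int i))"
    using u_in_disc[OF less_q_power] disc_mono[of "int i" "max R (int i)"] by auto
  then have f': "step_fun k (max R (int i)) (\<lambda>x. f (x + u i))"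
    using step_fun_mono[OF f, of k "max R (int i)"] by (intro step_fun_translate) auto
  have "L2_inner M f (\<lambda>x. \<psi> (x - u i)) = L2_inner M (\<lambda>x. f (x + u i)) \<psi>"
  proof -
    have "(\<lambda>x. \<psi> (x + - u i)) \<in> borel_measurable M" by (rule measurable_comp_translate[OF \<psi>])
    then have "(\<lambda>x. f x * cnj (\<psi> (x - u i))) \<in> borel_measurable M"
      by (intro borel_measurable_times borel_measurable_cnj fm) simp
    from integral_translate[OF this, of "u i"] show ?thesis by (simp add: L2_inner_def)
  qed
  also have "\<dots> = L2_inner M (FT (\<lambda>x. f (x + u i))) g" by (rule planch[OF f', symmetric])
  also have "FT (\<lambda>x. f (x + u i)) = (\<lambda>\<xi>. chi (u i * \<xi>) * FT f \<xi>)"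
    by (rule ext) (simp add: FT_translate[OF fm] mult.commute)
  also have "L2_inner M (\<lambda>\<xi>. chi (u i * \<xi>) * FT f \<xi>) g = coef i (\<lambda>\<xi>. FT f \<xi> * cnj (g \<xi>))"
    unfolding L2_inner_def coef_def by (simp only: mult_ac)
  finally show "L2_inner M f (\<lambda>x. \<psi> (x - u i)) = coef i (\<lambda>\<xi>. FT f \<xi> * cnj (g \<xi>))" .
qed

lemma transform_pair_has_fourier_transform:
  assumes g: "has_fourier_transform M chi \<psi> g" shows "transform_pair \<psi> g"
proof (rule transform_pairI)
  have L: "\<psi> \<in> L2 M" "g \<in> L2 M" using g unfolding has_fourier_transform_def by auto
  then show "\<psi> \<in> borel_measurable M" "g \<in> borel_measurable M" by (auto intro: L2_measurable)
  fix k R f assume f: "step_fun k R f"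
  show "L2_inner M (FT f) g = L2_inner M f \<psi>" by (rule plancherel[OF f g])
  obtain C where C: "\<forall>x. cmod (FT f x) \<le> C" using step_fun_bounded[OF FT_step[OF f]] ..
  show "(\<lambda>\<xi>. FT f \<xi> * cnj (g \<xi>)) \<in> L2 M"
    by (rule L2_mult_bounded[OF L2_cnj[OF L(2)] step_fun_measurable[OF FT_step[OF f]]]) (use C in auto)
qed

lemma transform_pair_integrable:
  assumes h: "integrable M h" shows "transform_pair h (FT h)"
proof (rule transform_pairI)
  show "h \<in> borel_measurable M" using h by auto
  show "FT h \<in> borel_measurable M" by (rule FT_measurable[OF h])
  fix k R f assume f: "step_fun k R f"
  show "L2_inner M (FT f) (FT h) = L2_inner M f h" by (rule plancherel_step[OF f h])
  have "(\<lambda>\<xi>. cnj (FT h \<xi>) * FT f \<xi>) \<in> L2 M"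
    by (rule L2_mult_bounded[OF step_fun_L2[OF FT_step[OF f]] borel_measurable_cnj[OF FT_measurable[OF h]]])
       (use FT_bound[OF h] in simp)
  then show "(\<lambda>\<xi>. FT f \<xi> * cnj (FT h \<xi>)) \<in> L2 M" by (simp only: mult.commute)
qed

lemma coef_cong_AE:
  assumes "G \<in> borel_measurable M" "H \<in> borel_measurable M" "AE x in M. G x = H x"
  shows "coef i G = coef i H"
  unfolding coef_def
  by (rule integral_cong_AE) (use assms in \<open>auto intro!: borel_measurable_times measurable_chi_mult_M\<close>)

lemma transform_pair_cong_AE:
  assumes g: "transform_pair \<psi> g" and g': "g' \<in> borel_measurable M" "AE \<xi> in M. g \<xi> = g' \<xi>"
  shows "transform_pair \<psi> g'"
  unfolding transform_pair_def
proof (intro conjI allI impI g'(1))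
  fix k R f assume f: "step_fun k R f"
  note fm = step_fun_measurable[OF FT_step[OF f]]
  have L: "(\<lambda>\<xi>. FT f \<xi> * cnj (g \<xi>)) \<in> L2 M" and c: "\<And>i. L2_inner M f (\<lambda>x. \<psi> (x - u i)) = coef i (\<lambda>\<xi>. FT f \<xi> * cnj (g \<xi>))"
    using g f unfolding transform_pair_def by blast+
  have m': "(\<lambda>\<xi>. FT f \<xi> * cnj (g' \<xi>)) \<in> borel_measurable M"
    by (intro borel_measurable_times borel_measurable_cnj fm g'(1))
  have ae: "AE \<xi> in M. FT f \<xi> * cnj (g \<xi>) = FT f \<xi> * cnj (g' \<xi>)" using g'(2) by eventually_elim simp
  show "(\<lambda>\<xi>. FT f \<xi> * cnj (g' \<xi>)) \<in> L2 M" by (rule L2_cong_AE[OF L m' ae])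
  show "L2_inner M f (\<lambda>x. \<psi> (x - u i)) = coef i (\<lambda>\<xi>. FT f \<xi> * cnj (g' \<xi>))" for i
    unfolding c by (rule coef_cong_AE[OF L2_measurable[OF L] m' ae])
qed

lemma transform_pair_supported:
  assumes "step_fun (- R) S f" shows "supported_in R (\<lambda>\<xi>. FT f \<xi> * cnj (g \<xi>))"
  using FT_step[OF assms] unfolding supported_in_def step_fun_def by auto

lemma transform_pair_has_sum:
  assumes g: "transform_pair \<psi> g" "transform_pair \<psi>' g'"
    and f: "step_fun (- int R) S f" "step_fun (- int R) S' f'"
  shows "((\<lambda>i. L2_inner M f (\<lambda>x. \<psi> (x - u i)) * cnj (L2_inner M f' (\<lambda>x. \<psi>' (x - u i))))
    has_sum period_form R (\<lambda>\<xi>. FT f \<xi> * cnj (g \<xi>)) (\<lambda>\<xi>. FT f' \<xi> * cnj (g' \<xi>))) UNIV"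
proof -
  have L: "(\<lambda>\<xi>. FT f \<xi> * cnj (g \<xi>)) \<in> L2 M" "(\<lambda>\<xi>. FT f' \<xi> * cnj (g' \<xi>)) \<in> L2 M"
    and eq: "\<And>i. L2_inner M f (\<lambda>x. \<psi> (x - u i)) = coef i (\<lambda>\<xi>. FT f \<xi> * cnj (g \<xi>))"
      "\<And>i. L2_inner M f' (\<lambda>x. \<psi>' (x - u i)) = coef i (\<lambda>\<xi>. FT f' \<xi> * cnj (g' \<xi>))"
    using g f unfolding transform_pair_def by blast+
  show ?thesis unfolding eq
    by (rule coef_has_sum[OF L(1) transform_pair_supported[OF f(1)] L(2) transform_pair_supported[OF f(2)]])
qed

definition energy :: "('a \<Rightarrow> complex) \<Rightarrow> ('a \<Rightarrow> complex) \<Rightarrow> real" where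
  "energy \<psi> f = (\<Sum>\<^sub>\<infinity>i. (cmod (L2_inner M f (\<lambda>x. \<psi> (x - u i))))\<^sup>2)"

lemma energy_period_form:
  assumes g: "transform_pair \<psi> g" and f: "step_fun (- int R) S f"
  shows "((\<lambda>i. (cmod (L2_inner M f (\<lambda>x. \<psi> (x - u i))))\<^sup>2) has_sum energy \<psi> f) UNIV"
    and "of_real (energy \<psi> f) = period_form R (\<lambda>\<xi>. FT f \<xi> * cnj (g \<xi>)) (\<lambda>\<xi>. FT f \<xi> * cnj (g \<xi>))"
proof -
  let ?h = "\<lambda>i. (cmod (L2_inner M f (\<lambda>x. \<psi> (x - u i))))\<^sup>2"
  let ?P = "period_form R (\<lambda>\<xi>. FT f \<xi> * cnj (g \<xi>)) (\<lambda>\<xi>. FT f \<xi> * cnj (g \<xi>))"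
  have 1: "((\<lambda>i. of_real (?h i)) has_sum ?P) UNIV"
    using transform_pair_has_sum[OF g g f f] by (simp only: complex_norm_square)
  have "(?h has_sum Re ?P) UNIV" using has_sum_Re[OF 1] by (simp only: Re_complex_of_real)
  then show 2: "(?h has_sum energy \<psi> f) UNIV" unfolding energy_def by (rule has_sum_infsum[OF has_sum_imp_summable])
  have "((\<lambda>i. of_real (?h i)) has_sum complex_of_real (energy \<psi> f)) UNIV"
    using has_sum_of_real[OF 2] .
  then show "of_real (energy \<psi> f) = ?P" using has_sum_unique[OF 1] by simp
qed

section \<open>Dilations\<close>

text \<open>The unitary dilation that moves the scale of a wavelet onto the function it is tested on.\<close>

definition dil :: "int \<Rightarrow> ('a \<Rightarrow> complex) \<Rightarrow> 'a \<Rightarrow> complex" where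
  "dil j f x = of_real (real q powr (- real_of_int j / 2)) * f (\<pp> powi j * x)"

lemma dil_dil: "dil i (dil j f) = dil (i + j) f"
proof
  fix x
  have "real q powr (- real_of_int i / 2) * real q powr (- real_of_int j / 2) = real q powr (- real_of_int (i + j) / 2)"
    by (simp add: powr_add[symmetric] field_simps)
  then have 1: "complex_of_real (real q powr (- real_of_int i / 2)) * of_real (real q powr (- real_of_int j / 2))
      = of_real (real q powr (- real_of_int (i + j) / 2))" by (metis of_real_mult)
  have "\<pp> powi j * (\<pp> powi i * x) = (\<pp> powi i * \<pp> powi j) * x" by (simp only: mult_ac)
  also have "\<pp> powi i * \<pp> powi j = \<pp> powi (i + j)" by (subst power_int_add) auto
  finally have 2: "\<pp> powi j * (\<pp> powi i * x) = \<pp> powi (i + j) * x" .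
  show "dil i (dil j f) x = dil (i + j) f x"
    unfolding dil_def 2 1[symmetric] by (rule mult.assoc[symmetric])
qed

lemma step_fun_dil: "step_fun k R f \<Longrightarrow> step_fun (k + j) (R + j) (dil j f)"
  unfolding dil_def[abs_def] by (intro step_fun_cmult step_fun_dilate)

lemma powi_eq_powr: "real q powi j = real q powr (real_of_int j)"
  using powr_real_of_int'[of "real q" j] by simp

lemma powr_half_square: "real q powr (- real_of_int j / 2) * real q powr (- real_of_int j / 2) = real q powi (- j)"
proof -
  have "real q powr (- real_of_int j / 2) * real q powr (- real_of_int j / 2) = real q powr (real_of_int (- j))"
    by (simp add: powr_add[symmetric])
  then show ?thesis by (simp only: powi_eq_powr)
qed

lemma L2_norm_dil: assumes "f \<in> L2 M" shows "L2_norm M (dil j f) = L2_norm M f"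
proof -
  have "(\<integral>x. (cmod (dil j f x))\<^sup>2 \<partial>M) = (\<integral>x. real q powi (- j) * (cmod (f (\<pp> powi j * x)))\<^sup>2 \<partial>M)"
    unfolding dil_def powr_half_square[symmetric]
    by (simp add: norm_mult power_mult_distrib power2_eq_square mult_ac)
  also have "\<dots> = real q powi (- j) * (real q powi j * (\<integral>x. (cmod (f x))\<^sup>2 \<partial>M))"
    using integral_dilate[of "\<lambda>x. (cmod (f x))\<^sup>2" j] L2_measurable[OF assms] by simp
  also have "\<dots> = (\<integral>x. (cmod (f x))\<^sup>2 \<partial>M)"
    by (simp add: power_int_minus)
  finally show ?thesis by (simp add: L2_norm_def)
qed

lemma FT_dil:
  assumes "f \<in> borel_measurable M"
  shows "FT (dil j f) \<xi> = of_real (real q powr (real_of_int j / 2)) * FT f (\<pp> powi (- j) * \<xi>)"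
proof -
  have "FT (dil j f) \<xi> = of_real (real q powr (- real_of_int j / 2)) * FT (\<lambda>x. f (\<pp> powi j * x)) \<xi>"
    unfolding fourier_integral_def dil_def by (simp add: mult.assoc)
  also have "\<dots> = of_real (real q powr (- real_of_int j / 2) * real q powi j) * FT f (\<pp> powi (- j) * \<xi>)"
    unfolding FT_dilate[OF assms] by (simp add: mult.assoc)
  also have "real q powr (- real_of_int j / 2) * real q powi j = real q powr (real_of_int j / 2)"
  proof -
    have "real q powi j = real q powr (real_of_int j)" by (rule powi_eq_powr)
    then show ?thesis by (simp add: powr_add[symmetric])
  qed
  finally show ?thesis .
qed

lemma wavelet_L2: assumes "\<psi> l \<in> L2 M" shows "wavelet q \<pp> u \<psi> (l, j, k) \<in> L2 M"
proof -
  have "(\<lambda>x. \<psi> l (x + - u k)) \<in> L2 M" by (rule L2_translate[OF assms])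
  from L2_dilate[OF this, of "- j"] show ?thesis
    unfolding wavelet_def by (simp add: L2_cmult)
qed

lemma inner_wavelet:
  assumes f: "f \<in> borel_measurable M" and \<psi>: "\<psi> l \<in> borel_measurable M"
  shows "L2_inner M f (wavelet q \<pp> u \<psi> (l, j, k)) = L2_inner M (dil j f) (\<lambda>x. \<psi> l (x - u k))"
proof -
  define F where "F = (\<lambda>x. f x * cnj (wavelet q \<pp> u \<psi> (l, j, k) x))"
  have "(\<lambda>x. \<psi> l (\<pp> powi (- j) * x + - u k)) \<in> borel_measurable M" by (rule measurable_comp_affine[OF \<psi>])
  then have "wavelet q \<pp> u \<psi> (l, j, k) \<in> borel_measurable M" unfolding wavelet_def by simp
  then have Fm: "F \<in> borel_measurable M"
    unfolding F_def by (intro borel_measurable_times borel_measurable_cnj f)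
  have "F (\<pp> powi j * x) = of_real (real q powi j) * (dil j f x * cnj (\<psi> l (x - u k)))" for x
  proof -
    have e1: "\<pp> powi (- j) * (\<pp> powi j * x) = x" by (simp only: mult.assoc[symmetric] pp_powi_inverse mult_1)
    have e2: "real q powr (real_of_int j / 2) = real q powi j * real q powr (- real_of_int j / 2)"
    proof -
      have "real q powi j = real q powr (real_of_int j)" by (rule powi_eq_powr)
      then show ?thesis by (simp add: powr_add[symmetric])
    qed
    show ?thesis unfolding F_def wavelet_def dil_def case_prod_conv e1 e2 by simp
  qed
  then have "(real q powi j) *\<^sub>R (\<integral>x. F x \<partial>M) = of_real (real q powi j) * L2_inner M (dil j f) (\<lambda>x. \<psi> l (x - u k))"
    using integral_dilate[OF Fm, of j] by (simp add: L2_inner_def)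
  then have "(\<integral>x. F x \<partial>M) = L2_inner M (dil j f) (\<lambda>x. \<psi> l (x - u k))"
    by (simp add: scaleR_conv_of_real)
  then show ?thesis by (simp add: F_def L2_inner_def)
qed

end

context local_field_setup
begin

lemma AE_neq: "AE x in M. x \<noteq> a"
proof (rule AE_I)
  have "emeasure M {a} \<le> ennreal (inverse (real q) ^ n)" for n
  proof -
    have "emeasure M {a} \<le> emeasure M (coset a (- int n))" by (intro emeasure_mono) auto
    then show ?thesis by (simp add: emeasure_coset power_int_minus power_inverse)
  qed
  moreover have "(\<lambda>n. ennreal (inverse (real q) ^ n)) \<longlonglongrightarrow> ennreal 0"
    using q_ge_2 by (intro tendsto_ennrealI LIMSEQ_power_zero) (auto simp: inverse_eq_divide)
  ultimately have "emeasure M {a} \<le> ennreal 0" by (intro LIMSEQ_le_const[of _ "ennreal 0"]) auto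
  then show "emeasure M {a} = 0" by simp
qed auto

text \<open>The neighbourhoods of the group of representatives of radius \<open>q powi (- n)\<close>; they shrink to that
  countable, hence null, set.\<close>

definition near_reps :: "nat \<Rightarrow> 'a set" where
  "near_reps n = (\<Union>i. coset (- u i) (- int n))"

lemma near_reps_iff: "x \<in> near_reps n \<longleftrightarrow> (\<exists>i. x + u i \<in> disc (- int n))"
  by (simp add: near_reps_def coset_def)

lemma near_reps_borel [measurable]: "near_reps n \<in> sets borel"
  unfolding near_reps_def by (intro sets.countable_UN) auto

lemma rep_unique: "x + u i \<in> disc (- int n) \<Longrightarrow> x + u j \<in> disc (- int m) \<Longrightarrow> i = j"
proof -
  assume "x + u i \<in> disc (- int n)" "x + u j \<in> disc (- int m)"
  then have "x + u i \<in> disc 0" "x + u j \<in> disc 0"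
    using disc_mono[of "- int n" 0] disc_mono[of "- int m" 0] by auto
  from disc_diff[OF this] show "i = j" by (simp add: u_eq_iff)
qed

lemma near_reps_eventually:
  assumes x: "\<And>i. x \<noteq> - u i" shows "\<forall>\<^sub>F n in sequentially. x \<notin> near_reps n"
proof (cases "\<exists>i. x + u i \<in> disc (- int 0)")
  case True
  then obtain i where i: "x + u i \<in> disc (- int 0)" by blast
  have "x + u i \<noteq> 0" using x[of i] by (simp add: add_eq_0_iff2)
  then obtain N where N: "x + u i \<notin> disc (- int N)" using disc_Inter by blast
  show ?thesis unfolding eventually_sequentially near_reps_iff
  proof (intro exI allI impI notI)
    fix n assume n: "N \<le> n" and "\<exists>i. x + u i \<in> disc (- int n)"
    then obtain j where j: "x + u j \<in> disc (- int n)" by blast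
    have "j = i" by (rule rep_unique[OF j i])
    then show False using j N disc_mono[of "- int n" "- int N"] n by auto
  qed
next
  case False
  have "x \<notin> near_reps n" for n
    unfolding near_reps_iff using False disc_mono[of "- int n" 0] by auto
  then show ?thesis by simp
qed

lemma near_reps_integral_tendsto:
  assumes h: "h \<in> L2 M"
  shows "(\<lambda>n. \<integral>x. indicator (near_reps n) x * (cmod (h x))\<^sup>2 \<partial>M) \<longlonglongrightarrow> 0"
proof -
  have hm [measurable]: "h \<in> borel_measurable M" by (rule L2_measurable[OF h])
  have "(\<lambda>n. \<integral>x. indicator (near_reps n) x * (cmod (h x))\<^sup>2 \<partial>M) \<longlonglongrightarrow> (\<integral>x. 0 \<partial>M)"
  proof (rule integral_dominated_convergence[where w = "\<lambda>x. (cmod (h x))\<^sup>2"])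
    show "integrable M (\<lambda>x. (cmod (h x))\<^sup>2)" by (rule L2_integrable_square[OF h])
    have "AE x in M. \<forall>i. x \<noteq> - u i" by (subst AE_all_countable) (use AE_neq in blast)
    then show "AE x in M. (\<lambda>n. indicator (near_reps n) x * (cmod (h x))\<^sup>2) \<longlonglongrightarrow> 0"
    proof eventually_elim
      case (elim x)
      then have "\<forall>\<^sub>F n in sequentially. x \<notin> near_reps n" by (intro near_reps_eventually) simp
      then have "\<forall>\<^sub>F n in sequentially. indicator (near_reps n) x * (cmod (h x))\<^sup>2 = 0"
        by eventually_elim simp
      then show ?case by (rule tendsto_eventually)
    qed
    show "AE x in M. norm (indicator (near_reps n) x * (cmod (h x))\<^sup>2) \<le> (cmod (h x))\<^sup>2" for n
      by (auto simp: indicator_def)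
  qed simp_all
  then show ?thesis by simp
qed

text \<open>If \<open>f\<close> lives in a disc of radius at most 1, then different translates of \<open>h\<close> are seen by \<open>f\<close>
  on disjoint sets, whose union is \<open>near_reps n\<close>.\<close>

lemma energy_small_support:
  assumes f: "f \<in> L2 M" "\<And>x. x \<notin> disc (- int n) \<Longrightarrow> f x = 0" and h: "h \<in> L2 M" and F: "finite F"
  shows "(\<Sum>i\<in>F. (cmod (L2_inner M f (\<lambda>x. h (x - u i))))\<^sup>2)
    \<le> (L2_norm M f)\<^sup>2 * (\<integral>x. indicator (near_reps n) x * (cmod (h x))\<^sup>2 \<partial>M)"
proof -
  have hm [measurable]: "h \<in> borel_measurable M" by (rule L2_measurable[OF h])
  define D where "D = disc (- int n)"
  have D [measurable]: "D \<in> sets borel" by (simp add: D_def)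
  have tr: "(\<lambda>x. indicator D (x + u i) * (cmod (h x))\<^sup>2) \<in> borel_measurable M" for i
  proof -
    have "(\<lambda>x. indicator D (x + u i) :: real) \<in> borel_measurable M"
      by (rule measurable_comp_translate[of "indicator D"]) simp
    then show ?thesis by simp
  qed
  have int: "integrable M (\<lambda>x. indicator D (x + u i) * (cmod (h x))\<^sup>2)" for i
    by (rule Bochner_Integration.integrable_bound[OF L2_integrable_square[OF h] tr]) (auto simp: indicator_def)
  have one: "(cmod (L2_inner M f (\<lambda>x. h (x - u i))))\<^sup>2
      \<le> (L2_norm M f)\<^sup>2 * (\<integral>x. indicator D (x + u i) * (cmod (h x))\<^sup>2 \<partial>M)" for i
  proof -
    define g where "g = (\<lambda>x. indicator D x * h (x + - u i))"
    have g: "g \<in> L2 M" unfolding g_def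
      by (rule L2_mult_bounded[OF L2_translate[OF h], where C = 1]) (auto simp: indicator_def)
    have "L2_inner M f (\<lambda>x. h (x - u i)) = L2_inner M f g"
      unfolding L2_inner_def
    proof (rule Bochner_Integration.integral_cong[OF refl])
      fix x show "f x * cnj (h (x - u i)) = f x * cnj (g x)"
        using f(2)[of x] by (cases "x \<in> D") (auto simp: g_def D_def)
    qed
    then have "cmod (L2_inner M f (\<lambda>x. h (x - u i))) \<le> L2_norm M f * L2_norm M g"
      using L2_Cauchy_Schwarz[OF f(1) g] by simp
    from power_mono[OF this, of 2]
    have "(cmod (L2_inner M f (\<lambda>x. h (x - u i))))\<^sup>2 \<le> (L2_norm M f)\<^sup>2 * (L2_norm M g)\<^sup>2"
      by (simp add: power_mult_distrib)
    also have "(L2_norm M g)\<^sup>2 = (\<integral>x. (cmod (g (x + u i)))\<^sup>2 \<partial>M)"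
      using L2_norm_translate[OF g, of "u i"] by (simp add: L2_norm_sq[symmetric])
    also have "\<dots> = (\<integral>x. indicator D (x + u i) * (cmod (h x))\<^sup>2 \<partial>M)"
      by (intro Bochner_Integration.integral_cong) (auto simp: g_def indicator_def)
    finally show ?thesis .
  qed
  have "(\<Sum>i\<in>F. (cmod (L2_inner M f (\<lambda>x. h (x - u i))))\<^sup>2)
      \<le> (\<Sum>i\<in>F. (L2_norm M f)\<^sup>2 * (\<integral>x. indicator D (x + u i) * (cmod (h x))\<^sup>2 \<partial>M))"
    by (intro sum_mono one)
  also have "\<dots> = (L2_norm M f)\<^sup>2 * (\<integral>x. (\<Sum>i\<in>F. indicator D (x + u i) * (cmod (h x))\<^sup>2) \<partial>M)"
    using int by (simp add: sum_distrib_left Bochner_Integration.integral_sum)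
  also have "\<dots> \<le> (L2_norm M f)\<^sup>2 * (\<integral>x. indicator (near_reps n) x * (cmod (h x))\<^sup>2 \<partial>M)"
  proof (intro mult_left_mono integral_mono)
    show "integrable M (\<lambda>x. \<Sum>i\<in>F. indicator D (x + u i) * (cmod (h x))\<^sup>2)"
      by (intro Bochner_Integration.integrable_sum int)
    show "integrable M (\<lambda>x. indicator (near_reps n) x * (cmod (h x))\<^sup>2)"
      by (rule Bochner_Integration.integrable_bound[OF L2_integrable_square[OF h]]) (auto simp: indicator_def)
    fix x
    have "(\<Sum>i\<in>F. indicator D (x + u i)) \<le> (indicator (near_reps n) x :: real)"
    proof (cases "\<exists>i. x + u i \<in> D")
      case True
      then obtain i0 where i0: "x + u i0 \<in> D" by blast
      have "(\<Sum>i\<in>F. indicator D (x + u i)) \<le> (\<Sum>i\<in>F. if i = i0 then 1 else 0 :: real)"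
      proof (rule sum_mono)
        fix i show "indicator D (x + u i) \<le> (if i = i0 then 1 else 0 :: real)"
        proof (cases "i = i0")
          case False
          then have "x + u i \<notin> D" using rep_unique[of x i n i0 n] i0 unfolding D_def by blast
          then show ?thesis by simp
        qed (simp add: indicator_def)
      qed
      also have "\<dots> \<le> 1" using F by simp
      also have "1 = (indicator (near_reps n) x :: real)"
        using i0 by (auto simp: indicator_def near_reps_iff D_def)
      finally show ?thesis .
    qed simp
    then show "(\<Sum>i\<in>F. indicator D (x + u i) * (cmod (h x))\<^sup>2) \<le> indicator (near_reps n) x * (cmod (h x))\<^sup>2"
      unfolding sum_distrib_right[symmetric] by (rule mult_right_mono) simp
  qed simp
  finally show ?thesis .
qed

lemma compactly_supported_disc:
  assumes h: "h \<in> L2 M" "compactly_supported M h"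
  obtains S where "supported_in (int S) h" "integrable M h"
proof -
  obtain C where C: "compact C" "AE x in M. x \<notin> C \<longrightarrow> h x = 0"
    using h unfolding compactly_supported_def by blast
  obtain S :: nat where S: "C \<subseteq> disc (int S)" using compact_subset_disc[OF C(1)] by blast
  have supp: "supported_in (int S) h"
    using C(2) unfolding supported_in_def by eventually_elim (use S in auto)
  have "integrable M (\<lambda>x. h x * indicator (coset 0 (int S)) x)"
    by (rule L2_integrable_mult[OF h(1) L2_indicator_coset])
  then have "integrable M h"
  proof (rule integrable_cong_AE_imp)
    show "h \<in> borel_measurable M" by (rule L2_measurable[OF h(1)])
    show "AE x in M. h x * indicator (coset 0 (int S)) x = h x"
      using supp unfolding supported_in_def by eventually_elim (auto simp: indicator_def)
  qed
  with supp show ?thesis by (rule that)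
qed

lemma sum_multiples_of_q:
  fixes h :: "nat \<Rightarrow> complex"
  shows "(\<Sum>n<q ^ Suc R. (if n mod q = 0 then 1 else 0) * h n) = (\<Sum>n<q ^ R. h (q * n))"
proof -
  have img: "{n \<in> {..<q ^ Suc R}. n mod q = 0} = (*) q ` {..<q ^ R}"
    by (auto simp: image_iff elim!: dvdE[of q] simp flip: dvd_eq_mod_eq_0)
  have "(\<Sum>n<q ^ Suc R. (if n mod q = 0 then 1 else 0) * h n) = (\<Sum>n\<in>{n \<in> {..<q ^ Suc R}. n mod q = 0}. h n)"
    by (subst sum.inter_filter) (auto intro!: sum.cong)
  also have "\<dots> = (\<Sum>n<q ^ R. h (q * n))"
    unfolding img by (subst sum.reindex) (auto simp: inj_on_def)
  finally show ?thesis .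
qed

end

section \<open>The extension principle for Parseval frames\<close>

locale extension_principle = local_field_setup M p c q \<pp> \<zeta> chi
  for M :: "'a::local_field measure" and p c q \<pp> \<zeta> chi +
  fixes L :: nat and \<phi>0 :: "'a \<Rightarrow> complex" and m \<psi> :: "nat \<Rightarrow> 'a \<Rightarrow> complex"
  assumes scaling_L2: "\<phi>0 \<in> L2 M"
    and scaling_compact: "compactly_supported M \<phi>0"
    and scaling_normalized: "fourier_integral M chi \<phi>0 0 = 1"
    and masks: "\<And>l. l \<le> L \<Longrightarrow> is_mask M q chi (coset_rep p c \<pp> \<zeta>) (m l)"
    and refinable: "AE \<xi> in M. fourier_integral M chi \<phi>0 \<xi> = m 0 (\<pp> * \<xi>) * fourier_integral M chi \<phi>0 (\<pp> * \<xi>)"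
    and unitary_masks: "mask_relation {..L} m m 1"
    and wavelets: "\<And>l. l \<in> {1..L} \<Longrightarrow>
      has_fourier_transform M chi (\<psi> l) (\<lambda>\<xi>. m l (\<pp> * \<xi>) * fourier_integral M chi \<phi>0 (\<pp> * \<xi>))"
begin

lemma scaling_integrable: "integrable M \<phi>0"
  using compactly_supported_disc[OF scaling_L2 scaling_compact] by metis

lemma scaling_pair: "transform_pair \<phi>0 (FT \<phi>0)"
  by (rule transform_pair_integrable[OF scaling_integrable])

lemma measurable_FT_scaling_pp: "(\<lambda>\<xi>. FT \<phi>0 (\<pp> * \<xi>)) \<in> borel_measurable M"
  by (rule measurable_comp_mult[OF FT_measurable[OF scaling_integrable]])

lemma refined_pair:
  assumes "l \<le> L"
  shows "transform_pair (if l = 0 then \<phi>0 else \<psi> l) (\<lambda>\<xi>. m l (\<pp> * \<xi>) * FT \<phi>0 (\<pp> * \<xi>))"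
proof (cases "l = 0")
  case True
  have "m 0 \<in> borel_measurable M" using masks[of 0] by (simp add: is_mask_def)
  then have "(\<lambda>\<xi>. m 0 (\<pp> * \<xi>) * FT \<phi>0 (\<pp> * \<xi>)) \<in> borel_measurable M"
    by (intro borel_measurable_times measurable_FT_scaling_pp measurable_comp_mult[of "m 0"])
  from transform_pair_cong_AE[OF scaling_pair this refinable] show ?thesis using True by simp
next
  case False
  then show ?thesis using transform_pair_has_fourier_transform[OF wavelets[of l]] assms by simp
qed

text \<open>The energies at one scale add up to the energy of the scaling function at the next finer
  scale. On the Fourier side every energy is a \<open>period_form\<close>; the sum over the masks is
  evaluated by \<open>period_form_masks\<close>, and the surviving shifts \<open>u (q * n) = inverse \<pp> * u n\<close> are
  those of the energy of \<open>dil 1 f\<close>.\<close>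

lemma refinement_identity:
  assumes f: "step_fun k S f"
  shows "energy \<phi>0 f + (\<Sum>l\<in>{1..L}. energy (\<psi> l) f) = energy \<phi>0 (dil 1 f)"
proof -
  \<comment> \<open>\<open>FT f\<close> lives in \<open>disc R\<close>, but indices with \<open>Suc R\<close> digits are summed at this scale: those that
    survive are the multiples \<open>q * n\<close>, where \<open>n\<close> has \<open>R\<close> digits, as required at the next scale.\<close>
  define R where "R = nat (- k)"
  have f1: "step_fun (- int (Suc R)) S f" using step_fun_mono[OF f, of "- int (Suc R)" S] by (simp add: R_def)
  have f2: "step_fun (- int R) (S + 1) (dil 1 f)" using step_fun_dil[OF f1, of 1] by simp
  have fm: "f \<in> borel_measurable M" by (rule step_fun_measurable[OF f])
  define \<eta> where "\<eta> = (\<lambda>l. if l = 0 then \<phi>0 else \<psi> l)"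
  define A where "A = (\<lambda>\<xi>. FT f \<xi> * cnj (FT \<phi>0 (\<pp> * \<xi>)))"
  have A: "A \<in> borel_measurable M" unfolding A_def
    by (intro borel_measurable_times borel_measurable_cnj step_fun_measurable[OF FT_step[OF f]] measurable_FT_scaling_pp)
  have Aeq: "FT f \<xi> * cnj (m l (\<pp> * \<xi>) * FT \<phi>0 (\<pp> * \<xi>)) = cnj (m l (\<pp> * \<xi>)) * A \<xi>" for l \<xi>
    by (simp add: A_def mult_ac)
  have pair: "transform_pair (\<eta> l) (\<lambda>\<xi>. m l (\<pp> * \<xi>) * FT \<phi>0 (\<pp> * \<xi>))" if "l \<le> L" for l
    using refined_pair[OF that] by (simp add: \<eta>_def)
  have GL: "filtered (m l) A \<in> L2 M" if "l \<le> L" for l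
  proof -
    have "(\<lambda>\<xi>. FT f \<xi> * cnj (m l (\<pp> * \<xi>) * FT \<phi>0 (\<pp> * \<xi>))) \<in> L2 M"
      using pair[OF that] f unfolding transform_pair_def by blast
    then show ?thesis unfolding Aeq .
  qed
  have "complex_of_real (\<Sum>l\<le>L. energy (\<eta> l) f) = (\<Sum>l\<le>L. of_real (energy (\<eta> l) f))"
    by (rule of_real_sum)
  also have "\<dots> = (\<Sum>l\<le>L. period_form (Suc R) (filtered (m l) A) (filtered (m l) A))"
  proof (rule sum.cong[OF refl])
    fix l assume "l \<in> {..L}"
    then have "l \<le> L" by simp
    from energy_period_form(2)[OF pair[OF this] f1]
    show "of_real (energy (\<eta> l) f) = period_form (Suc R) (filtered (m l) A) (filtered (m l) A)"
      unfolding Aeq .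
  qed
  also have "\<dots> = (\<Sum>n<q ^ Suc R. (if n mod q = 0 then 1 else 0) * (\<integral>\<xi>. A (\<xi> + u n) * cnj (A \<xi>) \<partial>M))"
    by (rule period_form_masks[OF unitary_masks]) (use masks GL A in auto)
  also have "\<dots> = (\<Sum>n<q ^ R. \<integral>\<xi>. A (\<xi> + u (q * n)) * cnj (A \<xi>) \<partial>M)"
    by (rule sum_multiples_of_q)
  also have "\<dots> = period_form R (\<lambda>\<xi>. FT (dil 1 f) \<xi> * cnj (FT \<phi>0 \<xi>)) (\<lambda>\<xi>. FT (dil 1 f) \<xi> * cnj (FT \<phi>0 \<xi>))"
    unfolding period_form_def
  proof (rule sum.cong[OF refl])
    fix n
    \<comment> \<open>Substitute \<open>\<xi> = \<pp> powi (- 1) * \<xi>'\<close>; the normalization of \<open>dil 1\<close> contributes \<open>r * r = q\<close>, which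
      cancels the Jacobian \<open>1 / q\<close>.\<close>
    define r where "r = real q powr (1 / 2)"
    have rr: "of_real r * cnj (of_real r) = (of_nat q :: complex)"
    proof -
      have "r * r = real q" unfolding r_def by (simp add: powr_add[symmetric])
      then show ?thesis by (metis complex_cnj_complex_of_real of_real_mult of_real_of_nat_eq)
    qed
    have G: "FT (dil 1 f) \<xi> * cnj (FT \<phi>0 \<xi>) = of_real r * A (\<pp> powi (- 1) * \<xi>)" for \<xi>
    proof -
      have e: "\<pp> * (\<pp> powi (- 1) * \<xi>) = \<xi>" by (simp add: power_int_minus mult.assoc[symmetric])
      show ?thesis unfolding FT_dil[OF fm] A_def r_def e by simp
    qed
    have sh: "\<pp> powi (- 1) * (\<xi> + u n) = \<pp> powi (- 1) * \<xi> + u (q * n)" for \<xi>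
      by (simp add: u_mult_q distrib_left power_int_minus)
    define B where "B = (\<lambda>\<xi>. A (\<xi> + u (q * n)) * cnj (A \<xi>))"
    have B: "B \<in> borel_measurable M"
      unfolding B_def by (intro borel_measurable_times borel_measurable_cnj measurable_comp_translate[OF A] A)
    have "(\<integral>\<xi>. FT (dil 1 f) (\<xi> + u n) * cnj (FT \<phi>0 (\<xi> + u n)) * cnj (FT (dil 1 f) \<xi> * cnj (FT \<phi>0 \<xi>)) \<partial>M)
        = (\<integral>\<xi>. (of_real r * cnj (of_real r)) * B (\<pp> powi (- 1) * \<xi>) \<partial>M)"
      unfolding G sh B_def by (simp add: mult_ac)
    also have "\<dots> = of_nat q * (\<integral>\<xi>. B (\<pp> powi (- 1) * \<xi>) \<partial>M)"
      unfolding rr by (rule integral_mult_right_zero)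
    also have "\<dots> = (\<integral>\<xi>. B \<xi> \<partial>M)"
      unfolding integral_dilate[OF B] by (simp add: power_int_minus scaleR_conv_of_real)
    finally show "(\<integral>\<xi>. A (\<xi> + u (q * n)) * cnj (A \<xi>) \<partial>M)
        = (\<integral>\<xi>. FT (dil 1 f) (\<xi> + u n) * cnj (FT \<phi>0 (\<xi> + u n)) * cnj (FT (dil 1 f) \<xi> * cnj (FT \<phi>0 \<xi>)) \<partial>M)"
      by (simp only: B_def)
  qed
  also have "\<dots> = of_real (energy \<phi>0 (dil 1 f))"
    by (rule energy_period_form(2)[OF scaling_pair f2, symmetric])
  finally have "(\<Sum>l\<le>L. energy (\<eta> l) f) = energy \<phi>0 (dil 1 f)" by (simp only: of_real_eq_iff)
  moreover have "{..L} = insert 0 {1..L}" by auto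
  then have "(\<Sum>l\<le>L. energy (\<eta> l) f) = energy \<phi>0 f + (\<Sum>l\<in>{1..L}. energy (\<psi> l) f)"
    by (simp add: \<eta>_def)
  ultimately show ?thesis by simp
qed

text \<open>\<open>FT \<phi>0\<close> is locally constant, because \<open>\<phi>0\<close> has compact support, and equals 1 at 0, so it
  equals 1 on a disc. On functions with transform in that disc, and in \<open>disc 0\<close>, the energy is
  the norm by Plancherel's theorem.\<close>

lemma energy_large_scale:
  assumes f: "step_fun k S f"
  shows "\<forall>\<^sub>F J in sequentially. energy \<phi>0 (dil (int J) f) = (L2_norm M f)\<^sup>2"
proof -
  obtain N where N: "supported_in (int N) \<phi>0" using compactly_supported_disc[OF scaling_L2 scaling_compact] by metis
  have one: "FT \<phi>0 \<xi> = 1" if "\<xi> \<in> disc (- int N)" for \<xi>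
    using FT_periodic[OF L2_measurable[OF scaling_L2] N[unfolded supported_in_def] that, of 0] scaling_normalized by simp
  show ?thesis unfolding eventually_sequentially
  proof (intro exI allI impI)
    fix J assume "nat (int N - k) \<le> J"
    then have J: "k + int J \<ge> int N" by simp
    have st: "step_fun (k + int J) (S + int J) (dil (int J) f)" by (rule step_fun_dil[OF f])
    have st0: "step_fun (- int 0) (S + int J) (dil (int J) f)"
      by (rule step_fun_mono[OF st]) (use J in auto)
    let ?F = "FT (dil (int J) f)"
    \<comment> \<open>From this scale on, the transform of the dilate lives where \<open>FT \<phi>0 = 1\<close>.\<close>
    have F: "?F \<xi> * cnj (FT \<phi>0 \<xi>) = ?F \<xi>" for \<xi>
    proof (cases "\<xi> \<in> disc (- int N)")
      case False
      then have "\<xi> \<notin> disc (- (k + int J))" using disc_mono[of "- (k + int J)" "- int N"] J by auto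
      then show ?thesis using FT_step[OF st] by (simp add: step_fun_def)
    qed (simp add: one)
    have "of_real (energy \<phi>0 (dil (int J) f)) = period_form 0 ?F ?F"
      using energy_period_form(2)[OF scaling_pair st0] unfolding F .
    also have "\<dots> = L2_inner M ?F ?F" by (simp add: period_form_def L2_inner_def)
    also have "\<dots> = of_real ((L2_norm M f)\<^sup>2)"
      unfolding L2_inner_self FT_step_L2_norm[OF st] L2_norm_dil[OF step_fun_L2[OF f]] ..
    finally show "energy \<phi>0 (dil (int J) f) = (L2_norm M f)\<^sup>2" by (simp only: of_real_eq_iff)
  qed
qed

lemma energy_nonneg: "0 \<le> energy h f"
  unfolding energy_def by (rule infsum_nonneg) simp

text \<open>Dilation in the other direction shrinks the support of \<open>f\<close>, so \<open>energy_small_support\<close> bounds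
  the energy by integrals over the shrinking sets \<open>near_reps n\<close>.\<close>

lemma energy_small_scale:
  assumes f: "step_fun k S f"
  shows "(\<lambda>J. energy \<phi>0 (dil (- int J) f)) \<longlonglongrightarrow> 0"
proof (rule LIMSEQ_offset)
  define r where "r = nat S"
  have f': "step_fun k (int r) f" by (rule step_fun_mono[OF f]) (auto simp: r_def)
  let ?g = "\<lambda>n. \<integral>x. indicator (near_reps n) x * (cmod (\<phi>0 x))\<^sup>2 \<partial>M"
  have bound: "energy \<phi>0 (dil (- int (n + r)) f) \<le> (L2_norm M f)\<^sup>2 * ?g n" for n
  proof -
    have st: "step_fun (k + - int (n + r)) (int r + - int (n + r)) (dil (- int (n + r)) f)"
      by (rule step_fun_dil[OF f'])
    have supp: "dil (- int (n + r)) f x = 0" if "x \<notin> disc (- int n)" for x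
      using st that by (simp add: step_fun_def)
    have st2: "step_fun (- int (nat (int (n + r) - k))) (int r) (dil (- int (n + r)) f)"
      by (rule step_fun_mono[OF st]) auto
    show ?thesis
    proof (rule has_sum_le_finite_sums[OF energy_period_form(1)[OF scaling_pair st2]])
      fix F :: "nat set" assume "finite F"
      from energy_small_support[OF step_fun_L2[OF st] supp scaling_L2 this]
      show "(\<Sum>i\<in>F. (cmod (L2_inner M (dil (- int (n + r)) f) (\<lambda>x. \<phi>0 (x - u i))))\<^sup>2) \<le> (L2_norm M f)\<^sup>2 * ?g n"
        unfolding L2_norm_dil[OF step_fun_L2[OF f]] .
    qed
  qed
  show "(\<lambda>n. energy \<phi>0 (dil (- int (n + r)) f)) \<longlonglongrightarrow> 0"
  proof (rule tendsto_sandwich[OF _ _ tendsto_const])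
    show "(\<lambda>n. (L2_norm M f)\<^sup>2 * ?g n) \<longlonglongrightarrow> 0"
      by (rule tendsto_mult_right_zero[OF near_reps_integral_tendsto[OF scaling_L2]])
    show "\<forall>\<^sub>F n in sequentially. 0 \<le> energy \<phi>0 (dil (- int (n + r)) f)"
      by (simp add: energy_nonneg)
    show "\<forall>\<^sub>F n in sequentially. energy \<phi>0 (dil (- int (n + r)) f) \<le> (L2_norm M f)\<^sup>2 * ?g n"
      by (intro always_eventually allI bound)
  qed
qed

lemma telescope_int:
  fixes Q :: "int \<Rightarrow> real"
  shows "(\<Sum>j\<in>{- int J..<int J}. Q (1 + j) - Q j) = Q (int J) - Q (- int J)"
proof (induction J)
  case (Suc J)
  have "{- int (Suc J)..<int (Suc J)} = insert (- int (Suc J)) (insert (int J) {- int J..<int J})" by auto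
  then show ?case using Suc by simp
qed simp

lemma wavelet_L2': "i \<in> wavelet_index L \<Longrightarrow> wavelet q \<pp> u \<psi> i \<in> L2 M"
  using wavelets by (cases i) (auto simp: wavelet_index_def has_fourier_transform_def intro!: wavelet_L2)

lemma wavelet_index_exhaust:
  "incseq (\<lambda>J. {1..L} \<times> {- int J..<int J} \<times> (UNIV :: nat set))"
  "(\<Union>J. {1..L} \<times> {- int J..<int J} \<times> (UNIV :: nat set)) = wavelet_index L"
proof -
  show "incseq (\<lambda>J. {1..L} \<times> {- int J..<int J} \<times> (UNIV :: nat set))"
    by (intro monoI) auto
  have "\<exists>J. j \<in> {- int J..<int J}" for j by (rule exI[of _ "nat (\<bar>j\<bar> + 1)"]) auto
  then show "(\<Union>J. {1..L} \<times> {- int J..<int J} \<times> (UNIV :: nat set)) = wavelet_index L"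
    unfolding wavelet_index_def by blast
qed

text \<open>Telescoping \<open>refinement_identity\<close> over the scales \<open>- J \<le> j < J\<close> leaves a difference of two
  energies of the scaling function, which tend to the squared norm and to 0.\<close>

theorem parseval_step:
  assumes f: "step_fun k S f"
  shows "((\<lambda>i. (cmod (L2_inner M f (wavelet q \<pp> u \<psi> i)))\<^sup>2) has_sum (L2_norm M f)\<^sup>2) (wavelet_index L)"
proof (rule has_sum_exhaust_nonneg[OF _ wavelet_index_exhaust])
  define Q where "Q = (\<lambda>j. energy \<phi>0 (dil j f))"
  have \<psi>m: "\<psi> l \<in> borel_measurable M" if "l \<in> {1..L}" for l
    using wavelets[OF that] by (auto simp: has_fourier_transform_def intro: L2_measurable)
  have one: "((\<lambda>k. (cmod (L2_inner M f (wavelet q \<pp> u \<psi> (l, j, k))))\<^sup>2) has_sum energy (\<psi> l) (dil j f)) UNIV"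
    if l: "l \<in> {1..L}" for l j
  proof -
    have st: "step_fun (- int (nat (- (k + j)))) (S + j) (dil j f)"
      by (rule step_fun_mono[OF step_fun_dil[OF f]]) auto
    show ?thesis unfolding inner_wavelet[of f \<psi> l, OF step_fun_measurable[OF f] \<psi>m[OF l]]
      by (rule energy_period_form(1)[OF transform_pair_has_fourier_transform[OF wavelets[OF l]] st])
  qed
  show "((\<lambda>i. (cmod (L2_inner M f (wavelet q \<pp> u \<psi> i)))\<^sup>2) has_sum (Q (int J) - Q (- int J)))
      ({1..L} \<times> {- int J..<int J} \<times> UNIV)" for J
  proof -
    have "(\<Sum>l\<in>{1..L}. energy (\<psi> l) (dil j f)) = Q (1 + j) - Q j" for j
      using refinement_identity[OF step_fun_dil[OF f, of j]] by (simp add: Q_def dil_dil)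
    then have "(\<Sum>j\<in>{- int J..<int J}. \<Sum>l\<in>{1..L}. energy (\<psi> l) (dil j f)) = Q (int J) - Q (- int J)"
      by (simp only: telescope_int)
    moreover have "((\<lambda>i. (cmod (L2_inner M f (wavelet q \<pp> u \<psi> i)))\<^sup>2)
        has_sum (\<Sum>j\<in>{- int J..<int J}. \<Sum>l\<in>{1..L}. energy (\<psi> l) (dil j f)))
        ({1..L} \<times> {- int J..<int J} \<times> UNIV)"
      by (rule has_sum_finite_fibers) (use one in auto)
    ultimately show ?thesis by simp
  qed
  have "(\<lambda>J. Q (int J)) \<longlonglongrightarrow> (L2_norm M f)\<^sup>2"
    unfolding Q_def by (rule tendsto_eventually[OF energy_large_scale[OF f]])
  from tendsto_diff[OF this energy_small_scale[OF f, folded Q_def]]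
  show "(\<lambda>J. Q (int J) - Q (- int J)) \<longlonglongrightarrow> (L2_norm M f)\<^sup>2" by (simp add: Q_def)
qed simp

sublocale L2_family M "{f. \<exists>k R. step_fun k R f}" "wavelet_index L" "wavelet q \<pp> u \<psi>"
proof
  show "s \<in> L2 M" if "s \<in> {f. \<exists>k R. step_fun k R f}" for s using that step_fun_L2 by blast
  show "\<exists>s\<in>{f. \<exists>k R. step_fun k R f}. L2_norm M (\<lambda>x. f x - s x) < \<epsilon>" if "f \<in> L2 M" "\<epsilon> > 0" for f \<epsilon>
    using that step_approx_L2_iff[of f] unfolding step_approx_def by blast
  show "wavelet q \<pp> u \<psi> i \<in> L2 M" if "i \<in> wavelet_index L" for i by (rule wavelet_L2'[OF that])
  show "((\<lambda>i. (cmod (L2_inner M s (wavelet q \<pp> u \<psi> i)))\<^sup>2) has_sum (L2_norm M s)\<^sup>2) (wavelet_index L)"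
    if "s \<in> {f. \<exists>k R. step_fun k R f}" for s using that parseval_step by blast
qed

theorem parseval_frame: "parseval_wavelet_frame M q \<pp> u L \<psi>"
  unfolding parseval_wavelet_frame_def
proof (intro conjI ballI)
  show "\<psi> l \<in> L2 M" if "l \<in> {1..L}" for l using wavelets[OF that] by (simp add: has_fourier_transform_def)
  show "((\<lambda>i. (cmod (L2_inner M f (wavelet q \<pp> u \<psi> i)))\<^sup>2) has_sum (L2_norm M f)\<^sup>2) (wavelet_index L)"
    if "f \<in> L2 M" for f by (rule parseval[OF that])
qed

end

section \<open>Orthogonality of two systems\<close>

locale orthogonal_extension_pair =
  X: extension_principle M p c q \<pp> \<zeta> chi L \<phi>0 m \<psi> + Y: extension_principle M p c q \<pp> \<zeta> chi L \<phi>0' m' \<phi>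
  for M :: "'a::local_field measure" and p c q \<pp> \<zeta> chi L \<phi>0 m \<psi> \<phi>0' m' \<phi> +
  assumes mixed_masks: "local_field_setup.mask_relation M p c q \<pp> \<zeta> {1..L} m m' 0"
begin

text \<open>The same computation as in \<open>refinement_identity\<close>, with \<open>a = 0\<close>: already the sum over the
  wavelets at a single scale vanishes.\<close>

lemma orthogonal_scale:
  assumes s: "X.step_fun k S s" and t: "X.step_fun k' S' t"
  obtains v where "\<And>l. l \<in> {1..L} \<Longrightarrow> ((\<lambda>i. L2_inner M s (\<lambda>x. \<psi> l (x - X.u i)) * cnj (L2_inner M t (\<lambda>x. \<phi> l (x - X.u i))))
      has_sum v l) UNIV" "(\<Sum>l\<in>{1..L}. v l) = 0"
proof -
  define R where "R = nat (max (- k) (- k'))"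
  have s1: "X.step_fun (- int R) S s" by (rule X.step_fun_mono[OF s]) (auto simp: R_def)
  have t1: "X.step_fun (- int R) S' t" by (rule X.step_fun_mono[OF t]) (auto simp: R_def)
  define A where "A = (\<lambda>\<xi>. X.FT s \<xi> * cnj (X.FT \<phi>0 (\<pp> * \<xi>)))"
  define B where "B = (\<lambda>\<xi>. X.FT t \<xi> * cnj (X.FT \<phi>0' (\<pp> * \<xi>)))"
  have A: "A \<in> borel_measurable M" unfolding A_def
    by (intro borel_measurable_times borel_measurable_cnj X.step_fun_measurable[OF X.FT_step[OF s]] X.measurable_FT_scaling_pp)
  have B: "B \<in> borel_measurable M" unfolding B_def
    by (intro borel_measurable_times borel_measurable_cnj X.step_fun_measurable[OF X.FT_step[OF t]] Y.measurable_FT_scaling_pp)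
  have Aeq: "X.FT s \<xi> * cnj (m l (\<pp> * \<xi>) * X.FT \<phi>0 (\<pp> * \<xi>)) = cnj (m l (\<pp> * \<xi>)) * A \<xi>" for l \<xi>
    by (simp add: A_def mult_ac)
  have Beq: "X.FT t \<xi> * cnj (m' l (\<pp> * \<xi>) * X.FT \<phi>0' (\<pp> * \<xi>)) = cnj (m' l (\<pp> * \<xi>)) * B \<xi>" for l \<xi>
    by (simp add: B_def mult_ac)
  note pX = X.transform_pair_has_fourier_transform[OF X.wavelets]
  note pY = X.transform_pair_has_fourier_transform[OF Y.wavelets]
  have GA: "X.filtered (m l) A \<in> L2 M" if "l \<in> {1..L}" for l
  proof -
    have "(\<lambda>\<xi>. X.FT s \<xi> * cnj (m l (\<pp> * \<xi>) * X.FT \<phi>0 (\<pp> * \<xi>))) \<in> L2 M"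
      using pX[OF that] s unfolding X.transform_pair_def by blast
    then show ?thesis unfolding Aeq .
  qed
  have GB: "X.filtered (m' l) B \<in> L2 M" if "l \<in> {1..L}" for l
  proof -
    have "(\<lambda>\<xi>. X.FT t \<xi> * cnj (m' l (\<pp> * \<xi>) * X.FT \<phi>0' (\<pp> * \<xi>))) \<in> L2 M"
      using pY[OF that] t unfolding X.transform_pair_def by blast
    then show ?thesis unfolding Beq .
  qed
  show ?thesis
  proof (rule that[of "\<lambda>l. X.period_form R (X.filtered (m l) A) (X.filtered (m' l) B)"])
    fix l assume l: "l \<in> {1..L}"
    show "((\<lambda>i. L2_inner M s (\<lambda>x. \<psi> l (x - X.u i)) * cnj (L2_inner M t (\<lambda>x. \<phi> l (x - X.u i))))
      has_sum X.period_form R (X.filtered (m l) A) (X.filtered (m' l) B)) UNIV"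
      using X.transform_pair_has_sum[OF pX[OF l] pY[OF l] s1 t1] unfolding Aeq Beq .
  next
    have "(\<Sum>l\<in>{1..L}. X.period_form R (X.filtered (m l) A) (X.filtered (m' l) B))
      = (\<Sum>n<q ^ R. (if n mod q = 0 then 0 else 0) * (\<integral>\<xi>. A (\<xi> + X.u n) * cnj (B \<xi>) \<partial>M))"
      by (rule X.period_form_masks[OF mixed_masks]) (use X.masks GA GB A B in auto)
    then show "(\<Sum>l\<in>{1..L}. X.period_form R (X.filtered (m l) A) (X.filtered (m' l) B)) = 0"
      by simp
  qed
qed

text \<open>The series is dominated by the two Parseval series, so it converges absolutely and may be
  summed scale by scale.\<close>

lemma orthogonal_step:
  assumes s: "X.step_fun k S s" and t: "X.step_fun k' S' t"
  shows "((\<lambda>i. L2_inner M s (wavelet q \<pp> X.u \<psi> i) * cnj (L2_inner M t (wavelet q \<pp> X.u \<phi> i))) has_sum 0)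
    (wavelet_index L)"
proof -
  let ?g = "\<lambda>i. L2_inner M s (wavelet q \<pp> X.u \<psi> i) * cnj (L2_inner M t (wavelet q \<pp> X.u \<phi> i))"
  have "(\<lambda>i. cmod (?g i)) summable_on wavelet_index L"
  proof (rule summable_on_comparison_test)
    show "(\<lambda>i. (cmod (L2_inner M s (wavelet q \<pp> X.u \<psi> i)))\<^sup>2 + (cmod (L2_inner M t (wavelet q \<pp> X.u \<phi> i)))\<^sup>2)
        summable_on wavelet_index L"
      using X.parseval_step[OF s] Y.parseval_step[OF t] by (intro summable_on_add) (auto simp: summable_on_def)
    show "cmod (?g i) \<le> (cmod (L2_inner M s (wavelet q \<pp> X.u \<psi> i)))\<^sup>2
        + (cmod (L2_inner M t (wavelet q \<pp> X.u \<phi> i)))\<^sup>2" for i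
      by (simp add: norm_mult mult_le_sum_squares)
  qed simp
  then have "?g summable_on wavelet_index L" by (rule abs_summable_summable)
  then obtain T where T: "(?g has_sum T) (wavelet_index L)" by (auto simp: summable_on_def)
  have zero: "(?g has_sum 0) ({1..L} \<times> {- int J..<int J} \<times> UNIV)" for J
  proof -
    have ex: "\<exists>v. (\<forall>l\<in>{1..L}. ((\<lambda>i. ?g (l, j, i)) has_sum v l) UNIV) \<and> (\<Sum>l\<in>{1..L}. v l) = 0" for j
    proof -
      obtain v where v: "\<And>l. l \<in> {1..L} \<Longrightarrow>
          ((\<lambda>i. L2_inner M (X.dil j s) (\<lambda>x. \<psi> l (x - X.u i)) * cnj (L2_inner M (X.dil j t) (\<lambda>x. \<phi> l (x - X.u i))))
            has_sum v l) UNIV" "(\<Sum>l\<in>{1..L}. v l) = 0"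
        using orthogonal_scale[OF X.step_fun_dil[OF s, of j] X.step_fun_dil[OF t, of j]] by blast
      have "((\<lambda>i. ?g (l, j, i)) has_sum v l) UNIV" if l: "l \<in> {1..L}" for l
      proof -
        have "\<psi> l \<in> borel_measurable M" "\<phi> l \<in> borel_measurable M"
          using X.wavelets[OF l] Y.wavelets[OF l] by (auto simp: has_fourier_transform_def intro: L2_measurable)
        then show ?thesis
          unfolding X.inner_wavelet[of s \<psi> l, OF X.step_fun_measurable[OF s] \<open>\<psi> l \<in> borel_measurable M\<close>]
            X.inner_wavelet[of t \<phi> l, OF X.step_fun_measurable[OF t] \<open>\<phi> l \<in> borel_measurable M\<close>]
          by (intro v(1) l)
      qed
      then show ?thesis using v(2) by (intro exI[of _ v] conjI ballI)
    qed
    have "\<exists>v. \<forall>j. (\<forall>l\<in>{1..L}. ((\<lambda>i. ?g (l, j, i)) has_sum v j l) UNIV) \<and> (\<Sum>l\<in>{1..L}. v j l) = 0"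
      by (rule choice) (rule allI, rule ex)
    then obtain v where
      "\<forall>j. (\<forall>l\<in>{1..L}. ((\<lambda>i. ?g (l, j, i)) has_sum v j l) UNIV) \<and> (\<Sum>l\<in>{1..L}. v j l) = 0" ..
    then have v: "\<And>j l. l \<in> {1..L} \<Longrightarrow> ((\<lambda>i. ?g (l, j, i)) has_sum v j l) UNIV"
        "\<And>j. (\<Sum>l\<in>{1..L}. v j l) = 0" by simp_all
    have "(?g has_sum (\<Sum>j\<in>{- int J..<int J}. \<Sum>l\<in>{1..L}. v j l)) ({1..L} \<times> {- int J..<int J} \<times> UNIV)"
      by (rule has_sum_finite_fibers) (use v(1) in auto)
    then show ?thesis by (simp only: v(2) sum.neutral_const)
  qed
  have "(\<lambda>J::nat. 0) \<longlonglongrightarrow> T" by (rule has_sum_exhaust[OF T X.wavelet_index_exhaust zero])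
  then have "T = 0" by (simp add: LIMSEQ_const_iff)
  then show ?thesis using T by simp
qed

theorem orthogonal_systems: "orthogonal_wavelet_systems M q \<pp> X.u L \<psi> \<phi>"
proof -
  interpret L2_family_pair M "{f. \<exists>k R. X.step_fun k R f}" "wavelet_index L" "wavelet q \<pp> X.u \<psi>" "wavelet q \<pp> X.u \<phi>"
  proof
    show "((\<lambda>i. L2_inner M s (wavelet q \<pp> X.u \<psi> i) * cnj (L2_inner M t (wavelet q \<pp> X.u \<phi> i))) has_sum 0)
        (wavelet_index L)"
      if "s \<in> {f. \<exists>k R. X.step_fun k R f}" "t \<in> {f. \<exists>k R. X.step_fun k R f}" for s t
      using that orthogonal_step by blast
  qed
  show ?thesis unfolding orthogonal_wavelet_systems_def
  proof (intro conjI ballI)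
    show "\<psi> l \<in> L2 M" "\<phi> l \<in> L2 M" if "l \<in> {1..L}" for l
      using X.wavelets[OF that] Y.wavelets[OF that] by (auto simp: has_fourier_transform_def)
    show "((\<lambda>F. L2_norm M (\<lambda>x. \<Sum>i\<in>F. L2_inner M f (wavelet q \<pp> X.u \<psi> i) * wavelet q \<pp> X.u \<phi> i x)) \<longlongrightarrow> 0)
        (finite_subsets_at_top (wavelet_index L))" if "f \<in> L2 M" for f
      by (rule synthesis_tendsto_zero[OF that])
  qed
qed

end

section \<open>The matrix conditions\<close>

lemma mask_matrix_dim: "mask_matrix m L s \<xi> \<in> carrier_mat (L + 1) 2" "mask_matrix0 m L s \<xi> \<in> carrier_mat L 2"
  by (auto simp: mask_matrix_def mask_matrix0_def)

lemma adjoint_mult_index: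
  fixes A B :: "complex Matrix.mat"
  assumes "A \<in> carrier_mat n 2" "B \<in> carrier_mat n 2" "i < 2" "j < 2"
  shows "(mat_adjoint A * B) $$ (i, j) = (\<Sum>l<n. cnj (A $$ (l, i)) * B $$ (l, j))"
  using assms
  by (simp add: scalar_prod_def mat_adjoint_def mat_of_rows_def lessThan_atLeast0)

lemma unitary_columns:
  assumes "mat_adjoint (mask_matrix m L s \<xi>) * mask_matrix m L s \<xi> = 1\<^sub>m 2"
  shows "(\<Sum>l\<le>L. cnj (m l \<xi>) * m l \<xi>) = 1" "(\<Sum>l\<le>L. cnj (m l (\<xi> + s)) * m l \<xi>) = 0"
proof -
  note i = adjoint_mult_index[OF mask_matrix_dim(1) mask_matrix_dim(1)]
  have "(\<Sum>l<L + 1. cnj (mask_matrix m L s \<xi> $$ (l, 0)) * mask_matrix m L s \<xi> $$ (l, 0)) = 1"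
    using arg_cong[OF assms, of "\<lambda>A. A $$ (0, 0)"] by (subst i[symmetric]) auto
  then show "(\<Sum>l\<le>L. cnj (m l \<xi>) * m l \<xi>) = 1" by (simp add: mask_matrix_def lessThan_Suc_atMost[symmetric])
  have "(\<Sum>l<L + 1. cnj (mask_matrix m L s \<xi> $$ (l, 1)) * mask_matrix m L s \<xi> $$ (l, 0)) = 0"
    using arg_cong[OF assms, of "\<lambda>A. A $$ (1, 0)"] by (subst i[symmetric]) auto
  then show "(\<Sum>l\<le>L. cnj (m l (\<xi> + s)) * m l \<xi>) = 0" by (simp add: mask_matrix_def lessThan_Suc_atMost[symmetric])
qed

lemma orthogonal_columns:
  assumes "mat_adjoint (mask_matrix0 m L s \<xi>) * mask_matrix0 m' L s \<xi> = 0\<^sub>m 2 2"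
  shows "(\<Sum>l\<in>{1..L}. cnj (m l \<xi>) * m' l \<xi>) = 0" "(\<Sum>l\<in>{1..L}. cnj (m l (\<xi> + s)) * m' l \<xi>) = 0"
proof -
  note i = adjoint_mult_index[OF mask_matrix_dim(2) mask_matrix_dim(2)]
  have re: "(\<Sum>l\<in>{1..L}. h l) = (\<Sum>l<L. h (Suc l))" for h :: "nat \<Rightarrow> complex"
    by (rule sum.reindex_bij_witness[of _ Suc "\<lambda>l. l - 1"]) auto
  have "(\<Sum>l<L. cnj (mask_matrix0 m L s \<xi> $$ (l, 0)) * mask_matrix0 m' L s \<xi> $$ (l, 0)) = 0"
    using arg_cong[OF assms, of "\<lambda>A. A $$ (0, 0)"] by (subst i[symmetric]) auto
  then show "(\<Sum>l\<in>{1..L}. cnj (m l \<xi>) * m' l \<xi>) = 0" unfolding re by (simp add: mask_matrix0_def mask_matrix_def)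
  have "(\<Sum>l<L. cnj (mask_matrix0 m L s \<xi> $$ (l, 1)) * mask_matrix0 m' L s \<xi> $$ (l, 0)) = 0"
    using arg_cong[OF assms, of "\<lambda>A. A $$ (1, 0)"] by (subst i[symmetric]) auto
  then show "(\<Sum>l\<in>{1..L}. cnj (m l (\<xi> + s)) * m' l \<xi>) = 0" unfolding re by (simp add: mask_matrix0_def mask_matrix_def)
qed

theorem theorem3p2:
  fixes M :: "'a::local_field measure"
    and p c q L :: nat
    and \<pp> :: 'a
    and \<zeta> u :: "nat \<Rightarrow> 'a"
    and chi \<phi>0 \<phi>0' :: "'a \<Rightarrow> complex"
    and m m' \<psi> \<phi> :: "nat \<Rightarrow> 'a \<Rightarrow> complex"
  defines "u \<equiv> coset_rep p c \<pp> \<zeta>"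
  assumes standing: "local_field_setup M p c q \<pp> \<zeta> chi"
    and phi_L2: "\<phi>0 \<in> L2 M" "\<phi>0' \<in> L2 M"
    and phi_supp: "compactly_supported M \<phi>0" "compactly_supported M \<phi>0'"
    and phi_hat_0: "fourier_integral M chi \<phi>0 0 = 1" "fourier_integral M chi \<phi>0' 0 = 1"
    and masks: "\<And>l. l \<le> L \<Longrightarrow> is_mask M q chi u (m l)" "\<And>l. l \<le> L \<Longrightarrow> is_mask M q chi u (m' l)"
    and refinable:
      "AE \<xi> in M. fourier_integral M chi \<phi>0 \<xi> = m 0 (\<pp> * \<xi>) * fourier_integral M chi \<phi>0 (\<pp> * \<xi>)"
      "AE \<xi> in M. fourier_integral M chi \<phi>0' \<xi> = m' 0 (\<pp> * \<xi>) * fourier_integral M chi \<phi>0' (\<pp> * \<xi>)"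
    and unitary:
      "\<And>k. k \<in> {1..q - 1} \<Longrightarrow> AE \<xi> in M.
         mat_adjoint (mask_matrix m L (\<pp> * u k) \<xi>) * mask_matrix m L (\<pp> * u k) \<xi> = 1\<^sub>m 2"
      "\<And>k. k \<in> {1..q - 1} \<Longrightarrow> AE \<xi> in M.
         mat_adjoint (mask_matrix m' L (\<pp> * u k) \<xi>) * mask_matrix m' L (\<pp> * u k) \<xi> = 1\<^sub>m 2"
    and mixed:
      "\<And>k. k \<in> {1..q - 1} \<Longrightarrow> AE \<xi> in M.
         mat_adjoint (mask_matrix0 m L (\<pp> * u k) \<xi>) * mask_matrix0 m' L (\<pp> * u k) \<xi> = 0\<^sub>m 2 2"
    and psi: "\<And>l. l \<in> {1..L} \<Longrightarrow>
      has_fourier_transform M chi (\<psi> l) (\<lambda>\<xi>. m l (\<pp> * \<xi>) * fourier_integral M chi \<phi>0 (\<pp> * \<xi>))"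
    and phi: "\<And>l. l \<in> {1..L} \<Longrightarrow>
      has_fourier_transform M chi (\<phi> l) (\<lambda>\<xi>. m' l (\<pp> * \<xi>) * fourier_integral M chi \<phi>0' (\<pp> * \<xi>))"
  shows "parseval_wavelet_frame M q \<pp> u L \<psi> \<and> parseval_wavelet_frame M q \<pp> u L \<phi> \<and>
         orthogonal_wavelet_systems M q \<pp> u L \<psi> \<phi>"
proof -
  interpret K: local_field_setup M p c q \<pp> \<zeta> chi by (rule standing)
  have rel: "K.mask_relation {..L} m m 1"
    unfolding K.mask_relation_def
  proof
    fix k assume "k \<in> {1..q - 1}"
    from unitary(1)[OF this]
    show "AE \<xi> in M. (\<Sum>l\<le>L. cnj (m l \<xi>) * m l \<xi>) = 1 \<and> (\<Sum>l\<le>L. cnj (m l (\<xi> + \<pp> * K.u k)) * m l \<xi>) = 0"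
      unfolding u_def by eventually_elim (use unitary_columns in blast)
  qed
  have rel': "K.mask_relation {..L} m' m' 1"
    unfolding K.mask_relation_def
  proof
    fix k assume "k \<in> {1..q - 1}"
    from unitary(2)[OF this]
    show "AE \<xi> in M. (\<Sum>l\<le>L. cnj (m' l \<xi>) * m' l \<xi>) = 1 \<and> (\<Sum>l\<le>L. cnj (m' l (\<xi> + \<pp> * K.u k)) * m' l \<xi>) = 0"
      unfolding u_def by eventually_elim (use unitary_columns in blast)
  qed
  have rel0: "K.mask_relation {1..L} m m' 0"
    unfolding K.mask_relation_def
  proof
    fix k assume "k \<in> {1..q - 1}"
    from mixed[OF this]
    show "AE \<xi> in M. (\<Sum>l\<in>{1..L}. cnj (m l \<xi>) * m' l \<xi>) = 0 \<and> (\<Sum>l\<in>{1..L}. cnj (m l (\<xi> + \<pp> * K.u k)) * m' l \<xi>) = 0"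
      unfolding u_def by eventually_elim (use orthogonal_columns in blast)
  qed
  interpret X: extension_principle M p c q \<pp> \<zeta> chi L \<phi>0 m \<psi>
    by unfold_locales (use phi_L2 phi_supp phi_hat_0 masks refinable rel psi in \<open>auto simp: u_def\<close>)
  interpret Y: extension_principle M p c q \<pp> \<zeta> chi L \<phi>0' m' \<phi>
    by unfold_locales (use phi_L2 phi_supp phi_hat_0 masks refinable rel' phi in \<open>auto simp: u_def\<close>)
  interpret XY: orthogonal_extension_pair M p c q \<pp> \<zeta> chi L \<phi>0 m \<psi> \<phi>0' m' \<phi>
    by unfold_locales (rule rel0)
  show ?thesis
    unfolding u_def using X.parseval_frame Y.parseval_frame XY.orthogonal_systems by blast
qed

end
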